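(* Let $C_4$ be a cyclic group of order $4$. There is an isomorphism of graded rings $$R^*_{\mathbb C}(C_4\times C_4)\cong\frac{\mathbb Z[x,y]}{(4x,\ 4y,\ 2x^2y+2xy^2,\ x^4y^2-x^2y^4)},\qquad |x|=|y|=1,$$ and therefore $$R^*_{\mathbb C}(C_4\times C_4)\otimes\mathbb F_2\cong\frac{\mathbb F_2[x,y]}{(x^4y^2+x^2y^4)}.$$
   Context: Let $G$ be a finite group. $R_{\mathbb C}(G)$ is the ring of virtual complex characters of $G$ (the free abelian group on the irreducible complex characters, with product induced by tensor product), with augmentation $\epsilon:R_{\mathbb C}(G)\to\mathbb Z$ the degree map and $I=\ker\epsilon$. Exterior powers of representations give maps $\lambda^n$ on characters, extended to $R_{\mathbb C}(G)$ by requiring $\lambda^0=1$ and $\lambda^n(x+y)=\sum_{i+j=n}\lambda^i(x)\lambda^j(y)$. Put $\gamma^n(x)=\lambda^n(x+n-1)$. Let $\Gamma^n\subseteq R_{\mathbb C}(G)$ be the additive subgroup generated by all products $\gamma^{i_1}(x_1)\cdots\gamma^{i_r}(x_r)$ with $x_j\in I$ and $\sum_j i_j\ge n$; then $\Gamma^0=R_{\mathbb C}(G)$, $\Gamma^1=I$, $\Gamma^m\Gamma^n\subseteq\Gamma^{m+n}$. The graded character ring is $R^*_{\mathbb C}(G)=\bigoplus_{n\ge0}\Gamma^n/\Gamma^{n+1}$. $|x|$ denotes the degree of a homogeneous element $x$. *)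

theory Defs
  imports
    "Jordan_Normal_Form.Determinant"
    "Jordan_Normal_Form.VS_Connect"
    "HOL-Algebra.Elementary_Groups"
    "HOL-Algebra.Free_Abelian_Groups"
    "HOL-Algebra.Generated_Groups"
    "HOL-Algebra.QuotRing"
    "HOL-Library.Poly_Mapping"
    "HOL-Library.Product_Plus"
    "HOL-Library.Z2"
begin

section \<open>Complex representations and their characters\<close>

text \<open>An $n$-dimensional representation is a homomorphism into $GL_n(\mathbb{C})$, the group of
  units of the matrix ring.  The case $n = 0$ is allowed.\<close>

definition representations ::
    "('g, 'm) monoid_scheme \<Rightarrow> nat \<Rightarrow> ('g \<Rightarrow> complex mat) set" where
  "representations G n = hom G (units_of (ring_mat TYPE(complex) n ()))"

definition irreducible_rep ::
    "('g, 'm) monoid_scheme \<Rightarrow> nat \<Rightarrow> ('g \<Rightarrow> complex mat) \<Rightarrow> bool" where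
  "irreducible_rep G n \<rho> \<longleftrightarrow>
     \<rho> \<in> representations G n \<and> n > 0 \<and>
     (\<forall>W. VectorSpace.subspace class_ring W (module_vec TYPE(complex) n) \<longrightarrow>
          (\<forall>g\<in>carrier G. \<forall>w\<in>W. \<rho> g *\<^sub>v w \<in> W) \<longrightarrow>
          W = {0\<^sub>v n} \<or> W = carrier_vec n)"

definition mat_trace :: "'a::comm_monoid_add mat \<Rightarrow> 'a" where
  "mat_trace A = (\<Sum>i<dim_row A. A $$ (i, i))"

definition rep_char ::
    "('g, 'm) monoid_scheme \<Rightarrow> ('g \<Rightarrow> complex mat) \<Rightarrow> ('g \<Rightarrow> complex)" where
  "rep_char G \<rho> = (\<lambda>g\<in>carrier G. mat_trace (\<rho> g))"

text \<open>The basis $e_J = e_{j_1} \wedge \dots \wedge e_{j_k}$ ($j_1 < \dots < j_k < n$) of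
  $\Lambda^k(\mathbb{C}^n)$, listed by the increasing index lists $J$.\<close>

definition ext_basis :: "nat \<Rightarrow> nat \<Rightarrow> nat list list" where
  "ext_basis n k = filter (\<lambda>J. length J = k) (subseqs [0..<n])"

text \<open>The matrix of $\Lambda^k A$ in this basis: since
  $Ae_{j_1} \wedge \dots \wedge Ae_{j_k} = \sum_I \det(A_{I,J})\, e_I$, its entries are the
  $k \times k$ minors of $A$.\<close>

definition exterior_power :: "nat \<Rightarrow> 'a::comm_ring_1 mat \<Rightarrow> 'a mat" where
  "exterior_power k A =
     (let B = ext_basis (dim_row A) k in
      mat (length B) (length B)
        (\<lambda>(s, t). det (mat k k (\<lambda>(p, q). A $$ (B ! s ! p, B ! t ! q)))))"


section \<open>The ring of virtual characters\<close>

definition fun_ring :: "'g set \<Rightarrow> ('g \<Rightarrow> complex) ring" where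
  "fun_ring X =
     \<lparr>carrier = X \<rightarrow>\<^sub>E UNIV,
      mult = (\<lambda>f h. \<lambda>g\<in>X. f g * h g), one = (\<lambda>g\<in>X. 1),
      ring.zero = (\<lambda>g\<in>X. 0), add = (\<lambda>f h. \<lambda>g\<in>X. f g + h g)\<rparr>"

text \<open>Irreducible characters are linearly independent functions on $G$, so the free abelian group
  on them is their integral span inside the functions; the character of a tensor product is the
  pointwise product.\<close>

definition char_ring :: "('g, 'm) monoid_scheme \<Rightarrow> ('g \<Rightarrow> complex) ring" where
  "char_ring G = (fun_ring (carrier G))
     \<lparr>carrier := generate (add_monoid (fun_ring (carrier G)))
                  {rep_char G \<rho> | n \<rho>. irreducible_rep G n \<rho>}\<rparr>"

text \<open>The degree of a virtual character, as a complex number (always an integer): the dimension of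
  a representation is the value of its character at the identity.\<close>

definition char_degree :: "('g, 'm) monoid_scheme \<Rightarrow> ('g \<Rightarrow> complex) \<Rightarrow> complex" where
  "char_degree G x = x \<one>\<^bsub>G\<^esub>"

definition aug_ideal :: "('g, 'm) monoid_scheme \<Rightarrow> ('g \<Rightarrow> complex) set" where
  "aug_ideal G = {x \<in> carrier (char_ring G). char_degree G x = 0}"


section \<open>Lambda and gamma operations, and the gamma filtration\<close>

definition is_lambda ::
    "('g, 'm) monoid_scheme \<Rightarrow> (nat \<Rightarrow> ('g \<Rightarrow> complex) \<Rightarrow> ('g \<Rightarrow> complex)) \<Rightarrow> bool" where
  "is_lambda G lam \<longleftrightarrow>
     (\<forall>k. lam k \<in> carrier (char_ring G) \<rightarrow>\<^sub>E carrier (char_ring G)) \<and>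
     (\<forall>k n. \<forall>\<rho>\<in>representations G n.
        lam k (rep_char G \<rho>) = rep_char G (\<lambda>g. exterior_power k (\<rho> g))) \<and>
     (\<forall>x\<in>carrier (char_ring G). lam 0 x = \<one>\<^bsub>char_ring G\<^esub>) \<and>
     (\<forall>k. \<forall>x\<in>carrier (char_ring G). \<forall>y\<in>carrier (char_ring G).
        lam k (x \<oplus>\<^bsub>char_ring G\<^esub> y) =
          (\<Oplus>\<^bsub>char_ring G\<^esub>i\<in>{..k}. lam i x \<otimes>\<^bsub>char_ring G\<^esub> lam (k - i) y))"

text \<open>For finite \<open>G\<close> there is exactly one such family: the generating series in \<open>lam\<close> turn sums
  into products and have constant term 1, so they are determined by their values on characters.\<close>

definition lambda_op ::
    "('g, 'm) monoid_scheme \<Rightarrow> nat \<Rightarrow> ('g \<Rightarrow> complex) \<Rightarrow> ('g \<Rightarrow> complex)" where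
  "lambda_op G = (THE lam. is_lambda G lam)"

definition gamma_op ::
    "('g, 'm) monoid_scheme \<Rightarrow> nat \<Rightarrow> ('g \<Rightarrow> complex) \<Rightarrow> ('g \<Rightarrow> complex)" where
  "gamma_op G n x =
     lambda_op G n (x \<oplus>\<^bsub>char_ring G\<^esub> add_pow (char_ring G) (int n - 1) \<one>\<^bsub>char_ring G\<^esub>)"

definition gamma_filtration :: "('g, 'm) monoid_scheme \<Rightarrow> nat \<Rightarrow> ('g \<Rightarrow> complex) set" where
  "gamma_filtration G n = generate (add_monoid (char_ring G))
     {(\<Otimes>\<^bsub>char_ring G\<^esub>j\<in>{..<r}. gamma_op G (i j) (x j)) | (r::nat) i x.
        (\<forall>j<r. x j \<in> aug_ideal G) \<and> (\<Sum>j<r. i j) \<ge> n}"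


section \<open>Graded rings\<close>

text \<open>The ring $\bigoplus_n F^n/F^{n+1}$ of a multiplicative filtration by ideals.  An element is
  the family of its homogeneous components; the zero of $F^n/F^{n+1}$ is the coset $F^{n+1}$.
  In a product, \<open>rcoset_mult R (F (Suc n))\<close> sends the cosets of $a \in F^i$ and $b \in F^{n-i}$ to
  the coset of $ab$ modulo $F^{n+1}$, and these cosets are summed over $i$.\<close>

definition assoc_graded :: "('a, 'm) ring_scheme \<Rightarrow> (nat \<Rightarrow> 'a set) \<Rightarrow> (nat \<Rightarrow> 'a set) ring" where
  "assoc_graded R F =
     \<lparr>carrier = {u. (\<forall>n. u n \<in> (\<lambda>a. F (Suc n) +>\<^bsub>R\<^esub> a) ` F n) \<and> finite {n. u n \<noteq> F (Suc n)}},
      mult = (\<lambda>u v n. finprod (R A_Mod F (Suc n))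
                (\<lambda>i. rcoset_mult R (F (Suc n)) (u i) (v (n - i))) {..n}),
      one = (\<lambda>n. if n = 0 then F 1 +>\<^bsub>R\<^esub> \<one>\<^bsub>R\<^esub> else F (Suc n)),
      ring.zero = (\<lambda>n. F (Suc n)),
      add = (\<lambda>u v n. u n <+>\<^bsub>R\<^esub> v n)\<rparr>"

definition assoc_graded_part ::
    "('a, 'm) ring_scheme \<Rightarrow> (nat \<Rightarrow> 'a set) \<Rightarrow> nat \<Rightarrow> (nat \<Rightarrow> 'a set) set" where
  "assoc_graded_part R F n = {u \<in> carrier (assoc_graded R F). \<forall>m. m \<noteq> n \<longrightarrow> u m = F (Suc m)}"

definition graded_char_ring ::
    "('g, 'm) monoid_scheme \<Rightarrow> (nat \<Rightarrow> ('g \<Rightarrow> complex) set) ring" where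
  "graded_char_ring G = assoc_graded (char_ring G) (gamma_filtration G)"

definition graded_char_part ::
    "('g, 'm) monoid_scheme \<Rightarrow> nat \<Rightarrow> (nat \<Rightarrow> ('g \<Rightarrow> complex) set) set" where
  "graded_char_part G = assoc_graded_part (char_ring G) (gamma_filtration G)"

text \<open>A graded ring is given by a ring and its homogeneous parts.\<close>

definition graded_isomorphic ::
    "('a, 'm) ring_scheme \<Rightarrow> (nat \<Rightarrow> 'a set) \<Rightarrow> ('b, 'n) ring_scheme \<Rightarrow> (nat \<Rightarrow> 'b set) \<Rightarrow> bool" where
  "graded_isomorphic A dA B dB \<longleftrightarrow> (\<exists>h\<in>ring_iso A B. \<forall>n. h ` dA n = dB n)"

definition quot_part ::
    "('a, 'm) ring_scheme \<Rightarrow> 'a set \<Rightarrow> (nat \<Rightarrow> 'a set) \<Rightarrow> nat \<Rightarrow> 'a set set" where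
  "quot_part R I d n = (\<lambda>a. I +>\<^bsub>R\<^esub> a) ` d n"


section \<open>Polynomials in two variables\<close>

text \<open>$A[x,y]$ is the monoid ring over the exponent monoid $\mathbb{N}^2$, with the convolution
  product of \<^type>\<open>poly_mapping\<close>.\<close>

type_synonym 'a poly2 = "(nat \<times> nat) \<Rightarrow>\<^sub>0 'a"

definition var_x :: "'a::comm_ring_1 poly2" where
  "var_x = Poly_Mapping.single (1, 0) 1"

definition var_y :: "'a::comm_ring_1 poly2" where
  "var_y = Poly_Mapping.single (0, 1) 1"

definition homogeneous :: "nat \<Rightarrow> 'a::comm_ring_1 poly2 set" where
  "homogeneous n = {p. \<forall>(i, j)\<in>Poly_Mapping.keys p. i + j = n}"

definition poly2_quot :: "'a::comm_ring_1 poly2 set \<Rightarrow> 'a poly2 set ring" where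
  "poly2_quot S = class_ring Quot (Idl\<^bsub>class_ring\<^esub> S)"

definition poly2_quot_part :: "'a::comm_ring_1 poly2 set \<Rightarrow> nat \<Rightarrow> 'a poly2 set set" where
  "poly2_quot_part S = quot_part class_ring (Idl\<^bsub>class_ring\<^esub> S) homogeneous"


section \<open>Tensor products of commutative rings over the integers\<close>

text \<open>The free abelian group on pairs, with $(a,b)(a',b') = (aa',bb')$ extended bilinearly; the
  biadditivity relations already span an ideal of it.\<close>

definition pair_ring ::
    "('a, 'm) ring_scheme \<Rightarrow> ('b, 'n) ring_scheme \<Rightarrow> (('a \<times> 'b) \<Rightarrow>\<^sub>0 int) ring" where
  "pair_ring A B =
     \<lparr>carrier = carrier (free_Abelian_group (carrier A \<times> carrier B)),
      mult = (\<lambda>c d. frag_extend (\<lambda>(a, b).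
                frag_extend (\<lambda>(a', b'). frag_of (a \<otimes>\<^bsub>A\<^esub> a', b \<otimes>\<^bsub>B\<^esub> b')) d) c),
      one = frag_of (\<one>\<^bsub>A\<^esub>, \<one>\<^bsub>B\<^esub>), ring.zero = 0, add = (+)\<rparr>"

definition tensor_relations ::
    "('a, 'm) ring_scheme \<Rightarrow> ('b, 'n) ring_scheme \<Rightarrow> (('a \<times> 'b) \<Rightarrow>\<^sub>0 int) set" where
  "tensor_relations A B =
     {frag_of (a \<oplus>\<^bsub>A\<^esub> a', b) - frag_of (a, b) - frag_of (a', b) | a a' b.
        a \<in> carrier A \<and> a' \<in> carrier A \<and> b \<in> carrier B} \<union>
     {frag_of (a, b \<oplus>\<^bsub>B\<^esub> b') - frag_of (a, b) - frag_of (a, b') | a b b'.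
        a \<in> carrier A \<and> b \<in> carrier B \<and> b' \<in> carrier B}"

definition tensor_ring ::
    "('a, 'm) ring_scheme \<Rightarrow> ('b, 'n) ring_scheme \<Rightarrow> (('a \<times> 'b) \<Rightarrow>\<^sub>0 int) set ring" where
  "tensor_ring A B = pair_ring A B Quot (Idl\<^bsub>pair_ring A B\<^esub> (tensor_relations A B))"

text \<open>The grading of $A \otimes B$ induced by a grading of $A$, with $B$ in degree 0.\<close>

definition tensor_part ::
    "('a, 'm) ring_scheme \<Rightarrow> (nat \<Rightarrow> 'a set) \<Rightarrow> ('b, 'n) ring_scheme \<Rightarrow>
     nat \<Rightarrow> (('a \<times> 'b) \<Rightarrow>\<^sub>0 int) set set" where
  "tensor_part A dA B =
     quot_part (pair_ring A B) (Idl\<^bsub>pair_ring A B\<^esub> (tensor_relations A B))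
       (\<lambda>n. carrier (free_Abelian_group (dA n \<times> carrier B)))"

end

theory Submission
  imports
    Defs
    "HOL-Algebra.Multiplicative_Group"
    "HOL-Computational_Algebra.Polynomial_FPS"
    "Jordan_Normal_Form.Char_Poly"
begin

text \<open>All representations of $G = C_4 \times C_4$ are controlled by the 16 linear characters: the
  isotypic projections of \<open>\<rho>\<close> give $\det(1 + t\rho(g)) = \prod_\chi (1 + t\chi(g))^{m_\chi}$, whose
  coefficients are the characters of the exterior powers.  Hence $\gamma_t(\chi - 1) = 1 + (\chi - 1)t$
  and $\Gamma^n$ is the $n$-th power of the augmentation ideal, which is generated by $u = X - 1$ and
  $v = Y - 1$ for the two coordinate characters $X$ and $Y$.  So the graded character ring is
  $\mathbb{Z}[x,y]$ modulo the leading forms of the polynomials vanishing at the 16 points $(u(g), v(g))$.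

  A homogeneous $f = \sum_b f_b x^{n-b}y^b$ that agrees on the points with a polynomial of order
  greater than $n$ is constrained as follows: restriction to the lines $v = 0$, $u = 0$, $u = v$ gives
  $4 \mid f_0, f_n, \sum_b f_b$; the $(i-1)$-adic orders at $(i,\pm i)$ and at $(i,\pm 1)$,
  $(\pm 1,i)$ give that $\sum_{b \text{ odd}} f_b$, $f_1$ and $f_{n-1}$ are even.  These
  conditions already put $f$ into the ideal of the four relations.\<close>

section \<open>Polynomials in two variables\<close>

text \<open>The multiplicities in the determinant formula have to be the same for all g. Eigenvalues
  of a single matrix rho(g) would not give this; the projections do, because they are built from the
  whole representation. The obstacle is that leading forms of generators do not generate the leading
  forms of an ideal. The polynomials vanishing at the points are generated by (1+u)^4 - 1 and
  (1+v)^4 - 1, whose leading forms are only 4u and 4v; the other two relations arise by cancellation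
  in combinations, and it must be excluded that cancellation yields more. The congruences on the
  coefficients do this by a matching count: in each degree n >= 5 they cut out a lattice of index
  4^3 * 2^3 = 512, while the relations leave at most 512 classes, namely 4 * 4 for x^n and y^n and
  32 for the span of x^(n-1)y, x^(n-2)y^2, x^(n-3)y^3 and xy^(n-1), which share one double, of order
  at most 2.\<close>

text \<open>For identities additive in each polynomial: nested inductions leave only the case of
  monomials.\<close>

lemma poly_mapping_add_induct [case_names single add]:
  fixes p :: "'a \<Rightarrow>\<^sub>0 'b::ab_group_add"
  assumes "\<And>k c. Q (Poly_Mapping.single k c)" and "\<And>p q. Q p \<Longrightarrow> Q q \<Longrightarrow> Q (p + q)"
  shows "Q p"
proof -
  have *: "Q (\<Sum>k\<in>K. Poly_Mapping.single k (f k))" if "finite K" for K and f :: "'a \<Rightarrow> 'b"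
    using that
  proof (induction K)
    case empty
    show ?case using assms(1)[of undefined 0] by simp
  qed (simp add: assms)
  have "p = (\<Sum>k\<in>Poly_Mapping.keys p. Poly_Mapping.single k (Poly_Mapping.lookup p k))"
    by (rule poly_mapping_eqI)
       (auto simp: lookup_sum lookup_single when_def in_keys_iff sum.delta)
  with *[OF finite_keys] show ?thesis by metis
qed

text \<open>The target ring is left open because three are used: the complex numbers for values at
  points, the integers for directions of lines, and F_2[x,y] for reduction modulo 2.\<close>

definition poly2_eval :: "'b::comm_ring_1 \<Rightarrow> 'b \<Rightarrow> int poly2 \<Rightarrow> 'b" where
  "poly2_eval u v p =
     (\<Sum>k\<in>Poly_Mapping.keys p. of_int (Poly_Mapping.lookup p k) * (u ^ fst k * v ^ snd k))"

lemma poly2_eval_superset: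
  assumes "finite K" "Poly_Mapping.keys p \<subseteq> K"
  shows "poly2_eval u v p = (\<Sum>k\<in>K. of_int (Poly_Mapping.lookup p k) * (u ^ fst k * v ^ snd k))"
  unfolding poly2_eval_def
  by (rule sum.mono_neutral_left) (use assms in \<open>auto simp: in_keys_iff\<close>)

lemma poly2_eval_single: "poly2_eval u v (Poly_Mapping.single k c) = of_int c * (u ^ fst k * v ^ snd k)"
  by (subst poly2_eval_superset[of "{k}"]) auto

lemma poly2_eval_add: "poly2_eval u v (p + q) = poly2_eval u v p + poly2_eval u v q"
proof -
  let ?K = "Poly_Mapping.keys p \<union> Poly_Mapping.keys q"
  have "Poly_Mapping.keys (p + q) \<subseteq> ?K" by (rule keys_add)
  then show ?thesis
    by (simp add: poly2_eval_superset[of ?K] lookup_add distrib_right sum.distrib)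
qed

lemma poly2_eval_0 [simp]: "poly2_eval u v 0 = 0"
  by (simp add: poly2_eval_def)

lemma poly2_eval_uminus: "poly2_eval u v (- p) = - poly2_eval u v p"
  using poly2_eval_add[of u v p "- p"] by (simp add: eq_neg_iff_add_eq_0 add.commute)

lemma poly2_eval_diff: "poly2_eval u v (p - q) = poly2_eval u v p - poly2_eval u v q"
  using poly2_eval_add[of u v p "- q"] by (simp add: poly2_eval_uminus)

lemma poly2_eval_mult: "poly2_eval u v (p * q) = poly2_eval u v p * poly2_eval u v q"
proof (induction p rule: poly_mapping_add_induct)
  case (single k c)
  show ?case
    by (induction q rule: poly_mapping_add_induct)
       (simp_all add: mult_single poly2_eval_single poly2_eval_add power_add algebra_simps)
qed (simp add: poly2_eval_add algebra_simps)

lemma poly2_eval_of_int: "poly2_eval u v (of_int c) = of_int c"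
proof -
  have "(of_int c :: int poly2) = Poly_Mapping.single 0 c" by (metis of_int_eq_id id_apply single_of_int)
  then show ?thesis by (simp only: poly2_eval_single) simp
qed

lemma poly2_eval_1 [simp]: "poly2_eval u v 1 = 1"
  using poly2_eval_of_int[of u v 1] by simp

lemma poly2_eval_numeral [simp]: "poly2_eval u v (numeral n) = numeral n"
  using poly2_eval_of_int[of u v "numeral n"] by simp

lemma poly2_eval_power: "poly2_eval u v (p ^ n) = poly2_eval u v p ^ n"
  by (induction n) (simp_all add: poly2_eval_mult)

lemma poly2_eval_sum: "poly2_eval u v (sum f A) = (\<Sum>x\<in>A. poly2_eval u v (f x))"
  by (induction A rule: infinite_finite_induct) (simp_all add: poly2_eval_add)

lemma poly2_eval_var [simp]: "poly2_eval u v var_x = u" "poly2_eval u v var_y = v"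
  by (simp_all add: var_x_def var_y_def poly2_eval_single)

lemmas poly2_eval_simps = poly2_eval_add poly2_eval_diff poly2_eval_uminus poly2_eval_mult
  poly2_eval_power poly2_eval_of_int

section \<open>Monomials, order and homogeneous components\<close>

lemma var_power_mult:
  "(var_x :: 'a::comm_ring_1 poly2) ^ a * var_y ^ b = Poly_Mapping.single (a, b) 1"
proof -
  have "(var_x :: 'a poly2) ^ a = Poly_Mapping.single (a, 0) 1"
    by (induction a) (simp_all add: var_x_def mult_single zero_prod_def flip: single_one)
  moreover have "(var_y :: 'a poly2) ^ b = Poly_Mapping.single (0, b) 1"
    by (induction b) (simp_all add: var_y_def mult_single zero_prod_def flip: single_one)
  ultimately show ?thesis by (simp add: mult_single)
qed

text \<open>This is the n-th power of the ideal (x, y), the model of the gamma filtration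
  upstairs.\<close>

definition order_ge :: "nat \<Rightarrow> 'a::comm_ring_1 poly2 set" where
  "order_ge n = {p. \<forall>k\<in>Poly_Mapping.keys p. n \<le> fst k + snd k}"

lemma order_ge_0 [simp]: "p \<in> order_ge 0"
  by (simp add: order_ge_def)

lemma order_ge_zero [simp]: "0 \<in> order_ge n"
  by (simp add: order_ge_def)

lemma order_ge_add: "p \<in> order_ge n \<Longrightarrow> q \<in> order_ge n \<Longrightarrow> p + q \<in> order_ge n"
  using keys_add[of p q] unfolding order_ge_def by blast

lemma order_ge_uminus: "p \<in> order_ge n \<Longrightarrow> - p \<in> order_ge n"
  by (simp add: order_ge_def in_keys_iff)

lemma order_ge_diff: "p \<in> order_ge n \<Longrightarrow> q \<in> order_ge n \<Longrightarrow> p - q \<in> order_ge n"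
  using order_ge_add[of p n "- q"] order_ge_uminus[of q n] by simp

lemma order_ge_sum: "(\<And>x. x \<in> A \<Longrightarrow> f x \<in> order_ge n) \<Longrightarrow> sum f A \<in> order_ge n"
  by (induction A rule: infinite_finite_induct) (simp_all add: order_ge_add)

lemma order_ge_mono: "p \<in> order_ge n \<Longrightarrow> m \<le> n \<Longrightarrow> p \<in> order_ge m"
  unfolding order_ge_def by (blast intro: le_trans)

lemma order_ge_mult:
  assumes "p \<in> order_ge m" "q \<in> order_ge n"
  shows "p * q \<in> order_ge (m + n)"
  unfolding order_ge_def
proof safe
  fix a b assume "(a, b) \<in> Poly_Mapping.keys (p * q)"
  then obtain k l where "k \<in> Poly_Mapping.keys p" "l \<in> Poly_Mapping.keys q" "(a, b) = k + l"
    using keys_mult[of p q] by blast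
  with assms show "m + n \<le> fst (a, b) + snd (a, b)"
    by (auto simp: order_ge_def dest!: bspec)
qed

lemma order_ge_mult_left: "q \<in> order_ge n \<Longrightarrow> p * q \<in> order_ge n"
  using order_ge_mult[of p 0 q n] by simp

lemma order_ge_power: "p \<in> order_ge m \<Longrightarrow> p ^ n \<in> order_ge (m * n)"
  by (induction n) (simp_all add: order_ge_mult)

lemma order_ge_single: "Poly_Mapping.single (a, b) c \<in> order_ge (a + b)"
  by (simp add: order_ge_def)

lemma order_ge_var: "var_x \<in> order_ge 1" "var_y \<in> order_ge 1"
  by (simp_all add: order_ge_def var_x_def var_y_def)

definition homog_part :: "nat \<Rightarrow> 'a::comm_ring_1 poly2 \<Rightarrow> 'a poly2" where
  "homog_part n p = (\<Sum>k | k \<in> Poly_Mapping.keys p \<and> fst k + snd k = n.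
                      Poly_Mapping.single k (Poly_Mapping.lookup p k))"

lemma lookup_homog_part:
  "Poly_Mapping.lookup (homog_part n p) k = (if fst k + snd k = n then Poly_Mapping.lookup p k else 0)"
  unfolding homog_part_def
  by (auto simp: lookup_sum lookup_single when_def in_keys_iff sum.delta)

lemma homog_part_add: "homog_part n (p + q) = homog_part n p + homog_part n q"
  by (rule poly_mapping_eqI) (simp add: lookup_homog_part lookup_add)

lemma homog_part_0 [simp]: "homog_part n 0 = 0"
  by (rule poly_mapping_eqI) (simp add: lookup_homog_part)

lemma homog_part_single:
  "homog_part n (Poly_Mapping.single k c) = (if fst k + snd k = n then Poly_Mapping.single k c else 0)"
  by (rule poly_mapping_eqI) (auto simp: lookup_homog_part lookup_single when_def)

lemma homog_part_1: "homog_part n 1 = (if n = 0 then 1 else 0)"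
  using homog_part_single[of n 0 "1 :: 'a"] by simp

text \<open>The right-hand side has the shape of the product in \<open>assoc_graded\<close>, which
  makes the passage to the graded ring multiplicative.\<close>

lemma homog_part_mult: "homog_part n (p * q) = (\<Sum>i\<le>n. homog_part i p * homog_part (n - i) q)"
proof (induction p rule: poly_mapping_add_induct)
  case (single k c)
  show ?case
  proof (induction q rule: poly_mapping_add_induct)
    case (single l d)
    have *: "(homog_part i (Poly_Mapping.single k c) * homog_part (n - i) (Poly_Mapping.single l d)
        = (if i = fst k + snd k then (if n = fst k + snd k + fst l + snd l
            then Poly_Mapping.single (k + l) (c * d) else 0) else 0))" if "i \<le> n" for i
      using that by (auto simp: homog_part_single mult_single)
    have "(\<Sum>i\<le>n. homog_part i (Poly_Mapping.single k c) * homog_part (n - i) (Poly_Mapping.single l d))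
      = (\<Sum>i\<le>n. (if i = fst k + snd k then (if n = fst k + snd k + fst l + snd l
            then Poly_Mapping.single (k + l) (c * d) else 0) else 0))"
      by (intro sum.cong refl *) simp
    also have "\<dots> = homog_part n (Poly_Mapping.single k c * Poly_Mapping.single l d)"
      by (auto simp: sum.delta mult_single homog_part_single)
    finally show ?case by simp
  qed (simp add: distrib_left homog_part_add sum.distrib)
qed (simp add: distrib_right homog_part_add sum.distrib)

lemma homog_part_homogeneous: "homog_part n p \<in> homogeneous n"
  unfolding homogeneous_def by (auto simp: in_keys_iff lookup_homog_part split: if_splits)

lemma homog_part_homogeneous_eq:
  assumes "p \<in> homogeneous m"
  shows "homog_part n p = (if n = m then p else 0)"
proof (rule poly_mapping_eqI)
  fix k
  have "Poly_Mapping.lookup p k = 0" if "fst k + snd k \<noteq> m"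
    using assms that by (cases k) (auto simp: homogeneous_def in_keys_iff)
  then show "Poly_Mapping.lookup (homog_part n p) k = Poly_Mapping.lookup (if n = m then p else 0) k"
    by (simp add: lookup_homog_part)
qed

lemma homogeneous_order_ge: "p \<in> homogeneous n \<Longrightarrow> p \<in> order_ge n"
  by (auto simp: homogeneous_def order_ge_def)

lemma homogeneous_add: "p \<in> homogeneous n \<Longrightarrow> q \<in> homogeneous n \<Longrightarrow> p + q \<in> homogeneous n"
  using keys_add[of p q] unfolding homogeneous_def by blast

lemma homogeneous_diff: "p \<in> homogeneous n \<Longrightarrow> q \<in> homogeneous n \<Longrightarrow> p - q \<in> homogeneous n"
  using keys_diff[of p q] unfolding homogeneous_def by blast

lemma order_geD: "p \<in> order_ge n \<Longrightarrow> fst k + snd k < n \<Longrightarrow> Poly_Mapping.lookup p k = 0"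
  unfolding order_ge_def by (metis (mono_tags, lifting) in_keys_iff mem_Collect_eq not_le)

lemma order_geI:
  assumes "\<And>k. fst k + snd k < n \<Longrightarrow> Poly_Mapping.lookup p k = 0"
  shows "p \<in> order_ge n"
  using assms unfolding order_ge_def mem_Collect_eq by (metis in_keys_iff not_le)

lemma homog_part_diff_order_ge: "p \<in> order_ge n \<Longrightarrow> p - homog_part n p \<in> order_ge (Suc n)"
  by (rule order_geI) (auto simp: lookup_minus lookup_homog_part less_Suc_eq dest: order_geD)

lemma sum_homog_part:
  assumes "\<And>k. k \<in> Poly_Mapping.keys p \<Longrightarrow> fst k + snd k \<le> N"
  shows "p = (\<Sum>n\<le>N. homog_part n p)"
proof (rule poly_mapping_eqI)
  fix k
  show "Poly_Mapping.lookup p k = Poly_Mapping.lookup (\<Sum>n\<le>N. homog_part n p) k"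
    using assms[of k] by (cases "k \<in> Poly_Mapping.keys p") (auto simp: lookup_sum lookup_homog_part in_keys_iff)
qed

lemma finite_homog_part: "finite {n. homog_part n p \<noteq> 0}"
proof (rule finite_subset)
  show "{n. homog_part n p \<noteq> 0} \<subseteq> (\<lambda>k. fst k + snd k) ` Poly_Mapping.keys p"
  proof
    fix n assume "n \<in> {n. homog_part n p \<noteq> 0}"
    then obtain k where "Poly_Mapping.lookup (homog_part n p) k \<noteq> 0"
      using poly_mapping_eqI[of "homog_part n p" 0] by auto
    then have "fst k + snd k = n" "k \<in> Poly_Mapping.keys p"
      by (simp_all add: lookup_homog_part in_keys_iff split: if_splits)
    then show "n \<in> (\<lambda>k. fst k + snd k) ` Poly_Mapping.keys p" by blast
  qed
qed simp

section \<open>Detecting leading forms at the points\<close>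

text \<open>The roots of (1 + u)^4 = 1, that is, the values of z - 1 at the fourth roots of unity
  z.\<close>

definition C4_values :: "complex set" where
  "C4_values = {0, \<i> - 1, - 2, - \<i> - 1}"

section \<open>Gaussian integers\<close>

definition gauss_ints :: "complex set" where
  "gauss_ints = {z. \<exists>a b. z = of_int a + of_int b * \<i>}"

lemma gauss_ints_add: "z \<in> gauss_ints \<Longrightarrow> w \<in> gauss_ints \<Longrightarrow> z + w \<in> gauss_ints"
  unfolding gauss_ints_def mem_Collect_eq
proof (elim exE)
  fix a b c d assume "z = of_int a + of_int b * \<i>" "w = of_int c + of_int d * \<i>"
  then have "z + w = of_int (a + c) + of_int (b + d) * \<i>" by (simp add: algebra_simps)
  then show "\<exists>a b. z + w = of_int a + of_int b * \<i>" by blast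
qed

lemma gauss_ints_mult: "z \<in> gauss_ints \<Longrightarrow> w \<in> gauss_ints \<Longrightarrow> z * w \<in> gauss_ints"
  unfolding gauss_ints_def mem_Collect_eq
proof (elim exE)
  fix a b c d assume "z = of_int a + of_int b * \<i>" "w = of_int c + of_int d * \<i>"
  then have "z * w = of_int (a * c - b * d) + of_int (a * d + b * c) * \<i>" by (simp add: algebra_simps)
  then show "\<exists>a b. z * w = of_int a + of_int b * \<i>" by blast
qed

lemma gauss_ints_of_int [simp]: "of_int a \<in> gauss_ints"
  unfolding gauss_ints_def by (rule CollectI, rule exI[of _ a], rule exI[of _ 0]) simp

lemma gauss_ints_0 [simp]: "0 \<in> gauss_ints" and gauss_ints_1 [simp]: "1 \<in> gauss_ints"
  using gauss_ints_of_int[of 0] gauss_ints_of_int[of 1] by simp_all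

lemma gauss_ints_ii [simp]: "\<i> \<in> gauss_ints"
  unfolding gauss_ints_def by (rule CollectI, rule exI[of _ 0], rule exI[of _ 1]) simp

lemma gauss_ints_uminus: "z \<in> gauss_ints \<Longrightarrow> - z \<in> gauss_ints"
  using gauss_ints_mult[OF gauss_ints_of_int[of "-1"], of z] by simp

lemma gauss_ints_diff: "z \<in> gauss_ints \<Longrightarrow> w \<in> gauss_ints \<Longrightarrow> z - w \<in> gauss_ints"
  using gauss_ints_add[OF _ gauss_ints_uminus, of z w] by simp

lemma gauss_ints_power: "z \<in> gauss_ints \<Longrightarrow> z ^ n \<in> gauss_ints"
  by (induction n) (simp_all add: gauss_ints_mult)

lemma gauss_ints_sum: "(\<And>x. x \<in> A \<Longrightarrow> f x \<in> gauss_ints) \<Longrightarrow> sum f A \<in> gauss_ints"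
  by (induction A rule: infinite_finite_induct) (simp_all add: gauss_ints_add)

lemmas gauss_ints_intros = gauss_ints_add gauss_ints_mult gauss_ints_uminus gauss_ints_diff
  gauss_ints_power gauss_ints_sum gauss_ints_of_int gauss_ints_0 gauss_ints_1 gauss_ints_ii

text \<open>Adding the term for u = 0 changes nothing for a positive exponent, and then the sum runs
  over a cyclic group: it is 4 times the multiplicity of the trivial character in a power of X - 1.
  The proof uses that the three numbers are the roots of u^3 + 4u^2 + 6u + 4, which gives an
  integral recurrence starting with -4, 4, -4.\<close>

lemma C4_power_sum:
  "\<exists>z::int. (\<i> - 1) ^ Suc m + (- 2) ^ Suc m + (- \<i> - 1) ^ Suc m = 4 * (of_int z :: complex)"
proof (induction m rule: less_induct)
  case (less m)
  let ?t = "\<lambda>m. (\<i> - 1) ^ Suc m + (- 2) ^ Suc m + (- \<i> - 1) ^ Suc m :: complex"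
  have rec: "?t (Suc (Suc (Suc k))) = - 4 * ?t (Suc (Suc k)) - 6 * ?t (Suc k) - 4 * ?t k" for k
  proof -
    have *: "u ^ Suc (Suc (Suc (Suc k)))
        = - 4 * u ^ Suc (Suc (Suc k)) - 6 * u ^ Suc (Suc k) - 4 * u ^ Suc k"
      if "u ^ 3 = - 4 * u\<^sup>2 - 6 * u - 4" for u :: complex
    proof -
      have "u ^ Suc (Suc (Suc (Suc k))) = u ^ Suc k * u ^ 3"
        by (simp add: power3_eq_cube)
      also have "\<dots> = - 4 * u ^ Suc (Suc (Suc k)) - 6 * u ^ Suc (Suc k) - 4 * u ^ Suc k"
        by (subst that) (simp add: algebra_simps power2_eq_square)
      finally show ?thesis .
    qed
    have "(\<i> - 1) ^ 3 = - 4 * (\<i> - 1)\<^sup>2 - 6 * (\<i> - 1) - (4::complex)"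
      "(- \<i> - 1) ^ 3 = - 4 * (- \<i> - 1)\<^sup>2 - 6 * (- \<i> - 1) - (4::complex)"
      "(- 2) ^ 3 = - 4 * (- 2)\<^sup>2 - 6 * (- 2) - (4::complex)"
      by (simp_all add: power3_eq_cube power2_eq_square algebra_simps)
    note this[THEN *]
    then show ?thesis by (simp only:) (simp add: algebra_simps)
  qed
  consider "m = 0" | "m = 1" | "m = 2" | k where "m = Suc (Suc (Suc k))"
    by (metis One_nat_def Suc_1 not0_implies_Suc)
  then show ?case
  proof cases
    case 1 then show ?thesis by (intro exI[of _ "-1"]) simp
  next
    case 2 then show ?thesis by (intro exI[of _ "1"]) (simp add: algebra_simps)
  next
    case 3 then show ?thesis
      by (intro exI[of _ "-1"]) (simp add: algebra_simps power3_eq_cube numeral_2_eq_2)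
  next
    case (4 k)
    obtain a b c :: int where eqs: "?t k = 4 * of_int a" "?t (Suc k) = 4 * of_int b"
      "?t (Suc (Suc k)) = 4 * of_int c"
      using less[of k] less[of "Suc k"] less[of "Suc (Suc k)"] 4 by auto
    have "?t m = - 4 * (4 * of_int c) - 6 * (4 * of_int b) - 4 * (4 * of_int a)"
      by (simp only: 4 rec eqs)
    also have "\<dots> = 4 * of_int (- 4 * c - 6 * b - 4 * a)" by simp
    finally have "?t m = 4 * of_int (- 4 * c - 6 * b - 4 * a)" .
    then show ?thesis by blast
  qed
qed

text \<open>Along the line through $0$ with direction $(\alpha, \beta)$ a monomial of degree $d$ becomes
  a multiple of $u^d$; cancelling $u^n$ and summing over the three nonzero values of $u$ leaves
  three times the leading coefficient, up to a multiple of 4.\<close>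

lemma line_detection:
  fixes \<alpha> \<beta> :: int
  assumes F: "F \<in> homogeneous n" and P: "P \<in> order_ge (Suc n)"
    and eq: "\<And>u. u \<in> {\<i> - 1, - 2, - \<i> - 1} \<Longrightarrow>
      poly2_eval (of_int \<alpha> * u) (of_int \<beta> * u) F = poly2_eval (of_int \<alpha> * u) (of_int \<beta> * u) P"
  shows "4 dvd poly2_eval \<alpha> \<beta> F"
proof -
  define d where "d k = Poly_Mapping.lookup P k * (\<alpha> ^ fst k * \<beta> ^ snd k)" for k
  \<comment> \<open>Exponents are written as \<open>Suc (e k)\<close> because the congruence for
    power sums starts at exponent 1; the zeroth power sum is 3.\<close>
  define e where "e k = fst k + snd k - Suc n" for k :: "nat \<times> nat"
  have *: "of_int (poly2_eval \<alpha> \<beta> F) = (\<Sum>k\<in>Poly_Mapping.keys P. of_int (d k) * u ^ Suc (e k))"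
    if u: "u \<in> {\<i> - 1, - 2, - \<i> - 1}" for u :: complex
  proof -
    have nz: "u \<noteq> 0" using u by (auto simp: complex_eq_iff)
    have "poly2_eval (of_int \<alpha> * u) (of_int \<beta> * u) F = u ^ n * of_int (poly2_eval \<alpha> \<beta> F)"
      unfolding poly2_eval_def of_int_sum sum_distrib_left
    proof (rule sum.cong)
      fix k assume "k \<in> Poly_Mapping.keys F"
      then have "fst k + snd k = n" using F by (auto simp: homogeneous_def)
      then show "of_int (Poly_Mapping.lookup F k) * ((of_int \<alpha> * u) ^ fst k * (of_int \<beta> * u) ^ snd k)
        = u ^ n * of_int (of_int (Poly_Mapping.lookup F k) * (\<alpha> ^ fst k * \<beta> ^ snd k))"
        by (auto simp: power_mult_distrib power_add)
    qed simp
    moreover have "poly2_eval (of_int \<alpha> * u) (of_int \<beta> * u) P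
        = u ^ n * (\<Sum>k\<in>Poly_Mapping.keys P. of_int (d k) * u ^ Suc (e k))"
      unfolding poly2_eval_def sum_distrib_left
    proof (rule sum.cong)
      fix k assume "k \<in> Poly_Mapping.keys P"
      then have "fst k + snd k = n + Suc (e k)" using P by (auto simp: order_ge_def e_def)
      then have "u ^ fst k * u ^ snd k = u ^ n * u ^ Suc (e k)"
        by (metis power_add)
      then show "of_int (Poly_Mapping.lookup P k) * ((of_int \<alpha> * u) ^ fst k * (of_int \<beta> * u) ^ snd k)
        = u ^ n * (of_int (d k) * u ^ Suc (e k))"
        by (simp add: power_mult_distrib d_def mult_ac)
    qed simp
    ultimately show ?thesis using eq[OF u] nz by simp
  qed
  obtain z :: "nat \<Rightarrow> int" where
    z: "\<And>m. (\<i> - 1) ^ Suc m + (- 2) ^ Suc m + (- \<i> - 1) ^ Suc m = 4 * (of_int (z m) :: complex)"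
    using C4_power_sum by metis
  have "3 * of_int (poly2_eval \<alpha> \<beta> F) =
      (\<Sum>k\<in>Poly_Mapping.keys P. of_int (d k) * (\<i> - 1) ^ Suc (e k)) +
      (\<Sum>k\<in>Poly_Mapping.keys P. of_int (d k) * (- 2) ^ Suc (e k)) +
      (\<Sum>k\<in>Poly_Mapping.keys P. of_int (d k) * (- \<i> - 1) ^ Suc (e k) :: complex)"
    using *[of "\<i> - 1"] *[of "- 2"] *[of "- \<i> - 1"] by simp
  also have "\<dots> = (\<Sum>k\<in>Poly_Mapping.keys P. of_int (d k) *
      ((\<i> - 1) ^ Suc (e k) + (- 2) ^ Suc (e k) + (- \<i> - 1) ^ Suc (e k)))"
    by (simp only: distrib_left sum.distrib)
  also have "\<dots> = (\<Sum>k\<in>Poly_Mapping.keys P. of_int (d k) * (4 * of_int (z (e k))))"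
    by (simp only: z)
  also have "\<dots> = of_int (4 * (\<Sum>k\<in>Poly_Mapping.keys P. d k * z (e k)))"
    by (simp add: sum_distrib_left mult_ac)
  finally have "of_int (3 * poly2_eval \<alpha> \<beta> F)
      = (of_int (4 * (\<Sum>k\<in>Poly_Mapping.keys P. d k * z (e k))) :: complex)"
    by simp
  then have "3 * poly2_eval \<alpha> \<beta> F = 4 * (\<Sum>k\<in>Poly_Mapping.keys P. d k * z (e k))"
    unfolding of_int_eq_iff .
  then show ?thesis by presburger
qed

lemma homogeneous_expansion:
  assumes "F \<in> homogeneous n"
  shows "F = (\<Sum>b\<le>n. Poly_Mapping.single (n - b, b) (Poly_Mapping.lookup F (n - b, b)))"
proof (rule poly_mapping_eqI)
  fix k :: "nat \<times> nat"
  obtain a c where k: "k = (a, c)" by force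
  have "Poly_Mapping.lookup F k = 0" if "a + c \<noteq> n"
    using assms that by (auto simp: homogeneous_def in_keys_iff k)
  moreover have "(n - b = a \<and> b = c) = (b = c \<and> a + c = n)" if "b \<le> n" for b
    using that by auto
  then have "Poly_Mapping.lookup (\<Sum>b\<le>n. Poly_Mapping.single (n - b, b) (Poly_Mapping.lookup F (n - b, b))) k
     = (\<Sum>b\<le>n. if b = c then (if a + c = n then Poly_Mapping.lookup F (a, c) else 0) else 0)"
    unfolding lookup_sum lookup_single k by (intro sum.cong) (auto simp: when_def)
  ultimately show "Poly_Mapping.lookup F k = Poly_Mapping.lookup
      (\<Sum>b\<le>n. Poly_Mapping.single (n - b, b) (Poly_Mapping.lookup F (n - b, b))) k"
    by (auto simp: k sum.delta)
qed

lemma poly2_eval_homogeneous: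
  assumes "F \<in> homogeneous n"
  shows "poly2_eval u v F = (\<Sum>b\<le>n. of_int (Poly_Mapping.lookup F (n - b, b)) * (u ^ (n - b) * v ^ b))"
  by (subst homogeneous_expansion[OF assms]) (simp add: poly2_eval_sum poly2_eval_single)

text \<open>With u = i - 1 the two points are (u, u) and (u, iu). The difference of the two values
  of F is u^n times the sum of f_b (1 - i^b). For P every monomial contributes u^(n+1) times a
  factor 1 - i^b that is itself divisible by u, and u^2 = -2i. After cancelling u^n the sum is
  divisible by 2, and its real part modulo 2 sees exactly the odd b.\<close>

lemma parity_detection:
  assumes F: "F \<in> homogeneous n" and P: "P \<in> order_ge (Suc n)"
    and eq: "poly2_eval (\<i> - 1) (\<i> - 1) F = poly2_eval (\<i> - 1) (\<i> - 1) P"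
      "poly2_eval (\<i> - 1) (- \<i> - 1) F = poly2_eval (\<i> - 1) (- \<i> - 1) P"
  shows "even (\<Sum>b | b \<le> n \<and> odd b. Poly_Mapping.lookup F (n - b, b))"
proof -
  define u where "u = \<i> - 1"
  define f where "f b = Poly_Mapping.lookup F (n - b, b)" for b
  have v: "- \<i> - 1 = \<i> * u" by (simp add: u_def algebra_simps)
  have nz: "u \<noteq> 0" by (simp add: u_def complex_eq_iff)
  have "\<exists>w\<in>gauss_ints. 1 - \<i> ^ b = u * w" for b
  proof (induction b)
    case (Suc b)
    then obtain w where "w \<in> gauss_ints" "1 - \<i> ^ b = u * w" by blast
    have "1 - \<i> ^ Suc b = - u + \<i> * (1 - \<i> ^ b)" by (simp add: u_def algebra_simps)
    then have "1 - \<i> ^ Suc b = u * (- 1 + \<i> * w)"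
      using \<open>1 - \<i> ^ b = u * w\<close> by (simp add: algebra_simps)
    then show ?case using \<open>w \<in> gauss_ints\<close>
      by (intro bexI[of _ "- 1 + \<i> * w"]) (auto intro!: gauss_ints_intros)
  qed (auto intro: bexI[of _ 0])
  then obtain w where w: "\<And>b. w b \<in> gauss_ints" "\<And>b. 1 - \<i> ^ b = u * w b" by metis
  have u2: "u * u = - 2 * \<i>" by (simp add: u_def algebra_simps)
  have "poly2_eval u u F - poly2_eval u (\<i> * u) F = u ^ n * (\<Sum>b\<le>n. of_int (f b) * (1 - \<i> ^ b))"
    unfolding poly2_eval_homogeneous[OF F] sum_subtractf[symmetric] sum_distrib_left
  proof (intro sum.cong refl)
    fix b assume "b \<in> {..n}"
    then have "u ^ n = u ^ (n - b) * u ^ b" by (simp flip: power_add)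
    then show "of_int (Poly_Mapping.lookup F (n - b, b)) * (u ^ (n - b) * u ^ b) -
        of_int (Poly_Mapping.lookup F (n - b, b)) * (u ^ (n - b) * (\<i> * u) ^ b)
      = u ^ n * (of_int (f b) * (1 - \<i> ^ b))"
      by (simp add: f_def power_mult_distrib algebra_simps)
  qed
  moreover have "\<exists>z\<in>gauss_ints. poly2_eval u u P - poly2_eval u (\<i> * u) P = u ^ n * (2 * z)"
  proof
    define g where "g k = of_int (Poly_Mapping.lookup P k) * (u ^ (fst k + snd k - Suc n) * (- \<i> * w (snd k)))"
      for k
    show "(\<Sum>k\<in>Poly_Mapping.keys P. g k) \<in> gauss_ints"
      unfolding g_def u_def by (intro gauss_ints_intros w)
    show "poly2_eval u u P - poly2_eval u (\<i> * u) P = u ^ n * (2 * (\<Sum>k\<in>Poly_Mapping.keys P. g k))"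
      unfolding poly2_eval_def sum_subtractf[symmetric] sum_distrib_left
    proof (intro sum.cong refl)
      fix k assume "k \<in> Poly_Mapping.keys P"
      then have "fst k + snd k = Suc (fst k + snd k - Suc n) + n" using P by (auto simp: order_ge_def)
      then have e: "u ^ fst k * u ^ snd k = u * u ^ (fst k + snd k - Suc n) * u ^ n"
        by (metis power_add power_Suc)
      have "of_int (Poly_Mapping.lookup P k) * (u ^ fst k * u ^ snd k) -
          of_int (Poly_Mapping.lookup P k) * (u ^ fst k * (\<i> * u) ^ snd k)
        = of_int (Poly_Mapping.lookup P k) * ((u ^ fst k * u ^ snd k) * (1 - \<i> ^ snd k))"
        by (simp add: power_mult_distrib algebra_simps)
      also have "\<dots> = of_int (Poly_Mapping.lookup P k) *
          ((u * u) * u ^ (fst k + snd k - Suc n) * u ^ n * w (snd k))"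
        unfolding e w by (simp only: mult_ac)
      also have "\<dots> = u ^ n * (2 * g k)" unfolding u2 g_def by (simp add: mult_ac)
      finally show "of_int (Poly_Mapping.lookup P k) * (u ^ fst k * u ^ snd k) -
          of_int (Poly_Mapping.lookup P k) * (u ^ fst k * (\<i> * u) ^ snd k) = u ^ n * (2 * g k)" .
    qed
  qed
  moreover have "poly2_eval u u F = poly2_eval u u P" "poly2_eval u (\<i> * u) F = poly2_eval u (\<i> * u) P"
    using eq unfolding v unfolding u_def .
  ultimately obtain z where z: "z \<in> gauss_ints" "(\<Sum>b\<le>n. of_int (f b) * (1 - \<i> ^ b)) = 2 * z"
    using nz by auto
  \<comment> \<open>The real part of 1 - i^b is 0, 1 or 2, and it is 1 exactly for odd b.\<close>
  have "\<exists>r::int. Re (1 - \<i> ^ b) = 2 * of_int r + of_int (of_bool (odd b))" for b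
  proof (cases "even b")
    case True
    then obtain c where c: "b = 2 * c" by blast
    have "\<i> ^ b = (- 1) ^ c" by (simp add: c power_mult)
    then have "Re (1 - \<i> ^ b) = 2 * of_int (of_bool (odd c))" by (cases "even c") auto
    then show ?thesis using True by auto
  next
    case False
    then obtain c where c: "b = 2 * c + 1" using oddE by blast
    have "\<i> ^ b = (- 1) ^ c * \<i>" by (simp add: c power_mult)
    then have "\<i> ^ b = \<i> \<or> \<i> ^ b = - \<i>" by (cases "even c") auto
    then show ?thesis using False by (intro exI[of _ 0]) auto
  qed
  then obtain r :: "nat \<Rightarrow> int" where r: "\<And>b. Re (1 - \<i> ^ b) = 2 * of_int (r b) + of_int (of_bool (odd b))"
    by metis
  obtain c where c: "Re z = of_int c" using z(1) by (auto simp: gauss_ints_def)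
  have "of_int (2 * c) = Re (2 * z)" using c by simp
  also have "\<dots> = (\<Sum>b\<le>n. of_int (f b) * Re (1 - \<i> ^ b))"
    unfolding z(2)[symmetric] Re_sum by (intro sum.cong) auto
  also have "\<dots> = of_int (\<Sum>b\<le>n. f b * (2 * r b + of_bool (odd b)))"
    unfolding r by simp
  finally have "2 * c = (\<Sum>b\<le>n. f b * (2 * r b + of_bool (odd b)))"
    unfolding of_int_eq_iff .
  also have "\<dots> = 2 * (\<Sum>b\<le>n. f b * r b) + (\<Sum>b\<le>n. f b * of_bool (odd b))"
    by (simp add: distrib_left sum.distrib sum_distrib_left mult_ac)
  also have "(\<Sum>b\<le>n. f b * of_bool (odd b)) = (\<Sum>b | b \<le> n \<and> odd b. f b)"
    by (rule sum.mono_neutral_cong_right) auto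
  finally show ?thesis unfolding f_def by presburger
qed

text \<open>Since $-2 = -i(i-1)^2$, moving one factor from the first variable to the second raises the
  $(i-1)$-adic order at $(i - 1, -2)$; the differences isolate the coefficient of $u^{n-1}v$.\<close>

lemma side_detection:
  fixes f :: "nat \<Rightarrow> int" and c :: "'k \<Rightarrow> int"
  assumes n: "n \<ge> 1" and K: "finite K" "\<And>k. k \<in> K \<Longrightarrow> Suc n \<le> a k + b k"
    and eq: "\<And>v. v \<in> {0, - 2} \<Longrightarrow> (\<Sum>j\<le>n. of_int (f j) * ((\<i> - 1) ^ (n - j) * v ^ j))
      = (\<Sum>k\<in>K. of_int (c k) * ((\<i> - 1) ^ a k * v ^ b k))"
  shows "even (f 1)"
proof -
  define u where "u = \<i> - 1"
  have nz: "u \<noteq> 0" by (simp add: u_def complex_eq_iff)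
  have m2: "- 2 = - \<i> * (u * u)" by (simp add: u_def algebra_simps)
  have expand: "u ^ p * (- 2) ^ q = u ^ (p + 2 * q) * (- \<i>) ^ q" for p q
    unfolding m2 power_mult_distrib power_add power_mult power2_eq_square by (simp only: mult_ac)
  have "(\<Sum>j\<le>n. of_int (f j) * (u ^ (n - j) * (- 2) ^ j)) - (\<Sum>j\<le>n. of_int (f j) * (u ^ (n - j) * 0 ^ j))
      = (\<Sum>j\<le>n. of_int (f j) * (if j = 0 then 0 else u ^ (n - j) * (- 2) ^ j))"
    unfolding sum_subtractf[symmetric] by (intro sum.cong) auto
  \<comment> \<open>The term j = 0 has cancelled against the value at v = 0. The term j = 1 is a
    unit times f_1 u^(n+1), and each remaining one is divisible by u^(n+2), as is every term on the
    other side.\<close>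
  also have "\<dots> = (\<Sum>j\<in>{..n} - {0, 1}. of_int (f j) * (if j = 0 then 0 else u ^ (n - j) * (- 2) ^ j))
      + of_int (f 1) * (u ^ (n - 1) * (- 2))"
  proof -
    have "{..n} = insert 0 (insert 1 ({..n} - {0, 1}))" using n by auto
    moreover have "(\<Sum>j\<in>insert 0 (insert 1 ({..n} - {0, 1})). of_int (f j) * (if j = 0 then 0 else u ^ (n - j) * (- 2) ^ j))
      = (\<Sum>j\<in>{..n} - {0, 1}. of_int (f j) * (if j = 0 then 0 else u ^ (n - j) * (- 2) ^ j))
        + of_int (f 1) * (u ^ (n - 1) * (- 2))"
      by simp
    ultimately show ?thesis by metis
  qed
  also have "(\<Sum>j\<in>{..n} - {0, 1}. of_int (f j) * (if j = 0 then 0 else u ^ (n - j) * (- 2) ^ j))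
      = u ^ (n + 2) * (\<Sum>j\<in>{..n} - {0, 1}. of_int (f j) * (u ^ (j - 2) * (- \<i>) ^ j))"
    unfolding sum_distrib_left
  proof (intro sum.cong refl)
    fix j assume "j \<in> {..n} - {0, 1}"
    then have "j \<noteq> 0" "n - j + 2 * j = n + 2 + (j - 2)" by auto
    then show "of_int (f j) * (if j = 0 then 0 else u ^ (n - j) * (- 2) ^ j) =
      u ^ (n + 2) * (of_int (f j) * (u ^ (j - 2) * (- \<i>) ^ j))"
      unfolding expand by (simp add: power_add mult_ac)
  qed
  also have "of_int (f 1) * (u ^ (n - 1) * (- 2)) = u ^ (n + 1) * (- \<i> * of_int (f 1))"
  proof -
    have "n + 1 = n - 1 + 2" using n by simp
    then have e: "u ^ (n + 1) = u ^ (n - 1) * (u * u)"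
      by (simp only: power_add power2_eq_square)
    show ?thesis unfolding e m2 by (simp only: mult_ac)
  qed
  finally have l: "(\<Sum>j\<le>n. of_int (f j) * (u ^ (n - j) * (- 2) ^ j)) - (\<Sum>j\<le>n. of_int (f j) * (u ^ (n - j) * 0 ^ j))
    = u ^ (n + 1) * (u * (\<Sum>j\<in>{..n} - {0, 1}. of_int (f j) * (u ^ (j - 2) * (- \<i>) ^ j)) - \<i> * of_int (f 1))"
    by (simp add: algebra_simps)
  have "(\<Sum>k\<in>K. of_int (c k) * (u ^ a k * (- 2) ^ b k)) - (\<Sum>k\<in>K. of_int (c k) * (u ^ a k * 0 ^ b k))
      = (\<Sum>k\<in>K. of_int (c k) * (if b k = 0 then 0 else u ^ a k * (- 2) ^ b k))"
    unfolding sum_subtractf[symmetric] by (intro sum.cong) auto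
  also have "\<dots> = u ^ (n + 1) * (u * (\<Sum>k\<in>K. of_int (c k) *
      (if b k = 0 then 0 else u ^ (a k + 2 * b k - (n + 2)) * (- \<i>) ^ b k)))"
    unfolding sum_distrib_left
  proof (intro sum.cong refl)
    fix k assume k: "k \<in> K"
    show "of_int (c k) * (if b k = 0 then 0 else u ^ a k * (- 2) ^ b k) = u ^ (n + 1) * (u * (of_int (c k) *
      (if b k = 0 then 0 else u ^ (a k + 2 * b k - (n + 2)) * (- \<i>) ^ b k)))"
    proof (cases "b k = 0")
      case False
      then have "a k + 2 * b k = n + 1 + 1 + (a k + 2 * b k - (n + 2))" using K(2)[OF k] by simp
      then have "u ^ (a k + 2 * b k) = u ^ (n + 1) * u * u ^ (a k + 2 * b k - (n + 2))"
        by (metis power_add power_one_right)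
      then show ?thesis using False unfolding expand by (simp add: mult_ac)
    qed simp
  qed
  finally have r: "(\<Sum>k\<in>K. of_int (c k) * (u ^ a k * (- 2) ^ b k)) - (\<Sum>k\<in>K. of_int (c k) * (u ^ a k * 0 ^ b k))
    = u ^ (n + 1) * (u * (\<Sum>k\<in>K. of_int (c k) *
      (if b k = 0 then 0 else u ^ (a k + 2 * b k - (n + 2)) * (- \<i>) ^ b k)))" .
  let ?A = "\<Sum>j\<in>{..n} - {0, 1}. of_int (f j) * (u ^ (j - 2) * (- \<i>) ^ j)"
  let ?B = "\<Sum>k\<in>K. of_int (c k) * (if b k = 0 then 0 else u ^ (a k + 2 * b k - (n + 2)) * (- \<i>) ^ b k)"
  define z where "z = ?A - ?B"
  have "z \<in> gauss_ints" unfolding z_def u_def by (auto intro!: gauss_ints_intros)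
  moreover have "\<i> * of_int (f 1) = u * z"
  proof -
    have "u ^ (n + 1) * (u * ?A - \<i> * of_int (f 1)) = u ^ (n + 1) * (u * ?B)"
      using eq[of 0] eq[of "- 2"] unfolding u_def[symmetric] l[symmetric] r[symmetric] by simp
    then have "u * ?A - \<i> * of_int (f 1) = u * ?B" using nz by simp
    then show ?thesis unfolding z_def by (simp add: algebra_simps)
  qed
  ultimately obtain p q :: int where "\<i> * of_int (f 1) = u * (of_int p + of_int q * \<i>)"
    unfolding gauss_ints_def by blast
  \<comment> \<open>Since (i - 1)(p + qi) = -(p + q) + (p - q)i, comparing parts gives f_1 =
    2p.\<close>
  then have "p + q = 0" "f 1 = p - q" by (auto simp: u_def complex_eq_iff simp flip: of_int_diff of_int_add)
  then show ?thesis by presburger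
qed

section \<open>Membership in the ideal of the relations\<close>

lemma class_ring_idealD:
  fixes J :: "'a::comm_ring_1 set"
  assumes "ideal J class_ring"
  shows "0 \<in> J" "p \<in> J \<Longrightarrow> q \<in> J \<Longrightarrow> p + q \<in> J" "p \<in> J \<Longrightarrow> q * p \<in> J"
    "p \<in> J \<Longrightarrow> - p \<in> J" "p \<in> J \<Longrightarrow> q \<in> J \<Longrightarrow> p - q \<in> J"
proof -
  interpret ideal J class_ring by fact
  show 0: "0 \<in> J" using additive_subgroup.zero_closed[OF is_additive_subgroup] by simp
  show add: "p + q \<in> J" if "p \<in> J" "q \<in> J" for p q
    using additive_subgroup.a_closed[OF is_additive_subgroup that] by simp
  show mult: "q * p \<in> J" if "p \<in> J" for p q using I_l_closed[OF that, of q] by simp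
  show uminus: "- p \<in> J" if "p \<in> J" for p using mult[OF that, of "-1"] by simp
  show "p - q \<in> J" if "p \<in> J" "q \<in> J" for p q using add[OF that(1) uminus[OF that(2)]] by simp
qed

lemma class_ring_ideal_sum:
  fixes J :: "'a::comm_ring_1 set"
  assumes "ideal J class_ring" "\<And>x. x \<in> A \<Longrightarrow> f x \<in> J"
  shows "sum f A \<in> J"
  using assms(2)
  by (induction A rule: infinite_finite_induct)
     (simp_all add: class_ring_idealD[OF assms(1)])

definition C4_relations :: "int poly2 set" where
  "C4_relations = {4 * var_x, 4 * var_y, 2 * var_x\<^sup>2 * var_y + 2 * var_x * var_y\<^sup>2,
     var_x ^ 4 * var_y\<^sup>2 - var_x\<^sup>2 * var_y ^ 4}"

lemma of_int_mult_single:
  "of_int c * Poly_Mapping.single k 1 = (Poly_Mapping.single k c :: int poly2)"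
proof -
  have "(of_int c :: int poly2) = Poly_Mapping.single 0 c" by (metis of_int_eq_id id_apply single_of_int)
  then show ?thesis by (simp add: mult_single)
qed

text \<open>The two binomial relations times a monomial. Modulo 4 the first moves one factor from x
  to y in a doubled monomial with both exponents positive; the second moves two factors as long as
  both exponents stay at least 2.\<close>

lemma monomial_exchange:
  fixes x y :: "'a::comm_ring_1"
  shows "2 * (x ^ Suc (Suc d) * y ^ Suc c) - 2 * (x ^ Suc d * y ^ Suc (Suc c))
      = (x ^ d * y ^ c) * (2 * x\<^sup>2 * y + 2 * x * y\<^sup>2) - 4 * (x ^ Suc d * y ^ Suc (Suc c))"
    and "x ^ (d + 4) * y ^ (c + 2) - x ^ (d + 2) * y ^ (c + 4)
      = (x ^ d * y ^ c) * (x ^ 4 * y\<^sup>2 - x\<^sup>2 * y ^ 4)"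
  by (simp_all add: power2_eq_square power_add algebra_simps)

text \<open>Modulo J all doubled inner monomials agree with 2 x^(n-1)y, and for 2 <= b <= n - 2 a
  monomial depends only on the parity of b. Reducing with these exchanges turns F into an integral
  combination of x^n, y^n, 2 x^(n-1)y, x^(n-2)y^2 and x^(n-3)y^3. The parity conditions make the
  last two coefficients even, so they too become multiples of 2 x^(n-1)y, and the conditions modulo
  4 dispose of what remains.\<close>

lemma homogeneous_mem_ideal:
  fixes J :: "int poly2 set"
  defines "f \<equiv> \<lambda>F n b. Poly_Mapping.lookup F (n - b, b :: nat)"
  assumes J: "ideal J class_ring" "C4_relations \<subseteq> J"
    and F: "F \<in> homogeneous n" and n: "n \<ge> 1"
    and four: "4 dvd f F n 0" "4 dvd f F n n" "4 dvd (\<Sum>b\<le>n. f F n b)"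
    and two: "even (f F n 1)" "even (f F n (n - 1))" "even (\<Sum>b | b \<le> n \<and> odd b. f F n b)"
  shows "F \<in> J"
proof -
  note I = class_ring_idealD[OF J(1)]
  define g where "g = f F n"
  define m where "m b = (Poly_Mapping.single (n - b, b) 1 :: int poly2)" for b
  have m: "m b = var_x ^ (n - b) * var_y ^ b" for b by (simp add: m_def var_power_mult)
  have expand: "F = (\<Sum>b\<le>n. of_int (g b) * m b)"
    unfolding m_def of_int_mult_single g_def f_def by (rule homogeneous_expansion[OF F])
  have rels: "4 * var_x \<in> J" "4 * var_y \<in> J" "2 * var_x\<^sup>2 * var_y + 2 * var_x * var_y\<^sup>2 \<in> J"
    "var_x ^ 4 * var_y\<^sup>2 - var_x\<^sup>2 * var_y ^ 4 \<in> J"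
    using J(2) by (auto simp: C4_relations_def)
  have m4: "4 * m b \<in> J" if "b \<le> n" for b
  proof (cases "b = n")
    case True
    then obtain c where c: "b = Suc c" using n by (cases b) auto
    have "4 * m b = (var_x ^ (n - b) * var_y ^ c) * (4 * var_y)"
      unfolding m unfolding c power_Suc by (simp only: mult_ac)
    then show ?thesis using I(3)[OF rels(2)] by metis
  next
    case False
    then have "0 < n - b" using that by simp
    then obtain c where c: "n - b = Suc c" using gr0_conv_Suc by blast
    have "4 * m b = (var_x ^ c * var_y ^ b) * (4 * var_x)"
      unfolding m c power_Suc by (simp only: mult_ac)
    then show ?thesis using I(3)[OF rels(1)] by metis
  qed
  have step2: "2 * m b - 2 * m (Suc b) \<in> J" if b: "1 \<le> b" "Suc b \<le> n - 1" for b
  proof -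
    obtain c where c: "b = Suc c" using b(1) by (cases b) auto
    obtain d where d: "n - b = Suc (Suc d)" using b that by (intro that[of "n - b - 2"]) auto
    then have d': "n - Suc b = Suc d" by simp
    have eq: "2 * m b - 2 * m (Suc b) = (var_x ^ d * var_y ^ c) * (2 * var_x\<^sup>2 * var_y + 2 * var_x * var_y\<^sup>2)
        - 4 * m (Suc b)"
      unfolding m d d' unfolding c by (rule monomial_exchange)
    show ?thesis unfolding eq by (rule I(5)[OF I(3)[OF rels(3)] m4]) (use b in simp)
  qed
  have double: "2 * m b - 2 * m 1 \<in> J" if "1 \<le> b" "b \<le> n - 1" for b
    using that
  proof (induction b rule: dec_induct)
    case (step b)
    have "2 * m (Suc b) - 2 * m 1 = (2 * m b - 2 * m 1) - (2 * m b - 2 * m (Suc b))" by simp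
    then show ?case using I(5)[OF step.IH step2[of b]] step by simp
  qed (simp add: I(1))
  have step3: "m b - m (b + 2) \<in> J" if b: "2 \<le> b" "b + 2 \<le> n - 2" for b
  proof -
    obtain c where c: "b = c + 2" using b(1) by (metis add.commute le_Suc_ex)
    obtain d where d: "n - b = d + 4" using b by (intro that[of "n - b - 4"]) auto
    then have d': "n - (b + 2) = d + 2" by simp
    have b2: "b + 2 = c + 4" by (simp add: c)
    have "m b - m (b + 2) = (var_x ^ d * var_y ^ c) * (var_x ^ 4 * var_y\<^sup>2 - var_x\<^sup>2 * var_y ^ 4)"
      unfolding m d d'[unfolded b2] b2 unfolding c by (rule monomial_exchange)
    then show ?thesis using I(3)[OF rels(4)] by metis
  qed
  \<comment> \<open>Steps of length two connect all exponents of one parity between 2 and n - 2; the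
    representatives are 2 and 3.\<close>
  have inner: "m b - m (2 + b mod 2) \<in> J" if "2 \<le> b" "b \<le> n - 2" for b
    using that
  proof (induction b rule: less_induct)
    case (less b)
    show ?case
    proof (cases "b < 4")
      case True
      then have "2 + b mod 2 = b" using less.prems by presburger
      then show ?thesis using I(1) by simp
    next
      case False
      define c where "c = b - 2"
      have c: "b = c + 2" "2 \<le> c" "b mod 2 = c mod 2" using False by (auto simp: c_def mod_2_eq_odd)
      have "m c - m (2 + c mod 2) \<in> J" "m c - m b \<in> J"
        using less.IH[of c] step3[of c] less.prems c by auto
      from I(5)[OF this] show ?thesis using c by simp
    qed
  qed
  \<comment> \<open>With g b = 2 h b + e b, the doubled part is collected at \<open>m 1\<close> and
    the digits e b at \<open>m 2\<close> and \<open>m 3\<close>.\<close>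
  define e where "e b = g b mod 2" for b
  define h where "h b = g b div 2" for b
  have g: "g b = 2 * h b + e b" for b by (simp add: e_def h_def)
  define N where "N p = (\<Sum>b\<in>{1..n-1}. if b mod 2 = p then e b else 0)" for p
  define H where "H = (\<Sum>b\<in>{1..n-1}. h b)"
  have e01: "e b = 0 \<or> e b = 1" for b unfolding e_def by presburger
  \<comment> \<open>The fourth relation does not reach x^(n-1)y and xy^(n-1), so their coefficients
    have to be even from the start.\<close>
  have eout: "e b = 0" if "b \<in> {1..n-1}" "\<not> (2 \<le> b \<and> b \<le> n - 2)" for b
  proof -
    have "b = 1 \<or> b = n - 1" using that by auto
    then show ?thesis using two(1,2) by (auto simp: e_def g_def)
  qed
  have term1: "of_int (g b) * m b - (of_int (h b) * (2 * m 1) + of_int (e b) * m (2 + b mod 2)) \<in> J"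
    if b: "b \<in> {1..n-1}" for b
  proof -
    have "of_int (e b) * (m b - m (2 + b mod 2)) \<in> J"
      using eout[OF b] inner[of b] I(1) I(3) by (cases "2 \<le> b \<and> b \<le> n - 2") auto
    moreover have "of_int (h b) * (2 * m b - 2 * m 1) \<in> J"
      using double[of b] b I(3) by auto
    ultimately have "of_int (h b) * (2 * m b - 2 * m 1) + of_int (e b) * (m b - m (2 + b mod 2)) \<in> J"
      using I(2) by blast
    then show ?thesis by (simp add: g algebra_simps)
  qed
  have part: "(\<Sum>b\<in>{1..n-1}. of_int (e b) * m (2 + b mod 2)) = of_int (N 0) * m 2 + of_int (N 1) * m 3"
    unfolding N_def of_int_sum sum_distrib_right sum.distrib[symmetric]
  proof (intro sum.cong refl)
    fix b :: nat
    have "b mod 2 = 0 \<or> b mod 2 = 1" by presburger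
    then show "of_int (e b) * m (2 + b mod 2) = of_int (if b mod 2 = 0 then e b else 0) * m 2
        + of_int (if b mod 2 = 1 then e b else 0) * m 3"
      by (auto simp: eval_nat_numeral)
  qed
  have split: "{..n} = insert 0 (insert n {1..n-1})" using n by auto
  have sum_g: "(\<Sum>b\<le>n. g b) = g 0 + g n + (\<Sum>b\<in>{1..n-1}. g b)"
    unfolding split using n by (subst sum.insert; auto)+
  have HN: "(\<Sum>b\<in>{1..n-1}. g b) = 2 * H + N 0 + N 1"
    unfolding H_def N_def sum_distrib_left sum.distrib[symmetric]
    by (intro sum.cong refl) (auto simp: g mod_2_eq_odd)
  then have tot: "4 dvd 2 * H + N 0 + N 1"
    using four sum_g unfolding g_def[symmetric] by presburger
  have N1: "even (N 1)"
  proof -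
    have "(\<Sum>b | b \<le> n \<and> odd b. g b) = (\<Sum>b\<le>n. if odd b then g b else 0)"
      by (rule sum.mono_neutral_cong_left) auto
    also have "\<dots> = (if odd n then g n else 0) + (\<Sum>b\<in>{1..n-1}. if odd b then g b else 0)"
      unfolding split using n by (subst sum.insert; auto)+
    also have "(\<Sum>b\<in>{1..n-1}. if odd b then g b else 0) =
        2 * (\<Sum>b\<in>{1..n-1}. if odd b then h b else 0) + N 1"
      unfolding N_def sum_distrib_left sum.distrib[symmetric]
      by (intro sum.cong refl) (auto simp: g mod_2_eq_odd)
    finally have "even ((if odd n then g n else 0) + N 1)"
      using two(3) unfolding g_def[symmetric] by presburger
    moreover have "even (g n)" using four(2) unfolding g_def[symmetric] by presburger
    ultimately show ?thesis by (simp split: if_splits)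
  qed
  have N0: "even (N 0)" using tot N1 by presburger
  \<comment> \<open>In small degrees \<open>m 2\<close> and \<open>m 3\<close> may be end monomials
    or, by truncated subtraction, not even of degree n. A nonzero N p provides an inner exponent and
    thereby a large enough n.\<close>
  have N_inner: "\<exists>b. b mod 2 = p \<and> 2 \<le> b \<and> b \<le> n - 2" if "N p \<noteq> 0" for p
  proof (rule ccontr)
    assume *: "\<not> ?thesis"
    have "N p = 0" unfolding N_def
    proof (rule sum.neutral, rule ballI)
      fix b assume "b \<in> {1..n-1}"
      then show "(if b mod 2 = p then e b else 0) = 0" using * eout[of b] by auto
    qed
    then show False using that by simp
  qed
  have N2: "of_int (N 0) * m 2 - of_int (N 0 div 2) * (2 * m 1) \<in> J"
  proof (cases "N 0 = 0")
    case False
    then have "2 \<le> n - 1" using N_inner[of 0] by auto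
    then have "of_int (N 0 div 2) * (2 * m 2 - 2 * m 1) \<in> J" using double[of 2] I(3) by simp
    moreover have "of_int (N 0) = 2 * (of_int (N 0 div 2) :: int poly2)"
      using N0 by (metis dvd_mult_div_cancel of_int_mult of_int_numeral)
    ultimately show ?thesis by (simp add: algebra_simps)
  qed (simp add: I(1))
  have N3: "of_int (N 1) * m 3 - of_int (N 1 div 2) * (2 * m 1) \<in> J"
  proof (cases "N 1 = 0")
    case False
    then obtain b where b: "b mod 2 = 1" "2 \<le> b" "b \<le> n - 2" using N_inner[of 1] by auto
    then have "b \<noteq> 2" by auto
    then have "3 \<le> n - 1" using b by auto
    then have "of_int (N 1 div 2) * (2 * m 3 - 2 * m 1) \<in> J" using double[of 3] I(3) by simp
    moreover have "of_int (N 1) = 2 * (of_int (N 1 div 2) :: int poly2)"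
      using N1 by (metis dvd_mult_div_cancel of_int_mult of_int_numeral)
    ultimately show ?thesis by (simp add: algebra_simps)
  qed (simp add: I(1))
  have ends: "of_int (g b) * m b \<in> J" if "4 dvd g b" "b \<le> n" for b
  proof -
    from \<open>4 dvd g b\<close> obtain c where "g b = 4 * c" by blast
    then have "of_int (g b) * m b = of_int c * (4 * m b)" by (simp add: mult_ac)
    then show ?thesis using I(3)[OF m4[OF that(2)]] by metis
  qed
  \<comment> \<open>The total coefficient of 2 x^(n-1)y after all exchanges; 2M = 2H + N 0 + N 1 is
    divisible by 4.\<close>
  define M where "M = H + N 0 div 2 + N 1 div 2"
  have M: "of_int M * (2 * m 1) \<in> J"
  proof -
    have "even M" using tot N0 N1 unfolding M_def by presburger
    then obtain c where "M = 2 * c" by blast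
    then have "of_int M * (2 * m 1) = of_int c * (4 * m 1)" by (simp add: mult_ac)
    then show ?thesis using I(3)[OF m4[OF n]] by metis
  qed
  have mid: "(\<Sum>b\<in>{1..n-1}. of_int (g b) * m b) \<in> J"
  proof -
    have "(\<Sum>b\<in>{1..n-1}. of_int (g b) * m b -
        (of_int (h b) * (2 * m 1) + of_int (e b) * m (2 + b mod 2))) \<in> J"
      by (rule class_ring_ideal_sum[OF J(1)]) (rule term1)
    also have "(\<Sum>b\<in>{1..n-1}. of_int (g b) * m b -
        (of_int (h b) * (2 * m 1) + of_int (e b) * m (2 + b mod 2)))
      = (\<Sum>b\<in>{1..n-1}. of_int (g b) * m b)
        - (of_int H * (2 * m 1) + (of_int (N 0) * m 2 + of_int (N 1) * m 3))"
      unfolding part[symmetric] H_def sum_subtractf sum.distrib of_int_sum sum_distrib_right ..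
    finally have a: "(\<Sum>b\<in>{1..n-1}. of_int (g b) * m b)
        - (of_int H * (2 * m 1) + (of_int (N 0) * m 2 + of_int (N 1) * m 3)) \<in> J" .
    from I(2)[OF I(2)[OF I(2)[OF a N2] N3] M] show ?thesis
      unfolding M_def by (simp add: algebra_simps)
  qed
  have eq: "F = of_int (g 0) * m 0 + of_int (g n) * m n + (\<Sum>b\<in>{1..n-1}. of_int (g b) * m b)"
    unfolding expand unfolding split using n by (subst sum.insert; auto)+
  have "of_int (g 0) * m 0 \<in> J" "of_int (g n) * m n \<in> J"
    using ends[of 0] ends[of n] four(1,2) unfolding g_def by auto
  from I(2)[OF I(2)[OF this] mid] show ?thesis by (simp only: eq)
qed

lemma leading_form_mem_ideal:
  fixes J :: "int poly2 set"
  assumes J: "ideal J class_ring" "C4_relations \<subseteq> J"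
    and F: "F \<in> homogeneous n" and P: "P \<in> order_ge (Suc n)"
    and eq: "\<And>u v. u \<in> C4_values \<Longrightarrow> v \<in> C4_values \<Longrightarrow> poly2_eval u v F = poly2_eval u v P"
  shows "F \<in> J"
proof (cases "n = 0")
  \<comment> \<open>No relation has degree 0: F is a constant, and its value at the origin shows
    that it vanishes.\<close>
  case True
  have "poly2_eval 0 0 F = complex_of_int (Poly_Mapping.lookup F (0, 0))"
    using poly2_eval_homogeneous[OF F, of 0 "0 :: complex"] by (simp add: True)
  moreover have "poly2_eval 0 0 P = (0 :: complex)"
    unfolding poly2_eval_def
  proof (intro sum.neutral ballI)
    fix k assume "k \<in> Poly_Mapping.keys P"
    then have "fst k > 0 \<or> snd k > 0" using P by (force simp: order_ge_def)
    then show "of_int (Poly_Mapping.lookup P k) * (0 ^ fst k * 0 ^ snd k) = (0 :: complex)" by auto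
  qed
  ultimately have "Poly_Mapping.lookup F (0, 0) = 0"
    using eq[of 0 0] by (simp add: C4_values_def)
  then have "F = 0" using homogeneous_expansion[OF F] by (simp add: True)
  then show ?thesis using class_ring_idealD(1)[OF J(1)] by simp
next
  case False
  define f where "f b = Poly_Mapping.lookup F (n - b, b)" for b
  \<comment> \<open>The directions (1,0), (0,1) and (1,1) are usable because their lines stay inside
    the grid of points.\<close>
  have cart: "of_int \<alpha> * u \<in> C4_values" if "\<alpha> = 0 \<or> \<alpha> = 1" "u \<in> {\<i> - 1, - 2, - \<i> - 1}" for \<alpha> :: int and u
    using that by (auto simp: C4_values_def)
  have line: "4 dvd poly2_eval \<alpha> \<beta> F" if "\<alpha> = 0 \<or> \<alpha> = 1" "\<beta> = 0 \<or> \<beta> = 1" for \<alpha> \<beta> :: int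
    by (rule line_detection[OF F P]) (intro eq cart that; assumption)
  have four: "4 dvd f 0" "4 dvd f n" "4 dvd (\<Sum>b\<le>n. f b)"
  proof -
    have "poly2_eval 1 0 F = (\<Sum>b\<le>n. if b = 0 then f b else 0)"
      unfolding poly2_eval_homogeneous[OF F] f_def by (intro sum.cong) auto
    then show "4 dvd f 0" using line[of 1 0] by (simp add: sum.delta)
    have "poly2_eval 0 1 F = (\<Sum>b\<le>n. if b = n then f b else 0)"
      unfolding poly2_eval_homogeneous[OF F] f_def by (intro sum.cong) auto
    then show "4 dvd f n" using line[of 0 1] by (simp add: sum.delta)
    have "poly2_eval 1 1 F = (\<Sum>b\<le>n. f b)"
      unfolding poly2_eval_homogeneous[OF F] f_def by simp
    then show "4 dvd (\<Sum>b\<le>n. f b)" using line[of 1 1] by simp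
  qed
  have odds: "even (\<Sum>b | b \<le> n \<and> odd b. f b)"
    unfolding f_def by (rule parity_detection[OF F P]; rule eq) (auto simp: C4_values_def)
  have degP: "Suc n \<le> fst k + snd k" if "k \<in> Poly_Mapping.keys P" for k
    using P that by (auto simp: order_ge_def)
  have "even (f 1)"
  proof (rule side_detection[where n = n and K = "Poly_Mapping.keys P" and c = "Poly_Mapping.lookup P"
          and a = fst and b = snd])
    fix v :: complex assume "v \<in> {0, - 2}"
    then have "poly2_eval (\<i> - 1) v F = poly2_eval (\<i> - 1) v P" by (intro eq) (auto simp: C4_values_def)
    then show "(\<Sum>j\<le>n. of_int (f j) * ((\<i> - 1) ^ (n - j) * v ^ j))
      = (\<Sum>k\<in>Poly_Mapping.keys P. of_int (Poly_Mapping.lookup P k) * ((\<i> - 1) ^ fst k * v ^ snd k))"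
      unfolding poly2_eval_homogeneous[OF F] f_def unfolding poly2_eval_def .
  qed (use False degP in auto)
  \<comment> \<open>The same detection with the two variables exchanged, so that coefficients are
    read from the other end.\<close>
  moreover have "even (f (n - 1))"
  proof (rule side_detection[where n = n and f = "\<lambda>j. f (n - j)" and K = "Poly_Mapping.keys P"
          and c = "Poly_Mapping.lookup P" and a = snd and b = fst])
    fix v :: complex assume "v \<in> {0, - 2}"
    then have "poly2_eval v (\<i> - 1) F = poly2_eval v (\<i> - 1) P" by (intro eq) (auto simp: C4_values_def)
    moreover have "(\<Sum>j\<le>n. of_int (f (n - j)) * ((\<i> - 1) ^ (n - j) * v ^ j))
        = (\<Sum>j\<le>n. of_int (f j) * (v ^ (n - j) * (\<i> - 1) ^ j))"
      by (rule sum.reindex_bij_witness[of _ "\<lambda>j. n - j" "\<lambda>j. n - j"]) (auto simp: mult.commute)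
    ultimately show "(\<Sum>j\<le>n. of_int (f (n - j)) * ((\<i> - 1) ^ (n - j) * v ^ j))
      = (\<Sum>k\<in>Poly_Mapping.keys P. of_int (Poly_Mapping.lookup P k) * ((\<i> - 1) ^ snd k * v ^ fst k))"
      unfolding poly2_eval_homogeneous[OF F] f_def
      unfolding poly2_eval_def mult.commute[of "(\<i> - 1) ^ snd _"] by simp
  qed (use False degP in \<open>auto simp: add.commute\<close>)
  ultimately show ?thesis
    using homogeneous_mem_ideal[OF J F] False four odds unfolding f_def by simp
qed

section \<open>The relations as leading forms of vanishing polynomials\<close>

lemma C4_values_root: "u \<in> C4_values \<Longrightarrow> u ^ 4 + 4 * u ^ 3 + 6 * u\<^sup>2 + 4 * u = 0"
  unfolding C4_values_def
  by (elim insertE emptyE; hypsubst)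
     (simp_all add: power4_eq_xxxx power3_eq_cube power2_eq_square algebra_simps)

text \<open>Write p(u) = (1+u)^4 - 1. In the first identity v p(u) - u p(v) has leading form 6u^2v -
  6uv^2, and the extra cofactor -uv + 2v^2 of p(u) adds -4u^2v + 8uv^2, which leaves 2u^2v + 2uv^2.
  In the second the linear parts -2v and 2u of the cofactors cancel in degree 2, and their higher
  terms continue the cancellation up to degree 5.\<close>

lemma C4_relation_cofactors:
  fixes u v :: "'a::comm_ring_1"
  shows "(2 * u\<^sup>2 * v + 2 * u * v\<^sup>2) - (- 4 * (u ^ 3 * v ^ 1) - u ^ 4 * v ^ 1 + 4 * (u ^ 1 * v ^ 3) + u ^ 1 * v ^ 4
      + 6 * (u ^ 3 * v ^ 1) + 4 * (u ^ 4 * v ^ 1) + u ^ 5 * v ^ 1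
      - 12 * (u ^ 2 * v ^ 2) - 8 * (u ^ 3 * v ^ 2) - 2 * (u ^ 4 * v ^ 2)) = (v - u * v + 2 * v\<^sup>2) * (u ^ 4 + 4 * u ^ 3 + 6 * u\<^sup>2 + 4 * u)
            - u * (v ^ 4 + 4 * v ^ 3 + 6 * v\<^sup>2 + 4 * v)"
    and "(u ^ 4 * v\<^sup>2 - u\<^sup>2 * v ^ 4) - (6 * (u ^ 4 * v ^ 3) - 6 * (u ^ 5 * v ^ 2) + 3 * (u ^ 6 * v ^ 1) - 6 * (u ^ 3 * v ^ 4)
      - u ^ 6 * v ^ 2 + u ^ 7 * v ^ 1 - 3 * (u ^ 1 * v ^ 6) + 6 * (u ^ 2 * v ^ 5)
      - u ^ 1 * v ^ 7 + u ^ 2 * v ^ 6) = (- 2 * v - v ^ 2 + 2 * u * v + 2 * v ^ 3 + 2 * u * v ^ 2 + u ^ 2 * v + 2 * v ^ 4 + u ^ 2 * v ^ 2 - u ^ 3 * v)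
              * (u ^ 4 + 4 * u ^ 3 + 6 * u\<^sup>2 + 4 * u)
            + (2 * u - 2 * u * v + u ^ 2 - u * v ^ 2 - 2 * u ^ 2 * v - 2 * u ^ 3 + u * v ^ 3 - u ^ 2 * v ^ 2 - 2 * u ^ 4)
              * (v ^ 4 + 4 * v ^ 3 + 6 * v\<^sup>2 + 4 * v)"
  by (simp_all add: algebra_simps eval_nat_numeral)

text \<open>Each relation is the leading form of an element vanishing on the points: the first three come
  from $(1+u)^4 = 1$ and $v((1+u)^4-1) = u((1+v)^4-1)$, the last one was found by solving for
  integral cofactors of $(1+u)^4-1$ and $(1+v)^4-1$ that cancel all terms of degree at most 6.\<close>

lemma C4_relations_leading:
  assumes "F \<in> C4_relations"
  obtains n P where "F \<in> homogeneous n" "P \<in> order_ge (Suc n)"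
    "\<And>u v. u \<in> C4_values \<Longrightarrow> v \<in> C4_values \<Longrightarrow> poly2_eval u v F = poly2_eval u v P"
proof -
  let ?x = "var_x :: int poly2" and ?y = "var_y :: int poly2"
  have xy: "?x ^ a * ?y ^ b \<in> order_ge n" if "n \<le> a + b" for a b n
    using order_ge_mono[OF order_ge_single that] by (simp add: var_power_mult)
  have nc: "numeral k * p \<in> order_ge n" if "p \<in> order_ge n" for k n and p :: "int poly2"
    by (rule order_ge_mult_left[OF that])
  have hom: "Poly_Mapping.single (a, b) c \<in> homogeneous (a + b)" for a b and c :: int
    by (simp add: homogeneous_def)
  consider "F = 4 * ?x" | "F = 4 * ?y" | "F = 2 * ?x\<^sup>2 * ?y + 2 * ?x * ?y\<^sup>2"
    | "F = ?x ^ 4 * ?y\<^sup>2 - ?x\<^sup>2 * ?y ^ 4"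
    using assms by (auto simp: C4_relations_def)
  then show ?thesis
  proof cases
    case 1
    let ?P = "- (6 * (?x ^ 2 * ?y ^ 0)) - 4 * (?x ^ 3 * ?y ^ 0) - ?x ^ 4 * ?y ^ 0"
    show ?thesis
    proof (rule that)
      have "F = Poly_Mapping.single (1, 0) 4"
        using of_int_mult_single[of 4 "(1, 0)"] by (simp add: 1 var_x_def)
      then show "F \<in> homogeneous 1" using hom[of 1 0] by simp
      show "?P \<in> order_ge (Suc 1)"
        by (intro order_ge_diff order_ge_uminus nc xy) auto
      show "poly2_eval u v F = poly2_eval u v ?P" if "u \<in> C4_values" "v \<in> C4_values" for u v
      proof -
        have "poly2_eval u v F - poly2_eval u v ?P = u ^ 4 + 4 * u ^ 3 + 6 * u\<^sup>2 + 4 * u"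
          by (simp add: 1 poly2_eval_simps)
        then show ?thesis using C4_values_root that by simp
      qed
    qed
  next
    case 2
    let ?P = "- (6 * (?x ^ 0 * ?y ^ 2)) - 4 * (?x ^ 0 * ?y ^ 3) - ?x ^ 0 * ?y ^ 4"
    show ?thesis
    proof (rule that)
      have "F = Poly_Mapping.single (0, 1) 4"
        using of_int_mult_single[of 4 "(0, 1)"] by (simp add: 2 var_y_def)
      then show "F \<in> homogeneous 1" using hom[of 0 1] by simp
      show "?P \<in> order_ge (Suc 1)"
        by (intro order_ge_diff order_ge_uminus nc xy) auto
      show "poly2_eval u v F = poly2_eval u v ?P" if "u \<in> C4_values" "v \<in> C4_values" for u v
      proof -
        have "poly2_eval u v F - poly2_eval u v ?P = v ^ 4 + 4 * v ^ 3 + 6 * v\<^sup>2 + 4 * v"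
          by (simp add: 2 poly2_eval_simps)
        then show ?thesis using C4_values_root that by simp
      qed
    qed
  next
    case 3
    let ?P = "- 4 * (?x ^ 3 * ?y ^ 1) - ?x ^ 4 * ?y ^ 1 + 4 * (?x ^ 1 * ?y ^ 3) + ?x ^ 1 * ?y ^ 4
      + 6 * (?x ^ 3 * ?y ^ 1) + 4 * (?x ^ 4 * ?y ^ 1) + ?x ^ 5 * ?y ^ 1
      - 12 * (?x ^ 2 * ?y ^ 2) - 8 * (?x ^ 3 * ?y ^ 2) - 2 * (?x ^ 4 * ?y ^ 2)"
    show ?thesis
    proof (rule that)
      have "F = Poly_Mapping.single (2, 1) 2 + Poly_Mapping.single (1, 2) 2"
        unfolding 3 of_int_mult_single[of 2, symmetric] var_power_mult[symmetric] by (simp add: mult.assoc)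
      then show "F \<in> homogeneous 3"
        using homogeneous_add[of "Poly_Mapping.single (2, 1) 2" 3 "Poly_Mapping.single (1, 2) 2"]
          hom[of 2 1 2] hom[of 1 2 2] by (simp add: eval_nat_numeral)
      show "?P \<in> order_ge (Suc 3)"
        unfolding mult_minus_left
        by (intro order_ge_diff order_ge_add order_ge_uminus nc xy) auto
      show "poly2_eval u v F = poly2_eval u v ?P" if "u \<in> C4_values" "v \<in> C4_values" for u v
      proof -
        have "poly2_eval u v F - poly2_eval u v ?P =
            (v - u * v + 2 * v\<^sup>2) * (u ^ 4 + 4 * u ^ 3 + 6 * u\<^sup>2 + 4 * u)
            - u * (v ^ 4 + 4 * v ^ 3 + 6 * v\<^sup>2 + 4 * v)"
          unfolding 3 poly2_eval_simps poly2_eval_var poly2_eval_numeral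
          by (rule C4_relation_cofactors(1))
        then show ?thesis using C4_values_root that by simp
      qed
    qed
  next
    case 4
    let ?P = "6 * (?x ^ 4 * ?y ^ 3) - 6 * (?x ^ 5 * ?y ^ 2) + 3 * (?x ^ 6 * ?y ^ 1) - 6 * (?x ^ 3 * ?y ^ 4)
      - ?x ^ 6 * ?y ^ 2 + ?x ^ 7 * ?y ^ 1 - 3 * (?x ^ 1 * ?y ^ 6) + 6 * (?x ^ 2 * ?y ^ 5)
      - ?x ^ 1 * ?y ^ 7 + ?x ^ 2 * ?y ^ 6"
    show ?thesis
    proof (rule that)
      have "F = Poly_Mapping.single (4, 2) 1 - Poly_Mapping.single (2, 4) 1"
        unfolding 4 var_power_mult ..
      then show "F \<in> homogeneous 6"
        using homogeneous_diff[of "Poly_Mapping.single (4, 2) 1" 6 "Poly_Mapping.single (2, 4) 1"]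
          hom[of 4 2 1] hom[of 2 4 1] by simp
      show "?P \<in> order_ge (Suc 6)"
        by (intro order_ge_diff order_ge_add nc xy) auto
      show "poly2_eval u v F = poly2_eval u v ?P" if "u \<in> C4_values" "v \<in> C4_values" for u v
      proof -
        have "poly2_eval u v F - poly2_eval u v ?P =
            (- 2 * v - v ^ 2 + 2 * u * v + 2 * v ^ 3 + 2 * u * v ^ 2 + u ^ 2 * v + 2 * v ^ 4 + u ^ 2 * v ^ 2 - u ^ 3 * v)
              * (u ^ 4 + 4 * u ^ 3 + 6 * u\<^sup>2 + 4 * u)
            + (2 * u - 2 * u * v + u ^ 2 - u * v ^ 2 - 2 * u ^ 2 * v - 2 * u ^ 3 + u * v ^ 3 - u ^ 2 * v ^ 2 - 2 * u ^ 4)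
              * (v ^ 4 + 4 * v ^ 3 + 6 * v\<^sup>2 + 4 * v)"
          unfolding 4 poly2_eval_simps poly2_eval_var poly2_eval_numeral
          by (rule C4_relation_cofactors(2))
        then show ?thesis using C4_values_root that by simp
      qed
    qed
  qed
qed

section \<open>Exterior powers and determinants\<close>

lemma permutes_conjugate:
  assumes "\<sigma> permutes K" "bij \<tau>"
  shows "(\<tau> \<circ> \<sigma> \<circ> Hilbert_Choice.inv \<tau>) permutes (\<tau> ` K)"
  unfolding permutes_def
proof (intro conjI allI impI)
  fix x assume "x \<notin> \<tau> ` K"
  then have "Hilbert_Choice.inv \<tau> x \<notin> K" using assms(2) by (metis bij_inv_eq_iff image_eqI)
  then show "(\<tau> \<circ> \<sigma> \<circ> Hilbert_Choice.inv \<tau>) x = x"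
    using assms by (simp add: permutes_not_in bij_is_surj surj_f_inv_f)
next
  fix y
  have "bij (\<tau> \<circ> \<sigma> \<circ> Hilbert_Choice.inv \<tau>)" using assms by (intro bij_comp bij_imp_bij_inv permutes_bij)
  then show "\<exists>!x. (\<tau> \<circ> \<sigma> \<circ> Hilbert_Choice.inv \<tau>) x = y" by (simp add: bij_iff)
qed

text \<open>The list J is completed to a permutation tau of all indices with tau(p) = J_p for p < k.
  Conjugation by tau carries the permutations of {0..<k} to those of the set of J and keeps the
  sign. The result no longer refers to the order of J, so it can be compared with the expansion of
  det(1 + tA).\<close>

lemma principal_minor:
  fixes A :: "nat \<Rightarrow> nat \<Rightarrow> 'a::comm_ring_1"
  assumes J: "distinct J" "set J \<subseteq> {0..<n}" "length J = k"
  shows "det (mat k k (\<lambda>(p, q). A (J ! p) (J ! q)))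
    = (\<Sum>\<pi> | \<pi> permutes set J. of_int (sign \<pi>) * (\<Prod>i\<in>set J. A i (\<pi> i)))"
proof -
  define L where "L = J @ filter (\<lambda>i. i \<notin> set J) [0..<n]"
  have L: "distinct L" "set L = {0..<n}" using J by (auto simp: L_def)
  then have len: "length L = n" using distinct_card[of L] by simp
  define \<tau> where "\<tau> i = (if i < n then L ! i else i)" for i
  have kn: "k \<le> n" using len J(3) by (simp add: L_def)
  have "bij_betw ((!) L) {0..<n} {0..<n}"
    using bij_betw_nth[OF L(1), of "{0..<n}" "{0..<n}"] L(2) len by (simp add: atLeast0LessThan)
  then have "bij_betw \<tau> {0..<n} {0..<n}"
    by (subst bij_betw_cong[of _ _ "(!) L"]) (auto simp: \<tau>_def)
  then have tau: "\<tau> permutes {0..<n}" by (rule bij_imp_permutes) (simp add: \<tau>_def)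
  have bij: "bij \<tau>" using tau by (rule permutes_bij)
  have tauJ: "\<tau> p = J ! p" if "p < k" for p
    using that kn J(3) by (simp add: \<tau>_def L_def nth_append)
  have img: "\<tau> ` {0..<k} = set J"
    using tauJ J(3) by (auto simp: in_set_conv_nth image_iff) (metis atLeastLessThan_iff zero_le)
  have perm: "permutation \<tau>" using tau finite_atLeastLessThan permutation_permutes by blast
  have sgn: "sign (\<tau> \<circ> \<sigma> \<circ> Hilbert_Choice.inv \<tau>) = sign \<sigma>" if "\<sigma> permutes {0..<k}" for \<sigma>
  proof -
    have "permutation \<sigma>" using that finite_atLeastLessThan permutation_permutes by blast
    then show ?thesis
      using perm by (simp add: sign_compose permutation_compose permutation_inverse sign_inverse sign_idempotent mult.left_commute)
  qed
  have invJ: "Hilbert_Choice.inv \<tau> ` set J = {0..<k}"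
    using bij by (simp add: img[symmetric] image_image bij_is_inj inv_f_f)
  have "det (mat k k (\<lambda>(p, q). A (J ! p) (J ! q)))
    = (\<Sum>\<sigma> | \<sigma> permutes {0..<k}. of_int (sign \<sigma>) * (\<Prod>p=0..<k. A (\<tau> p) (\<tau> (\<sigma> p))))"
  proof -
    have *: "(\<Prod>p=0..<k. mat k k (\<lambda>(p, q). A (J ! p) (J ! q)) $$ (p, \<sigma> p)) = (\<Prod>p=0..<k. A (\<tau> p) (\<tau> (\<sigma> p)))"
      if "\<sigma> permutes {0..<k}" for \<sigma>
    proof (rule prod.cong)
      fix p assume "p \<in> {0..<k}"
      moreover from this have "\<sigma> p \<in> {0..<k}" using that by (simp only: permutes_in_image)
      ultimately show "mat k k (\<lambda>(p, q). A (J ! p) (J ! q)) $$ (p, \<sigma> p) = A (\<tau> p) (\<tau> (\<sigma> p))"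
        by (simp add: tauJ)
    qed simp
    have "det (mat k k (\<lambda>(p, q). A (J ! p) (J ! q))) = (\<Sum>\<sigma> | \<sigma> permutes {0..<k}.
        of_int (sign \<sigma>) * (\<Prod>p=0..<k. mat k k (\<lambda>(p, q). A (J ! p) (J ! q)) $$ (p, \<sigma> p)))"
      by (rule det_def') simp
    also have "\<dots> = (\<Sum>\<sigma> | \<sigma> permutes {0..<k}. of_int (sign \<sigma>) * (\<Prod>p=0..<k. A (\<tau> p) (\<tau> (\<sigma> p))))"
      by (intro sum.cong refl) (simp only: mem_Collect_eq *)
    finally show ?thesis .
  qed
  also have "\<dots> = (\<Sum>\<pi> | \<pi> permutes set J. of_int (sign \<pi>) * (\<Prod>i\<in>set J. A i (\<pi> i)))"
  proof (rule sum.reindex_bij_witness[of _ "\<lambda>\<pi>. Hilbert_Choice.inv \<tau> \<circ> \<pi> \<circ> \<tau>" "\<lambda>\<sigma>. \<tau> \<circ> \<sigma> \<circ> Hilbert_Choice.inv \<tau>"])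
    fix \<sigma> assume \<sigma>: "\<sigma> \<in> {\<sigma>. \<sigma> permutes {0..<k}}"
    show "Hilbert_Choice.inv \<tau> \<circ> (\<tau> \<circ> \<sigma> \<circ> Hilbert_Choice.inv \<tau>) \<circ> \<tau> = \<sigma>"
      using bij by (simp add: fun_eq_iff bij_is_inj inv_f_f)
    show "\<tau> \<circ> \<sigma> \<circ> Hilbert_Choice.inv \<tau> \<in> {\<pi>. \<pi> permutes set J}"
      using permutes_conjugate[of \<sigma> "{0..<k}" \<tau>] \<sigma> bij by (simp add: img)
    have "(\<Prod>i\<in>set J. A i ((\<tau> \<circ> \<sigma> \<circ> Hilbert_Choice.inv \<tau>) i)) = (\<Prod>p\<in>{0..<k}. A (\<tau> p) ((\<tau> \<circ> \<sigma> \<circ> Hilbert_Choice.inv \<tau>) (\<tau> p)))"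
      unfolding img[symmetric] using bij by (subst prod.reindex) (auto simp: bij_is_inj inj_on_subset[OF bij_is_inj])
    then show "of_int (sign (\<tau> \<circ> \<sigma> \<circ> Hilbert_Choice.inv \<tau>)) * (\<Prod>i\<in>set J. A i ((\<tau> \<circ> \<sigma> \<circ> Hilbert_Choice.inv \<tau>) i))
      = of_int (sign \<sigma>) * (\<Prod>p=0..<k. A (\<tau> p) (\<tau> (\<sigma> p)))"
      using sgn \<sigma> bij by (simp add: bij_is_inj inv_f_f)
  next
    fix \<pi> assume \<pi>: "\<pi> \<in> {\<pi>. \<pi> permutes set J}"
    show "\<tau> \<circ> (Hilbert_Choice.inv \<tau> \<circ> \<pi> \<circ> \<tau>) \<circ> Hilbert_Choice.inv \<tau> = \<pi>"
      using bij by (simp add: fun_eq_iff bij_is_surj surj_f_inv_f)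
    show "Hilbert_Choice.inv \<tau> \<circ> \<pi> \<circ> \<tau> \<in> {\<sigma>. \<sigma> permutes {0..<k}}"
      using permutes_conjugate[of \<pi> "set J" "Hilbert_Choice.inv \<tau>"] \<pi> bij by (simp add: invJ bij_imp_bij_inv inv_inv_eq)
  qed
  finally show ?thesis .
qed

text \<open>In each Leibniz product, S is the set of rows from which the term with t is taken. The
  remaining rows contribute entries of the identity matrix, so only permutations that fix everything
  outside S survive.\<close>

lemma det_one_plus:
  fixes A :: "nat \<Rightarrow> nat \<Rightarrow> 'a::comm_ring_1"
  shows "det (mat n n (\<lambda>(i, j). (if i = j then 1 else 0) + t * A i j))
    = (\<Sum>S\<in>Pow {0..<n}. t ^ card S * (\<Sum>\<pi> | \<pi> permutes S. of_int (sign \<pi>) * (\<Prod>i\<in>S. A i (\<pi> i))))"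
proof -
  let ?N = "{0..<n}"
  let ?d = "\<lambda>i j. if i = j then 1 else (0 :: 'a)"
  have "det (mat n n (\<lambda>(i, j). ?d i j + t * A i j))
    = (\<Sum>\<sigma> | \<sigma> permutes ?N. of_int (sign \<sigma>) * (\<Prod>i\<in>?N. t * A i (\<sigma> i) + ?d i (\<sigma> i)))"
  proof -
    have *: "(\<Prod>i\<in>?N. mat n n (\<lambda>(i, j). ?d i j + t * A i j) $$ (i, \<sigma> i)) = (\<Prod>i\<in>?N. t * A i (\<sigma> i) + ?d i (\<sigma> i))"
      if "\<sigma> permutes ?N" for \<sigma>
    proof (rule prod.cong)
      fix i assume "i \<in> ?N"
      moreover from this have "\<sigma> i \<in> ?N" using that by (simp only: permutes_in_image)
      ultimately show "mat n n (\<lambda>(i, j). ?d i j + t * A i j) $$ (i, \<sigma> i) = t * A i (\<sigma> i) + ?d i (\<sigma> i)"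
        by (simp add: add.commute)
    qed simp
    have "det (mat n n (\<lambda>(i, j). ?d i j + t * A i j)) = (\<Sum>\<sigma> | \<sigma> permutes ?N.
        of_int (sign \<sigma>) * (\<Prod>i\<in>?N. mat n n (\<lambda>(i, j). ?d i j + t * A i j) $$ (i, \<sigma> i)))"
      by (rule det_def') simp
    also have "\<dots> = (\<Sum>\<sigma> | \<sigma> permutes ?N. of_int (sign \<sigma>) * (\<Prod>i\<in>?N. t * A i (\<sigma> i) + ?d i (\<sigma> i)))"
      by (intro sum.cong refl) (simp only: mem_Collect_eq *)
    finally show ?thesis .
  qed
  also have "\<dots> = (\<Sum>\<sigma> | \<sigma> permutes ?N. \<Sum>S\<in>Pow ?N. of_int (sign \<sigma>) *
      ((\<Prod>i\<in>S. t * A i (\<sigma> i)) * (\<Prod>i\<in>?N - S. ?d i (\<sigma> i))))"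
    by (simp add: prod_add sum_distrib_left)
  also have "\<dots> = (\<Sum>S\<in>Pow ?N. \<Sum>\<sigma> | \<sigma> permutes ?N. of_int (sign \<sigma>) *
      ((\<Prod>i\<in>S. t * A i (\<sigma> i)) * (\<Prod>i\<in>?N - S. ?d i (\<sigma> i))))"
    by (rule sum.swap)
  also have "\<dots> = (\<Sum>S\<in>Pow ?N. t ^ card S * (\<Sum>\<pi> | \<pi> permutes S. of_int (sign \<pi>) * (\<Prod>i\<in>S. A i (\<pi> i))))"
  proof (rule sum.cong)
    fix S assume S: "S \<in> Pow ?N"
    have "(\<Sum>\<sigma> | \<sigma> permutes ?N. of_int (sign \<sigma>) * ((\<Prod>i\<in>S. t * A i (\<sigma> i)) * (\<Prod>i\<in>?N - S. ?d i (\<sigma> i))))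
      = (\<Sum>\<sigma> | \<sigma> permutes S. t ^ card S * (of_int (sign \<sigma>) * (\<Prod>i\<in>S. A i (\<sigma> i))))"
    proof (rule sum.mono_neutral_cong_right)
      show "finite {\<sigma>. \<sigma> permutes ?N}" by (simp add: finite_permutations)
      show "{\<sigma>. \<sigma> permutes S} \<subseteq> {\<sigma>. \<sigma> permutes ?N}" using S by (auto intro: permutes_subset)
      show "\<forall>\<sigma>\<in>{\<sigma>. \<sigma> permutes ?N} - {\<sigma>. \<sigma> permutes S}.
        of_int (sign \<sigma>) * ((\<Prod>i\<in>S. t * A i (\<sigma> i)) * (\<Prod>i\<in>?N - S. ?d i (\<sigma> i))) = 0"
      proof
        fix \<sigma> assume \<sigma>: "\<sigma> \<in> {\<sigma>. \<sigma> permutes ?N} - {\<sigma>. \<sigma> permutes S}"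
        have "\<exists>i\<in>?N - S. i \<noteq> \<sigma> i"
        proof (rule ccontr)
          assume "\<not> ?thesis"
          then have "\<sigma> i = i" if "i \<in> ?N - S" for i using that by metis
          then have "\<sigma> permutes S" using \<sigma> permutes_superset[of \<sigma> ?N S] by blast
          then show False using \<sigma> by simp
        qed
        then have "(\<Prod>i\<in>?N - S. ?d i (\<sigma> i)) = 0" by (intro prod_zero) auto
        then show "of_int (sign \<sigma>) * ((\<Prod>i\<in>S. t * A i (\<sigma> i)) * (\<Prod>i\<in>?N - S. ?d i (\<sigma> i))) = 0" by simp
      qed
      fix \<sigma> assume "\<sigma> \<in> {\<sigma>. \<sigma> permutes S}"
      then have "(\<Prod>i\<in>?N - S. ?d i (\<sigma> i)) = 1" by (intro prod.neutral) (auto simp: permutes_not_in)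
      then show "of_int (sign \<sigma>) * ((\<Prod>i\<in>S. t * A i (\<sigma> i)) * (\<Prod>i\<in>?N - S. ?d i (\<sigma> i)))
        = t ^ card S * (of_int (sign \<sigma>) * (\<Prod>i\<in>S. A i (\<sigma> i)))"
        by (simp add: prod.distrib mult_ac)
    qed
    then show "(\<Sum>\<sigma> | \<sigma> permutes ?N. of_int (sign \<sigma>) * ((\<Prod>i\<in>S. t * A i (\<sigma> i)) * (\<Prod>i\<in>?N - S. ?d i (\<sigma> i))))
      = t ^ card S * (\<Sum>\<pi> | \<pi> permutes S. of_int (sign \<pi>) * (\<Prod>i\<in>S. A i (\<pi> i)))"
      by (simp add: sum_distrib_left)
  qed simp
  finally show ?thesis .
qed

lemma ext_basis_mem:
  assumes "J \<in> set (ext_basis n k)"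
  shows "distinct J" "set J \<subseteq> {0..<n}" "length J = k"
proof -
  have J: "J \<in> set (subseqs [0..<n])" "length J = k" using assms by (auto simp: ext_basis_def)
  show "distinct J" using J(1) by (rule subseqs_distinctD) simp
  have "set J \<in> set ` set (subseqs [0..<n])" using J(1) by blast
  then show "set J \<subseteq> {0..<n}" by (simp add: subseqs_powset)
  show "length J = k" by fact
qed

lemma bij_betw_ext_basis: "bij_betw set (set (ext_basis n k)) {S \<in> Pow {0..<n}. card S = k}"
  unfolding bij_betw_def
proof
  have "distinct (map set (subseqs [0..<n]))" by (rule distinct_set_subseqs) simp
  then have inj: "inj_on set (set (subseqs [0..<n]))" by (simp add: distinct_map)
  show "inj_on set (set (ext_basis n k))"
    by (rule inj_on_subset[OF inj]) (auto simp: ext_basis_def)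
  show "set ` set (ext_basis n k) = {S \<in> Pow {0..<n}. card S = k}"
  proof
    show "set ` set (ext_basis n k) \<subseteq> {S \<in> Pow {0..<n}. card S = k}"
      using ext_basis_mem distinct_card by fastforce
    show "{S \<in> Pow {0..<n}. card S = k} \<subseteq> set ` set (ext_basis n k)"
    proof
      fix S assume S: "S \<in> {S \<in> Pow {0..<n}. card S = k}"
      then have "S \<in> set ` set (subseqs [0..<n])" by (simp add: subseqs_powset)
      then obtain J where J: "J \<in> set (subseqs [0..<n])" "S = set J" by blast
      then have "distinct J" using subseqs_distinctD[of J "[0..<n]"] by simp
      then have "J \<in> set (ext_basis n k)" using J S distinct_card[of J] by (simp add: ext_basis_def)
      then show "S \<in> set ` set (ext_basis n k)" using J(2) by blast
    qed
  qed
qed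

lemma distinct_ext_basis: "distinct (ext_basis n k)"
proof -
  have "distinct (map set (subseqs [0..<n]))" by (rule distinct_set_subseqs) simp
  then show ?thesis by (simp add: ext_basis_def distinct_map)
qed

lemma trace_exterior_power:
  fixes A :: "'a::comm_ring_1 mat"
  assumes "dim_row A = n"
  shows "mat_trace (exterior_power k A) = (\<Sum>S | S \<subseteq> {0..<n} \<and> card S = k.
     \<Sum>\<pi> | \<pi> permutes S. of_int (sign \<pi>) * (\<Prod>i\<in>S. A $$ (i, \<pi> i)))"
proof -
  let ?B = "ext_basis n k"
  let ?m = "\<lambda>J. det (mat k k (\<lambda>(p, q). A $$ (J ! p, J ! q)))"
  have "mat_trace (exterior_power k A) = (\<Sum>s<length ?B. ?m (?B ! s))"
    using assms by (simp add: mat_trace_def exterior_power_def Let_def)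
  also have "\<dots> = sum_list (map ?m ?B)"
    by (simp add: sum_list_sum_nth atLeast0LessThan)
  also have "\<dots> = (\<Sum>J\<in>set ?B. ?m J)"
    by (rule sum_list_distinct_conv_sum_set[OF distinct_ext_basis])
  also have "\<dots> = (\<Sum>J\<in>set ?B. \<Sum>\<pi> | \<pi> permutes set J. of_int (sign \<pi>) * (\<Prod>i\<in>set J. A $$ (i, \<pi> i)))"
    by (intro sum.cong refl principal_minor[where A = "\<lambda>i j. A $$ (i, j)" and n = n]) (simp_all add: ext_basis_mem)
  also have "\<dots> = (\<Sum>S\<in>{S \<in> Pow {0..<n}. card S = k}.
      \<Sum>\<pi> | \<pi> permutes S. of_int (sign \<pi>) * (\<Prod>i\<in>S. A $$ (i, \<pi> i)))"
    by (rule sum.reindex_bij_betw[OF bij_betw_ext_basis,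
        of "\<lambda>S. \<Sum>\<pi> | \<pi> permutes S. of_int (sign \<pi>) * (\<Prod>i\<in>S. A $$ (i, \<pi> i))"])
  finally show ?thesis by (simp add: Pow_def)
qed

lemma det_one_plus_exterior_power:
  fixes A :: "'a::comm_ring_1 mat"
  assumes "dim_row A = n"
  shows "det (mat n n (\<lambda>(i, j). (if i = j then 1 else 0) + t * A $$ (i, j)))
    = (\<Sum>k\<le>n. t ^ k * mat_trace (exterior_power k A))"
proof -
  define f where "f S = (\<Sum>\<pi> | \<pi> permutes S. of_int (sign \<pi>) * (\<Prod>i\<in>S. A $$ (i, \<pi> i)))" for S
  have "(\<Sum>S\<in>Pow {0..<n}. t ^ card S * f S)
      = (\<Sum>k\<le>n. \<Sum>S | S \<in> Pow {0..<n} \<and> card S = k. t ^ card S * f S)"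
    by (rule sum.group[symmetric]) (auto dest: card_mono[rotated])
  also have "\<dots> = (\<Sum>k\<le>n. t ^ k * mat_trace (exterior_power k A))"
    by (auto simp: trace_exterior_power[OF assms] f_def sum_distrib_left intro!: sum.cong)
  finally show ?thesis unfolding f_def by (simp add: det_one_plus[where A = "\<lambda>i j. A $$ (i, j)"])
qed

lemma trace_exterior_power_eq_0:
  fixes A :: "'a::comm_ring_1 mat"
  assumes "dim_row A = n" "n < k"
  shows "mat_trace (exterior_power k A) = 0"
proof -
  have "{S. S \<subseteq> {0..<n} \<and> card S = k} = {}"
    using assms(2) by (auto dest: card_mono[rotated])
  then show ?thesis by (simp only: trace_exterior_power[OF assms(1)]) simp
qed

section \<open>Determinants of families of projections\<close>

text \<open>$\det(1 + (v - 1)P)$ is a polynomial in $v$ which is multiplicative because $P^2 = P$, hence a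
  power of $v$.\<close>

lemma det_one_plus_idempotent:
  fixes P :: "nat \<Rightarrow> nat \<Rightarrow> complex"
  assumes P: "\<And>i j. i < n \<Longrightarrow> j < n \<Longrightarrow> (\<Sum>k=0..<n. P i k * P k j) = P i j"
  shows "\<exists>m. \<forall>s. det (mat n n (\<lambda>(i, j). (if i = j then 1 else 0) + s * P i j)) = (1 + s) ^ m"
proof -
  define M where "M s = mat n n (\<lambda>(i, j). (if i = j then 1 else 0) + s * P i j)" for s
  \<comment> \<open>The parameter s + r + sr is (1+s)(1+r) - 1, so in the variable v = 1 + s the
    family is multiplicative.\<close>
  have prod: "M s * M r = M (s + r + s * r)" for s r
  proof (rule eq_matI)
    fix i j assume "i < dim_row (M (s + r + s * r))" "j < dim_col (M (s + r + s * r))"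
    then have ij: "i < n" "j < n" by (auto simp: M_def)
    have "(M s * M r) $$ (i, j) = (\<Sum>k=0..<n. ((if i = k then 1 else 0) + s * P i k) * ((if k = j then 1 else 0) + r * P k j))"
      using ij by (simp add: M_def scalar_prod_def)
    also have "\<dots> = (\<Sum>k=0..<n. (if i = k then (if k = j then 1 else 0) else 0) + (if i = k then r * P k j else 0)
        + (if k = j then s * P i k else 0) + s * r * (P i k * P k j))"
      by (intro sum.cong refl) (auto simp: algebra_simps)
    also have "\<dots> = (if i = j then 1 else 0) + r * P i j + s * P i j + s * r * P i j"
      using ij by (simp add: sum.distrib sum.delta sum.delta' sum_distrib_left[symmetric] P)
    finally show "(M s * M r) $$ (i, j) = M (s + r + s * r) $$ (i, j)"
      using ij by (simp add: M_def algebra_simps)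
  qed (simp_all add: M_def)
  define g where "g = det (mat n n (\<lambda>(i, j). [:(if i = j then 1 else 0) - P i j, P i j:]))"
  have g: "poly g v = det (M (v - 1))" for v
    unfolding g_def M_def by (rule poly_det_cong[of _ n]) (auto simp: algebra_simps)
  have mult: "poly g (v * w) = poly g v * poly g w" for v w
  proof -
    have "poly g v * poly g w = det (M (v - 1) * M (w - 1))"
      unfolding g by (rule det_mult[of _ n, symmetric]) (auto simp: M_def)
    also have "\<dots> = poly g (v * w)" unfolding prod g by (simp add: algebra_simps)
    finally show ?thesis by simp
  qed
  have one: "poly g 1 = 1"
  proof -
    have "M 0 = 1\<^sub>m n" by (rule eq_matI) (auto simp: M_def)
    then show ?thesis by (simp add: g)
  qed
  \<comment> \<open>For fixed w, multiplicativity says that g(w) g and g(wX) are the same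
    polynomial. At any k with a nonzero coefficient, comparison gives g(w) = w^k for all w.\<close>
  have coeffs: "Polynomial.coeff g k * poly g w = Polynomial.coeff g k * w ^ k" for k w
  proof -
    have "Polynomial.smult (poly g w) g = pcompose g [:0, w:]"
      by (subst poly_eq_poly_eq_iff[symmetric]) (simp add: fun_eq_iff poly_pcompose mult mult.commute)
    then have "Polynomial.coeff (Polynomial.smult (poly g w) g) k = Polynomial.coeff (pcompose g [:0, w:]) k" by simp
    then show ?thesis by (simp add: coeff_pcompose_linear mult.commute)
  qed
  have "g \<noteq> 0" using one by auto
  then obtain k where "Polynomial.coeff g k \<noteq> 0" using leading_coeff_neq_0 by blast
  then have "poly g w = w ^ k" for w using coeffs[of k w] by simp
  then have "det (M s) = (1 + s) ^ k" for s using g[of "1 + s"] by simp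
  then show ?thesis unfolding M_def by blast
qed

text \<open>All mixed products vanish, so the product of the matrices 1 + s_chi P_chi is 1 plus the
  sum of the s_chi P_chi; the determinant is multiplicative.\<close>

lemma det_one_plus_orthogonal:
  fixes P :: "'c \<Rightarrow> nat \<Rightarrow> nat \<Rightarrow> complex"
  assumes "finite F"
    and P: "\<And>\<chi> \<psi> i j. \<chi> \<in> F \<Longrightarrow> \<psi> \<in> F \<Longrightarrow> \<chi> \<noteq> \<psi> \<Longrightarrow> i < n \<Longrightarrow> j < n \<Longrightarrow> (\<Sum>k=0..<n. P \<chi> i k * P \<psi> k j) = 0"
  shows "det (mat n n (\<lambda>(i, j). (if i = j then 1 else 0) + (\<Sum>\<chi>\<in>F. s \<chi> * P \<chi> i j)))
    = (\<Prod>\<chi>\<in>F. det (mat n n (\<lambda>(i, j). (if i = j then 1 else 0) + s \<chi> * P \<chi> i j)))"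
  using assms
proof (induction F)
  case empty
  have "mat n n (\<lambda>(i, j). (if i = j then 1 else 0) + (\<Sum>\<chi>\<in>{}. s \<chi> * P \<chi> i j)) = 1\<^sub>m n"
    by (rule eq_matI) auto
  then show ?case by simp
next
  case (insert \<phi> F)
  define Q where "Q i j = (\<Sum>\<chi>\<in>F. s \<chi> * P \<chi> i j)" for i j
  let ?A = "mat n n (\<lambda>(i, j). (if i = j then 1 else 0) + s \<phi> * P \<phi> i j)"
  let ?B = "mat n n (\<lambda>(i, j). (if i = j then 1 else 0) + Q i j)"
  have PQ: "(\<Sum>k=0..<n. P \<phi> i k * Q k j) = 0" if "i < n" "j < n" for i j
  proof -
    have "(\<Sum>k=0..<n. P \<phi> i k * Q k j) = (\<Sum>\<chi>\<in>F. \<Sum>k=0..<n. s \<chi> * (P \<phi> i k * P \<chi> k j))"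
      unfolding Q_def sum_distrib_left by (subst sum.swap) (simp add: mult_ac)
    also have "\<dots> = (\<Sum>\<chi>\<in>F. s \<chi> * (\<Sum>k=0..<n. P \<phi> i k * P \<chi> k j))"
      by (simp only: sum_distrib_left)
    also have "\<dots> = 0" using insert that by (intro sum.neutral ballI) (auto intro!: insert.prems)
    finally show ?thesis .
  qed
  have "mat n n (\<lambda>(i, j). (if i = j then 1 else 0) + (\<Sum>\<chi>\<in>insert \<phi> F. s \<chi> * P \<chi> i j)) = ?A * ?B"
  proof (rule eq_matI)
    fix i j assume "i < dim_row (?A * ?B)" "j < dim_col (?A * ?B)"
    then have ij: "i < n" "j < n" by auto
    have "(?A * ?B) $$ (i, j) = (\<Sum>k=0..<n. ((if i = k then 1 else 0) + s \<phi> * P \<phi> i k) * ((if k = j then 1 else 0) + Q k j))"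
      using ij by (simp add: scalar_prod_def)
    also have "\<dots> = (\<Sum>k=0..<n. (if i = k then (if k = j then 1 else 0) else 0) + (if i = k then Q k j else 0)
        + (if k = j then s \<phi> * P \<phi> i k else 0) + s \<phi> * (P \<phi> i k * Q k j))"
      by (intro sum.cong refl) (auto simp: algebra_simps)
    also have "\<dots> = (if i = j then 1 else 0) + Q i j + s \<phi> * P \<phi> i j"
      using ij by (simp add: sum.distrib sum.delta sum.delta' sum_distrib_left[symmetric] PQ)
    finally show "mat n n (\<lambda>(i, j). (if i = j then 1 else 0) + (\<Sum>\<chi>\<in>insert \<phi> F. s \<chi> * P \<chi> i j)) $$ (i, j)
        = (?A * ?B) $$ (i, j)"
      using ij insert.hyps by (simp add: Q_def algebra_simps)
  qed simp_all
  moreover have "det (?A * ?B) = det ?A * det ?B" by (rule det_mult[of _ n]) auto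
  moreover have "det ?B = (\<Prod>\<chi>\<in>F. det (mat n n (\<lambda>(i, j). (if i = j then 1 else 0) + s \<chi> * P \<chi> i j)))"
    unfolding Q_def using insert.prems by (intro insert.IH) auto
  ultimately show ?case using insert.hyps by simp
qed

section \<open>Characters of a finite abelian group\<close>

lemma fun_ring_simps [simp]:
  "carrier (fun_ring X) = X \<rightarrow>\<^sub>E UNIV"
  "f \<otimes>\<^bsub>fun_ring X\<^esub> h = (\<lambda>g\<in>X. f g * h g)" "\<one>\<^bsub>fun_ring X\<^esub> = (\<lambda>g\<in>X. 1)"
  "\<zero>\<^bsub>fun_ring X\<^esub> = (\<lambda>g\<in>X. 0)" "f \<oplus>\<^bsub>fun_ring X\<^esub> h = (\<lambda>g\<in>X. f g + h g)"
  by (simp_all add: fun_ring_def)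

lemma cring_fun_ring: "cring (fun_ring X)"
proof (rule cringI)
  have minus: "\<exists>y\<in>X \<rightarrow>\<^sub>E UNIV. (\<lambda>g\<in>X. y g + f g) = (\<lambda>g\<in>X. 0)" for f :: "'a \<Rightarrow> complex"
    by (rule bexI[of _ "\<lambda>g\<in>X. - f g"]) (auto simp: fun_eq_iff)
  show "abelian_group (fun_ring X)"
    by (rule abelian_groupI)
       (use minus in \<open>auto simp: fun_eq_iff PiE_def extensional_def restrict_def algebra_simps\<close>)
  show "comm_monoid (fun_ring X)"
    by (rule comm_monoidI)
       (auto simp: fun_eq_iff PiE_def extensional_def restrict_def algebra_simps)
qed (auto simp: fun_eq_iff algebra_simps)

lemma a_inv_fun_ring:
  assumes "f \<in> X \<rightarrow>\<^sub>E UNIV"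
  shows "\<ominus>\<^bsub>fun_ring X\<^esub> f = (\<lambda>g\<in>X. - f g)"
proof -
  interpret cring "fun_ring X" by (rule cring_fun_ring)
  show ?thesis by (rule minus_equality) (use assms in \<open>auto simp: fun_eq_iff\<close>)
qed

lemma char_ring_simps [simp]:
  "f \<otimes>\<^bsub>char_ring G\<^esub> h = (\<lambda>g\<in>carrier G. f g * h g)" "\<one>\<^bsub>char_ring G\<^esub> = (\<lambda>g\<in>carrier G. 1)"
  "\<zero>\<^bsub>char_ring G\<^esub> = (\<lambda>g\<in>carrier G. 0)" "f \<oplus>\<^bsub>char_ring G\<^esub> h = (\<lambda>g\<in>carrier G. f g + h g)"
  by (simp_all add: char_ring_def)

lemma carrier_char_ring:
  "carrier (char_ring G) = generate (add_monoid (fun_ring (carrier G)))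
     {rep_char G \<rho> | n \<rho>. irreducible_rep G n \<rho>}"
  by (simp add: char_ring_def)

text \<open>Both orthogonality relations together force G to be abelian with Ch as its full dual
  group. Row orthogonality makes the isotypic projections orthogonal idempotents and the elements of
  Ch independent; column orthogonality recovers a representation from its projections.\<close>

locale dual_group = group G for G (structure) +
  fixes Ch :: "('a \<Rightarrow> complex) set"
  assumes finite_carrier: "finite (carrier G)" and finite_Ch: "finite Ch"
    and Ch_extensional: "\<chi> \<in> Ch \<Longrightarrow> \<chi> \<in> extensional (carrier G)"
    and Ch_mult: "\<chi> \<in> Ch \<Longrightarrow> x \<in> carrier G \<Longrightarrow> y \<in> carrier G \<Longrightarrow> \<chi> (x \<otimes> y) = \<chi> x * \<chi> y"
    and Ch_one: "\<chi> \<in> Ch \<Longrightarrow> \<chi> \<one> = 1"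
    and Ch_closed: "\<chi> \<in> Ch \<Longrightarrow> \<psi> \<in> Ch \<Longrightarrow> (\<lambda>g\<in>carrier G. \<chi> g * \<psi> g) \<in> Ch"
    and trivial_Ch: "(\<lambda>g\<in>carrier G. 1) \<in> Ch"
    and row_orthogonality: "\<chi> \<in> Ch \<Longrightarrow> \<psi> \<in> Ch \<Longrightarrow>
      (\<Sum>g\<in>carrier G. \<chi> g * \<psi> (inv g)) = (if \<chi> = \<psi> then of_nat (card (carrier G)) else 0)"
    and column_orthogonality: "g \<in> carrier G \<Longrightarrow>
      (\<Sum>\<chi>\<in>Ch. \<chi> g) = (if g = \<one> then of_nat (card (carrier G)) else 0)"
begin

lemma card_carrier_pos: "(of_nat (card (carrier G)) :: complex) \<noteq> 0"
  using finite_carrier by (auto simp: card_eq_0_iff)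

lemma representation_mult:
  assumes "\<rho> \<in> representations G n" "g \<in> carrier G" "h \<in> carrier G"
  shows "\<rho> (g \<otimes> h) = \<rho> g * \<rho> h"
proof -
  have "\<rho> (g \<otimes> h) = \<rho> g \<otimes>\<^bsub>units_of (ring_mat TYPE(complex) n ())\<^esub> \<rho> h"
    using assms by (simp add: representations_def hom_def)
  then show "\<rho> (g \<otimes> h) = \<rho> g * \<rho> h" by (simp add: units_of_mult ring_mat_simps)
qed

lemma representation_carrier:
  assumes "\<rho> \<in> representations G n" "g \<in> carrier G"
  shows "\<rho> g \<in> carrier_mat n n"
proof -
  have "\<rho> g \<in> carrier (units_of (ring_mat TYPE(complex) n ()))"
    using assms by (auto simp: representations_def hom_def)
  then show "\<rho> g \<in> carrier_mat n n" by (auto simp: units_of_carrier Units_def ring_mat_simps)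
qed

text \<open>The isotypic projections of \<open>\<rho>\<close> are orthogonal idempotents, and \<open>\<rho> g\<close> acts on each by
  the scalar \<open>\<chi> g\<close>.\<close>

lemma det_representation:
  assumes \<rho>: "\<rho> \<in> representations G n"
  obtains m :: "('a \<Rightarrow> complex) \<Rightarrow> nat" where
    "\<And>g t. g \<in> carrier G \<Longrightarrow>
      det (mat n n (\<lambda>(i, j). (if i = j then 1 else 0) + t * \<rho> g $$ (i, j))) = (\<Prod>\<chi>\<in>Ch. (1 + t * \<chi> g) ^ m \<chi>)"
proof -
  define N where "N = (of_nat (card (carrier G)) :: complex)"
  have N: "N \<noteq> 0" using card_carrier_pos by (simp add: N_def)
  define P where "P \<chi> i j = (\<Sum>g\<in>carrier G. \<chi> (inv g) * \<rho> g $$ (i, j)) / N" for \<chi> i j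
  have prod: "(\<Sum>k=0..<n. \<rho> g $$ (i, k) * \<rho> h $$ (k, j)) = \<rho> (g \<otimes> h) $$ (i, j)"
    if "g \<in> carrier G" "h \<in> carrier G" "i < n" "j < n" for g h i j
    using representation_mult[OF \<rho>] representation_carrier[OF \<rho>, THEN carrier_matD(1)]
      representation_carrier[OF \<rho>, THEN carrier_matD(2)] that by (simp add: scalar_prod_def)
  have orth: "(\<Sum>k=0..<n. P \<chi> i k * P \<psi> k j) = (if \<chi> = \<psi> then P \<psi> i j else 0)"
    if "\<chi> \<in> Ch" "\<psi> \<in> Ch" and ij: "i < n" "j < n" for \<chi> \<psi> i j
  proof -
    have "(\<Sum>k=0..<n. P \<chi> i k * P \<psi> k j) = (\<Sum>k=0..<n. \<Sum>g\<in>carrier G. \<Sum>h\<in>carrier G.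
        \<chi> (inv g) * \<psi> (inv h) * (\<rho> g $$ (i, k) * \<rho> h $$ (k, j))) / (N * N)"
      unfolding P_def times_divide_times_eq sum_product sum_divide_distrib[symmetric]
      by (simp add: mult_ac)
    also have "(\<Sum>k=0..<n. \<Sum>g\<in>carrier G. \<Sum>h\<in>carrier G.
        \<chi> (inv g) * \<psi> (inv h) * (\<rho> g $$ (i, k) * \<rho> h $$ (k, j)))
      = (\<Sum>g\<in>carrier G. \<Sum>h\<in>carrier G. \<Sum>k=0..<n. \<chi> (inv g) * \<psi> (inv h) * (\<rho> g $$ (i, k) * \<rho> h $$ (k, j)))"
      by (subst sum.swap, rule sum.cong[OF refl], rule sum.swap)
    also have "\<dots> = (\<Sum>g\<in>carrier G. \<Sum>h\<in>carrier G. \<chi> (inv g) * \<psi> (inv h) * \<rho> (g \<otimes> h) $$ (i, j))"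
      unfolding sum_distrib_left[symmetric] by (intro sum.cong refl) (simp add: prod ij)
    \<comment> \<open>After the substitution k = gh the factor psi(inv h) becomes psi(inv k) psi(g),
      and the sum over g is a row sum.\<close>
    also have "\<dots> = (\<Sum>g\<in>carrier G. \<Sum>k\<in>carrier G. \<chi> (inv g) * \<psi> (inv (inv g \<otimes> k)) * \<rho> k $$ (i, j))"
    proof (rule sum.cong[OF refl])
      fix g assume g: "g \<in> carrier G"
      show "(\<Sum>h\<in>carrier G. \<chi> (inv g) * \<psi> (inv h) * \<rho> (g \<otimes> h) $$ (i, j))
        = (\<Sum>k\<in>carrier G. \<chi> (inv g) * \<psi> (inv (inv g \<otimes> k)) * \<rho> k $$ (i, j))"
        by (rule sum.reindex_bij_witness[of _ "\<lambda>k. inv g \<otimes> k" "\<lambda>h. g \<otimes> h"])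
           (use g in \<open>auto simp: m_assoc[symmetric]\<close>)
    qed
    also have "\<dots> = (\<Sum>g\<in>carrier G. \<Sum>k\<in>carrier G. (\<psi> (inv k) * \<rho> k $$ (i, j)) * (\<psi> g * \<chi> (inv g)))"
      using that by (intro sum.cong refl) (simp add: inv_mult_group Ch_mult mult_ac)
    also have "\<dots> = (\<Sum>k\<in>carrier G. (\<psi> (inv k) * \<rho> k $$ (i, j)) * (\<Sum>g\<in>carrier G. \<psi> g * \<chi> (inv g)))"
      by (subst sum.swap) (simp add: sum_distrib_left)
    also have "\<dots> = (\<Sum>k\<in>carrier G. \<psi> (inv k) * \<rho> k $$ (i, j)) * (if \<chi> = \<psi> then N else 0)"
      using that by (auto simp: row_orthogonality N_def sum_distrib_right)
    finally show ?thesis using N by (simp add: P_def)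
  qed
  have recover: "(\<Sum>\<chi>\<in>Ch. \<chi> h * P \<chi> i j) = \<rho> h $$ (i, j)" if h: "h \<in> carrier G" for h i j
  proof -
    have "(\<Sum>\<chi>\<in>Ch. \<chi> h * P \<chi> i j) = (\<Sum>\<chi>\<in>Ch. \<Sum>g\<in>carrier G. \<chi> h * (\<chi> (inv g) * \<rho> g $$ (i, j))) / N"
      unfolding P_def by (simp add: sum_divide_distrib sum_distrib_left)
    also have "(\<Sum>\<chi>\<in>Ch. \<Sum>g\<in>carrier G. \<chi> h * (\<chi> (inv g) * \<rho> g $$ (i, j)))
        = (\<Sum>g\<in>carrier G. (\<Sum>\<chi>\<in>Ch. \<chi> (h \<otimes> inv g)) * \<rho> g $$ (i, j))"
      unfolding sum_distrib_right using h
      by (subst sum.swap) (intro sum.cong refl, simp add: Ch_mult mult_ac)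
    also have "\<dots> = (\<Sum>g\<in>carrier G. if g = h then N * \<rho> h $$ (i, j) else 0)"
    proof (rule sum.cong[OF refl])
      fix g assume g: "g \<in> carrier G"
      have "h \<otimes> inv g = \<one> \<longleftrightarrow> g = h" using g h by (metis inv_equality inv_inv inv_closed r_inv)
      then show "(\<Sum>\<chi>\<in>Ch. \<chi> (h \<otimes> inv g)) * \<rho> g $$ (i, j) = (if g = h then N * \<rho> h $$ (i, j) else 0)"
        using g h by (simp add: column_orthogonality N_def)
    qed
    also have "\<dots> = N * \<rho> h $$ (i, j)" using h finite_carrier by simp
    finally show ?thesis using N by simp
  qed
  \<comment> \<open>The exponent is obtained from P chi alone, before any g is chosen; this is what
    makes it uniform in g.\<close>
  have "\<exists>m. \<forall>s. det (mat n n (\<lambda>(i, j). (if i = j then 1 else 0) + s * P \<chi> i j)) = (1 + s) ^ m" if "\<chi> \<in> Ch" for \<chi>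
    by (rule det_one_plus_idempotent) (simp add: orth that)
  then have "\<forall>\<chi>\<in>Ch. \<exists>m. \<forall>s. det (mat n n (\<lambda>(i, j). (if i = j then 1 else 0) + s * P \<chi> i j)) = (1 + s) ^ m"
    by blast
  from bchoice[OF this] obtain m where m: "\<And>\<chi> s. \<chi> \<in> Ch \<Longrightarrow>
      det (mat n n (\<lambda>(i, j). (if i = j then 1 else 0) + s * P \<chi> i j)) = (1 + s) ^ m \<chi>"
    by blast
  show thesis
  proof
    fix g t assume g: "g \<in> carrier G"
    have "det (mat n n (\<lambda>(i, j). (if i = j then 1 else 0) + t * \<rho> g $$ (i, j)))
      = det (mat n n (\<lambda>(i, j). (if i = j then 1 else 0) + (\<Sum>\<chi>\<in>Ch. (t * \<chi> g) * P \<chi> i j)))"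
      by (simp add: recover[OF g, symmetric] sum_distrib_left mult.assoc)
    also have "\<dots> = (\<Prod>\<chi>\<in>Ch. det (mat n n (\<lambda>(i, j). (if i = j then 1 else 0) + (t * \<chi> g) * P \<chi> i j)))"
      by (rule det_one_plus_orthogonal[OF finite_Ch]) (simp add: orth)
    also have "\<dots> = (\<Prod>\<chi>\<in>Ch. (1 + t * \<chi> g) ^ m \<chi>)" by (simp add: m)
    finally show "det (mat n n (\<lambda>(i, j). (if i = j then 1 else 0) + t * \<rho> g $$ (i, j))) = (\<Prod>\<chi>\<in>Ch. (1 + t * \<chi> g) ^ m \<chi>)" .
  qed
qed

lemma Ch_irreducible:
  assumes "\<chi> \<in> Ch"
  shows "\<exists>\<rho>. irreducible_rep G 1 \<rho> \<and> rep_char G \<rho> = \<chi>"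
proof (intro exI conjI)
  let ?\<rho> = "\<lambda>g. mat 1 1 (\<lambda>_. \<chi> g)"
  show "rep_char G ?\<rho> = \<chi>"
    using Ch_extensional[OF assms] by (auto simp: rep_char_def mat_trace_def extensional_def)
  have mult: "?\<rho> g * ?\<rho> h = ?\<rho> (g \<otimes> h)" if "g \<in> carrier G" "h \<in> carrier G" for g h
    by (rule eq_matI) (use that assms in \<open>auto simp: scalar_prod_def Ch_mult\<close>)
  have one: "?\<rho> \<one> = 1\<^sub>m 1" by (rule eq_matI) (use assms in \<open>auto simp: Ch_one\<close>)
  have unit: "?\<rho> g \<in> Units (ring_mat TYPE(complex) 1 ())" if "g \<in> carrier G" for g
    unfolding Units_def ring_mat_simps
    using that mult[of g "inv g"] mult[of "inv g" g] one
    by (auto intro!: bexI[of _ "?\<rho> (inv g)"])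
  have "?\<rho> \<in> representations G 1"
    unfolding representations_def
    by (rule homI) (simp_all only: units_of_carrier unit units_of_mult ring_mat_simps mult)
  moreover have "W = {0\<^sub>v 1} \<or> W = carrier_vec 1"
    if "VectorSpace.subspace class_ring W (module_vec TYPE(complex) 1)" for W
  proof -
    have W: "submodule class_ring W (module_vec TYPE(complex) 1)"
      by (rule VectorSpace.subspace.submod[OF that])
    have sub: "W \<subseteq> carrier_vec 1" and zero: "0\<^sub>v 1 \<in> W"
      and smult: "\<And>c v. v \<in> W \<Longrightarrow> c \<cdot>\<^sub>v v \<in> W"
      using W unfolding submodule_def by (auto simp: module_vec_def)
    show ?thesis
    proof (cases "W = {0\<^sub>v 1}")
      case False
      then obtain w where w: "w \<in> W" "w \<noteq> 0\<^sub>v 1" using zero by blast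
      then have "w $ 0 \<noteq> 0" using sub by (auto simp: vec_eq_iff)
      have "v \<in> W" if "v \<in> carrier_vec 1" for v
      proof -
        have "v = (v $ 0 / w $ 0) \<cdot>\<^sub>v w"
          using that w sub \<open>w $ 0 \<noteq> 0\<close> by (auto simp: vec_eq_iff)
        then show ?thesis using smult[OF w(1)] by metis
      qed
      then show ?thesis using sub by blast
    qed simp
  qed
  ultimately show "irreducible_rep G 1 ?\<rho>" by (simp add: irreducible_rep_def)
qed

text \<open>The coefficient function is defined on all functions, but only its values on Ch enter;
  \<open>comb_inject\<close> recovers exactly those.\<close>

definition comb :: "(('a \<Rightarrow> complex) \<Rightarrow> int) \<Rightarrow> 'a \<Rightarrow> complex" where
  "comb c = (\<lambda>g\<in>carrier G. \<Sum>\<chi>\<in>Ch. of_int (c \<chi>) * \<chi> g)"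

text \<open>Pairing with psi(inv g) isolates the coefficient of psi by row orthogonality.\<close>

lemma comb_inject:
  assumes "comb c = comb d" "\<psi> \<in> Ch"
  shows "c \<psi> = d \<psi>"
proof -
  have key: "(\<Sum>g\<in>carrier G. comb c g * \<psi> (inv g)) = of_int (c \<psi>) * of_nat (card (carrier G))" for c
  proof -
    have "(\<Sum>g\<in>carrier G. comb c g * \<psi> (inv g)) = (\<Sum>\<chi>\<in>Ch. of_int (c \<chi>) * (\<Sum>g\<in>carrier G. \<chi> g * \<psi> (inv g)))"
    proof -
      have "(\<Sum>g\<in>carrier G. comb c g * \<psi> (inv g)) = (\<Sum>g\<in>carrier G. \<Sum>\<chi>\<in>Ch. of_int (c \<chi>) * (\<chi> g * \<psi> (inv g)))"
        by (intro sum.cong refl) (simp add: comb_def sum_distrib_right mult.assoc)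
      then show ?thesis unfolding sum_distrib_left by (subst (asm) sum.swap)
    qed
    also have "\<dots> = (\<Sum>\<chi>\<in>Ch. if \<chi> = \<psi> then of_int (c \<psi>) * of_nat (card (carrier G)) else 0)"
      using assms by (intro sum.cong refl) (auto simp: row_orthogonality)
    finally show ?thesis using assms(2) finite_Ch by simp
  qed
  have "of_int (c \<psi>) * (of_nat (card (carrier G)) :: complex) = of_int (d \<psi>) * of_nat (card (carrier G))"
    unfolding key[symmetric] assms(1) ..
  then show ?thesis using card_carrier_pos by simp
qed

lemma comb_Ch:
  assumes "\<chi> \<in> Ch"
  shows "comb (\<lambda>\<psi>. of_bool (\<psi> = \<chi>)) = \<chi>"
proof
  fix g
  have "(\<Sum>\<psi>\<in>Ch. of_int (of_bool (\<psi> = \<chi>)) * \<psi> g) = (\<Sum>\<psi>\<in>Ch. if \<psi> = \<chi> then \<chi> g else 0)"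
    by (intro sum.cong) auto
  then show "comb (\<lambda>\<psi>. of_bool (\<psi> = \<chi>)) g = \<chi> g"
    using assms finite_Ch Ch_extensional[OF assms] by (simp add: comb_def extensional_def)
qed

text \<open>Elements of the character ring are undefined outside G. Restricting inside the predicate
  lets closure properties be stated for plain pointwise expressions.\<close>

definition virtual :: "('a \<Rightarrow> complex) \<Rightarrow> bool" where
  "virtual f \<longleftrightarrow> restrict f (carrier G) \<in> range comb"

lemma virtual_comb [simp]: "virtual (comb c)"
  unfolding virtual_def by (rule range_eqI[of _ _ c]) (simp add: comb_def fun_eq_iff restrict_def)

lemma virtual_cong: "(\<And>g. g \<in> carrier G \<Longrightarrow> f g = h g) \<Longrightarrow> virtual f \<longleftrightarrow> virtual h"
  unfolding virtual_def by (metis restrict_ext)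

lemma virtual_add:
  assumes "virtual f" "virtual h" shows "virtual (\<lambda>g. f g + h g)"
proof -
  obtain c d where "restrict f (carrier G) = comb c" "restrict h (carrier G) = comb d"
    using assms by (auto simp: virtual_def)
  then have "restrict (\<lambda>g. f g + h g) (carrier G) = comb (\<lambda>\<chi>. c \<chi> + d \<chi>)"
    by (fastforce simp: fun_eq_iff comb_def restrict_def distrib_right sum.distrib split: if_splits)
  then show ?thesis by (simp add: virtual_def)
qed

lemma virtual_of_int_mult:
  assumes "virtual f" shows "virtual (\<lambda>g. of_int a * f g)"
proof -
  obtain c where "restrict f (carrier G) = comb c"
    using assms by (auto simp: virtual_def)
  then have "restrict (\<lambda>g. of_int a * f g) (carrier G) = comb (\<lambda>\<chi>. a * c \<chi>)"
    by (fastforce simp: fun_eq_iff comb_def restrict_def sum_distrib_left mult_ac split: if_splits)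
  then show ?thesis by (simp add: virtual_def)
qed

lemma virtual_sum: "(\<And>x. x \<in> A \<Longrightarrow> virtual (f x)) \<Longrightarrow> virtual (\<lambda>g. \<Sum>x\<in>A. f x g)"
proof (induction A rule: infinite_finite_induct)
  case (insert x A)
  then show ?case using virtual_add[of "f x" "\<lambda>g. \<Sum>x\<in>A. f x g"] by simp
qed (use virtual_of_int_mult[of "comb (\<lambda>_. 0)" 0] in simp_all)

lemma virtual_Ch: "\<chi> \<in> Ch \<Longrightarrow> virtual \<chi>"
  using virtual_comb comb_Ch by metis

lemma virtual_const: "virtual (\<lambda>g. of_int a)"
proof -
  have "virtual (\<lambda>g. of_int a * (\<lambda>g\<in>carrier G. 1) g)"
    by (intro virtual_of_int_mult virtual_Ch trivial_Ch)
  then show ?thesis by (rule virtual_cong[THEN iffD1, rotated]) simp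
qed

lemma virtual_mult:
  assumes "virtual f" "virtual h" shows "virtual (\<lambda>g. f g * h g)"
proof -
  obtain c d where cd: "restrict f (carrier G) = comb c" "restrict h (carrier G) = comb d"
    using assms by (auto simp: virtual_def)
  have "virtual (\<lambda>g. \<Sum>\<chi>\<in>Ch. \<Sum>\<psi>\<in>Ch. of_int (c \<chi> * d \<psi>) * (\<lambda>g\<in>carrier G. \<chi> g * \<psi> g) g)"
    by (intro virtual_sum virtual_of_int_mult virtual_Ch Ch_closed)
  moreover have eq: "f g * h g = (\<Sum>\<chi>\<in>Ch. \<Sum>\<psi>\<in>Ch. of_int (c \<chi> * d \<psi>) * (\<lambda>g\<in>carrier G. \<chi> g * \<psi> g) g)"
    if "g \<in> carrier G" for g
  proof -
    have "f g = (\<Sum>\<chi>\<in>Ch. of_int (c \<chi>) * \<chi> g)" "h g = (\<Sum>\<chi>\<in>Ch. of_int (d \<chi>) * \<chi> g)"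
      using cd that by (auto simp: fun_eq_iff comb_def restrict_def split: if_splits)
    then show ?thesis using that by (simp add: sum_product mult_ac)
  qed
  ultimately show ?thesis by (subst virtual_cong[OF eq])
qed

lemma virtual_power: "virtual f \<Longrightarrow> virtual (\<lambda>g. f g ^ n)"
  by (induction n) (simp_all add: virtual_mult virtual_const[of 1, simplified])

end

text \<open>The series (1 + at)^c, with negative c included because virtual characters have negative
  multiplicities.\<close>

definition binomial_series :: "complex \<Rightarrow> int \<Rightarrow> complex fps" where
  "binomial_series a c = Abs_fps (\<lambda>k. (of_int c gchoose k) * a ^ k)"

lemma binomial_series_nth: "fps_nth (binomial_series a c) k = (of_int c gchoose k) * a ^ k"
  by (simp add: binomial_series_def)

lemma gbinomial_of_int_Ints: "(of_int c gchoose k :: complex) \<in> \<int>"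
  by (subst of_int_gbinomial[symmetric]) simp

lemma binomial_series_add: "binomial_series a (c + d) = binomial_series a c * binomial_series a d"
proof (rule fps_ext)
  fix k
  have "fps_nth (fps_binomial (of_int (c + d))) k
      = fps_nth (fps_binomial (of_int c) * fps_binomial (of_int d) :: complex fps) k"
    using fps_binomial_add_mult[of "of_int c :: complex" "of_int d"] by simp
  then have "(of_int (c + d) gchoose k :: complex)
      = (\<Sum>i=0..k. (of_int c gchoose i) * (of_int d gchoose (k - i)))"
    by (simp add: fps_mult_nth)
  then have "fps_nth (binomial_series a (c + d)) k
      = (\<Sum>i=0..k. (of_int c gchoose i) * (of_int d gchoose (k - i)) * a ^ k)"
    by (simp add: binomial_series_def sum_distrib_right)
  also have "\<dots> = fps_nth (binomial_series a c * binomial_series a d) k"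
    unfolding fps_mult_nth binomial_series_def
    by (intro sum.cong refl) (simp add: power_add[symmetric] mult_ac)
  finally show "fps_nth (binomial_series a (c + d)) k
    = fps_nth (binomial_series a c * binomial_series a d) k" .
qed

lemma binomial_series_0 [simp]: "binomial_series a 0 = 1"
  by (rule fps_ext) (simp add: binomial_series_def gbinomial_0_left)

lemma binomial_series_1: "binomial_series a 1 = 1 + fps_const a * fps_X"
proof (rule fps_ext)
  fix k
  have "(1 gchoose k :: complex) = of_nat (1 choose k)" by (metis binomial_gbinomial of_nat_1)
  then show "fps_nth (binomial_series a 1) k = fps_nth (1 + fps_const a * fps_X) k"
    by (cases k; cases "k - 1") (auto simp: binomial_series_def)
qed

lemma binomial_series_of_nat: "binomial_series a (int m) = (1 + fps_const a * fps_X) ^ m"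
  by (induction m) (simp_all add: binomial_series_add binomial_series_1 mult.commute)

text \<open>A homomorphism from the additive group of integers into units is determined by its value
  at 1. Identities between powers with integer exponent are thereby checked at exponent 1
  only.\<close>

lemma multiplicative_int_unique:
  fixes f h :: "int \<Rightarrow> 'b::comm_ring_1"
  assumes f: "\<And>c d. f (c + d) = f c * f d" "f 0 = 1"
    and h: "\<And>c d. h (c + d) = h c * h d" "h 0 = 1" and "f 1 = h 1"
  shows "f c = h c"
proof -
  have nat: "f (int m) = h (int m)" for m
    by (induction m) (simp_all add: f h \<open>f 1 = h 1\<close>)
  have neg: "f (- int m) = h (- int m)" for m
  proof -
    have "f (- int m) = f (- int m) * (h (int m) * h (- int m))" by (simp add: h(2) flip: h(1))
    also have "\<dots> = (f (- int m) * f (int m)) * h (- int m)" by (simp add: nat mult_ac)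
    also have "\<dots> = h (- int m)" by (simp add: f(2) flip: f(1))
    finally show ?thesis .
  qed
  show ?thesis by (cases c rule: int_cases2) (simp_all only: nat neg)
qed

text \<open>The substitution $t \mapsto t/(1-t)$ that turns $\lambda_t$ into $\gamma_t$.\<close>

definition gamma_subst :: "complex fps" where
  "gamma_subst = fps_X * inverse (1 - fps_X)"

lemma gamma_subst_nth_0 [simp]: "fps_nth gamma_subst 0 = 0"
  by (simp add: gamma_subst_def)

lemma gamma_subst_mult: "gamma_subst * (1 - fps_X) = fps_X"
proof -
  have "inverse (1 - fps_X) * (1 - fps_X :: complex fps) = 1" by (rule inverse_mult_eq_1) simp
  then show ?thesis by (simp add: gamma_subst_def mult.assoc)
qed

text \<open>The i-th power is t^i (1-t)^(-i), and negating the upper index of the binomial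
  coefficient gives the stated form. The top entry n - 1 is the shift in the definition of
  gamma^n.\<close>

lemma gamma_subst_power_nth:
  assumes "i \<le> n"
  shows "fps_nth (gamma_subst ^ i) n = (of_int (int n - 1) gchoose (n - i))"
proof (cases i)
  \<comment> \<open>Here n - i = n. For n > 0 the binomial n - 1 over n is 0, like the coefficient
    of the series 1; for n = 0 both sides are 1.\<close>
  case 0
  show ?thesis
  proof (cases n)
    case (Suc m)
    have "(of_int (int n - 1) gchoose n :: complex) = of_nat (m choose n)"
      by (simp add: Suc binomial_gbinomial)
    then show ?thesis by (simp add: 0 Suc)
  qed (simp add: 0)
next
  case (Suc m)
  have m: "n - 1 - m = n - i" "m + (n - i) = n - 1" using assms Suc by auto
  have "inverse (1 - fps_X :: complex fps) = binomial_series (- 1) (- 1)"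
  proof -
    have "binomial_series (- 1) (- 1) * (1 - fps_X) = 1"
    proof -
      have eq: "1 + fps_const (- 1) * fps_X = (1 - fps_X :: complex fps)" by (rule fps_ext) simp
      have "binomial_series (- 1) (- 1) * (1 + fps_const (- 1) * fps_X) = 1"
        using binomial_series_add[of "- 1" "- 1" 1] by (simp add: binomial_series_1)
      then show ?thesis unfolding eq .
    qed
    then show ?thesis using fps_inverse_unique[of "1 - fps_X :: complex fps"] by (simp add: mult.commute)
  qed
  moreover have "binomial_series (- 1) (- 1) ^ i = binomial_series (- 1) (- int i)"
  proof (induction i)
    case (Suc i)
    have "- int (Suc i) = - 1 + - int i" by simp
    then show ?case by (simp only: binomial_series_add power_Suc Suc)
  qed simp
  ultimately have "gamma_subst ^ i = fps_X ^ i * binomial_series (- 1) (- int i)"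
    by (simp add: gamma_subst_def power_mult_distrib)
  then have "fps_nth (gamma_subst ^ i) n = fps_nth (binomial_series (- 1) (- int i)) (n - i)"
    using assms by (simp add: fps_X_power_mult_nth)
  also have "\<dots> = (- of_nat i gchoose (n - i)) * (- 1) ^ (n - i)"
    by (simp add: binomial_series_def)
  also have "\<dots> = (of_nat (n - i) + of_nat i - 1) gchoose (n - i)"
    by (subst gbinomial_negated_upper) (simp add: algebra_simps flip: power_mult_distrib)
  also have "\<dots> = (of_int (int n - 1) gchoose (n - i))"
    using assms by (simp add: of_nat_diff)
  finally show ?thesis .
qed

text \<open>Adding n - 1 to x multiplies its lambda series by (1+t)^(n-1). The shift varies with n,
  so the two series are not equal; only their n-th coefficients agree, which is all that gamma^n
  uses.\<close>

lemma gamma_coefficient: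
  "fps_nth (F * binomial_series 1 (int n - 1)) n = fps_nth (fps_compose F gamma_subst) n"
  unfolding fps_mult_nth fps_compose_nth
  by (intro sum.cong refl) (simp add: gamma_subst_power_nth binomial_series_def)

lemma inverse_eq_of_common_factor:
  fixes a b c :: "'b::comm_ring_1"
  assumes "a * b = 1" "a * c = 1"
  shows "b = c"
proof -
  have "b = (a * c) * b" by (simp add: assms)
  also have "\<dots> = (a * b) * c" by (simp only: mult_ac)
  finally show ?thesis by (simp add: assms)
qed

text \<open>For s = t/(1-t) one has 1 + s = 1/(1-t), hence (1 + as)/(1 + s) = 1 + (a-1)t. The factor
  (1 + s)^(-c) is the contribution of subtracting the trivial character c times.\<close>

lemma binomial_series_gamma:
  "fps_compose (binomial_series a c) gamma_subst * fps_compose (binomial_series 1 (- c)) gamma_subst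
    = binomial_series (a - 1) c"
proof (rule multiplicative_int_unique[where c = c])
  fix c d
  show "fps_compose (binomial_series a (c + d)) gamma_subst * fps_compose (binomial_series 1 (- (c + d))) gamma_subst
    = fps_compose (binomial_series a c) gamma_subst * fps_compose (binomial_series 1 (- c)) gamma_subst
    * (fps_compose (binomial_series a d) gamma_subst * fps_compose (binomial_series 1 (- d)) gamma_subst)"
    using binomial_series_add[of 1 "- c" "- d"]
    by (simp add: binomial_series_add fps_compose_mult_distrib mult_ac)
  have *: "fps_compose (binomial_series a 1) gamma_subst * (1 - fps_X) = 1 + fps_const (a - 1) * fps_X" for a
  proof -
    have "fps_compose (binomial_series a 1) gamma_subst = 1 + fps_const a * gamma_subst"
      by (simp add: binomial_series_1 fps_compose_add_distrib fps_compose_mult_distrib)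
    then have "fps_compose (binomial_series a 1) gamma_subst * (1 - fps_X)
        = (1 - fps_X) + fps_const a * (gamma_subst * (1 - fps_X))"
      by (simp add: algebra_simps)
    also have "\<dots> = 1 + fps_const (a - 1) * fps_X"
      unfolding gamma_subst_mult by (simp add: algebra_simps flip: fps_const_sub)
    finally show ?thesis .
  qed
  have "fps_compose (binomial_series 1 1) gamma_subst * fps_compose (binomial_series 1 (- 1)) gamma_subst = 1"
    using binomial_series_add[of 1 1 "- 1"] by (simp flip: fps_compose_mult_distrib)
  moreover have "fps_compose (binomial_series 1 1) gamma_subst * (1 - fps_X) = 1"
    using *[of 1] by simp
  ultimately have "fps_compose (binomial_series 1 (- 1)) gamma_subst = 1 - fps_X"
    by (rule inverse_eq_of_common_factor)
  then show "fps_compose (binomial_series a 1) gamma_subst * fps_compose (binomial_series 1 (- 1)) gamma_subst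
    = binomial_series (a - 1) 1"
    using *[of a] by (simp add: binomial_series_1)
qed (simp_all add: binomial_series_add)

section \<open>Characters of representations as combinations of linear characters\<close>

lemma trace_exterior_power_1: "mat_trace (exterior_power 1 A) = mat_trace (A :: 'a::comm_ring_1 mat)"
proof -
  define n where "n = dim_row A"
  have "{S. S \<subseteq> {0..<n} \<and> card S = 1} = (\<lambda>i. {i}) ` {0..<n}"
    by (auto simp: card_1_singleton_iff)
  then have "mat_trace (exterior_power 1 A) = (\<Sum>i\<in>{0..<n}. \<Sum>\<pi> | \<pi> permutes {i}. of_int (sign \<pi>) * (\<Prod>i\<in>{i}. A $$ (i, \<pi> i)))"
    by (simp only: trace_exterior_power[OF n_def[symmetric]]) (subst sum.reindex, auto)
  also have "\<dots> = (\<Sum>i\<in>{0..<n}. A $$ (i, i))"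
    by (intro sum.cong refl) (simp add: sign_id)
  finally show ?thesis by (simp add: mat_trace_def n_def atLeast0LessThan)
qed

context dual_group begin

lemma trace_exterior_power_representation:
  assumes \<rho>: "\<rho> \<in> representations G n"
  obtains m :: "('a \<Rightarrow> complex) \<Rightarrow> nat" where
    "\<And>g k. g \<in> carrier G \<Longrightarrow> mat_trace (exterior_power k (\<rho> g))
      = fps_nth (\<Prod>\<chi>\<in>Ch. binomial_series (\<chi> g) (int (m \<chi>))) k"
proof -
  obtain m where m: "\<And>g t. g \<in> carrier G \<Longrightarrow>
      det (mat n n (\<lambda>(i, j). (if i = j then 1 else 0) + t * \<rho> g $$ (i, j))) = (\<Prod>\<chi>\<in>Ch. (1 + t * \<chi> g) ^ m \<chi>)"
    using det_representation[OF \<rho>] by blast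
  show thesis
  proof
    fix g k assume g: "g \<in> carrier G"
    have dim: "dim_row (\<rho> g) = n" using representation_carrier[OF \<rho> g] by simp
    define T where "T k = mat_trace (exterior_power k (\<rho> g))" for k
    define p where "p = (\<Sum>k\<le>n. Polynomial.monom (T k) k)"
    define q where "q = (\<Prod>\<chi>\<in>Ch. [:1, \<chi> g:] ^ m \<chi>)"
    have "poly p t = poly q t" for t
      using m[OF g, of t] det_one_plus_exterior_power[OF dim, of t]
      by (simp add: p_def q_def T_def poly_sum poly_prod poly_monom mult.commute)
    then have "p = q" by (simp add: poly_eq_poly_eq_iff[symmetric] fun_eq_iff)
    have "T k = Polynomial.coeff p k"
      using trace_exterior_power_eq_0[OF dim, of k] by (auto simp: p_def T_def coeff_sum)
    also have "\<dots> = fps_nth (fps_of_poly q) k" by (simp add: \<open>p = q\<close>)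
    also have "fps_of_poly q = (\<Prod>\<chi>\<in>Ch. binomial_series (\<chi> g) (int (m \<chi>)))"
      by (simp add: q_def fps_of_poly_prod fps_of_poly_power fps_of_poly_pCons binomial_series_of_nat)
    finally show "mat_trace (exterior_power k (\<rho> g)) = fps_nth (\<Prod>\<chi>\<in>Ch. binomial_series (\<chi> g) (int (m \<chi>))) k"
      by (simp add: T_def)
  qed
qed

lemma prod_binomial_series_nth_1:
  "finite F \<Longrightarrow> fps_nth (\<Prod>\<chi>\<in>F. binomial_series (\<chi> g) (c \<chi>)) 0 = 1 \<and>
    fps_nth (\<Prod>\<chi>\<in>F. binomial_series (\<chi> g) (c \<chi>)) 1 = (\<Sum>\<chi>\<in>F. of_int (c \<chi>) * \<chi> g)"
  by (induction F rule: finite_induct) (auto simp: fps_mult_nth binomial_series_def)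

text \<open>One multiplicity function serves all exterior powers. The character itself is the case k
  = 1, where the coefficient of t in the product is the sum of m_chi chi(g).\<close>

lemma representation_char:
  assumes \<rho>: "\<rho> \<in> representations G n"
  obtains m :: "('a \<Rightarrow> complex) \<Rightarrow> nat" where "rep_char G \<rho> = comb (\<lambda>\<chi>. int (m \<chi>))"
    "\<And>k. rep_char G (\<lambda>g. exterior_power k (\<rho> g))
      = (\<lambda>g\<in>carrier G. fps_nth (\<Prod>\<chi>\<in>Ch. binomial_series (\<chi> g) (int (m \<chi>))) k)"
proof -
  obtain m where m: "\<And>g k. g \<in> carrier G \<Longrightarrow> mat_trace (exterior_power k (\<rho> g))
      = fps_nth (\<Prod>\<chi>\<in>Ch. binomial_series (\<chi> g) (int (m \<chi>))) k"
    using trace_exterior_power_representation[OF \<rho>] by blast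
  show thesis
  proof
    show "rep_char G \<rho> = comb (\<lambda>\<chi>. int (m \<chi>))"
      unfolding rep_char_def comb_def
    proof (rule restrict_ext)
      fix g assume "g \<in> carrier G"
      then show "mat_trace (\<rho> g) = (\<Sum>\<chi>\<in>Ch. of_int (int (m \<chi>)) * \<chi> g)"
        using m[of g 1] prod_binomial_series_nth_1[OF finite_Ch]
        unfolding trace_exterior_power_1 by metis
    qed
    show "rep_char G (\<lambda>g. exterior_power k (\<rho> g))
      = (\<lambda>g\<in>carrier G. fps_nth (\<Prod>\<chi>\<in>Ch. binomial_series (\<chi> g) (int (m \<chi>))) k)" for k
      unfolding rep_char_def by (intro restrict_ext m)
  qed
qed

lemma comb_add: "(\<lambda>g\<in>carrier G. comb c g + comb d g) = comb (\<lambda>\<chi>. c \<chi> + d \<chi>)"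
  by (auto simp: comb_def fun_eq_iff distrib_right sum.distrib)

lemma comb_uminus: "(\<lambda>g\<in>carrier G. - comb c g) = comb (\<lambda>\<chi>. - c \<chi>)"
  by (auto simp: comb_def fun_eq_iff sum_negf)

lemma comb_zero: "(\<lambda>g\<in>carrier G. 0) = comb (\<lambda>\<chi>. 0)"
  by (auto simp: comb_def)

lemma comb_PiE: "comb c \<in> carrier G \<rightarrow>\<^sub>E UNIV"
  by (auto simp: comb_def)

text \<open>Characters of representations are combinations of Ch by
  \<open>representation_char\<close>; conversely each element of Ch is the character of an
  irreducible representation of dimension 1.\<close>

lemma char_ring_carrier: "carrier (char_ring G) = range comb"
proof
  let ?H = "{rep_char G \<rho> | n \<rho>. irreducible_rep G n \<rho>}"
  let ?A = "add_monoid (fun_ring (carrier G))"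
  interpret F: cring "fun_ring (carrier G)" by (rule cring_fun_ring)
  have H: "h \<in> range comb" if "h \<in> ?H" for h
  proof -
    from that obtain \<rho> n where h: "h = rep_char G \<rho>" "\<rho> \<in> representations G n"
      by (auto simp: irreducible_rep_def)
    obtain m where "rep_char G \<rho> = comb (\<lambda>\<chi>. int (m \<chi>))"
      using representation_char[OF h(2)] by blast
    then show ?thesis using h(1) by blast
  qed
  have inv: "inv\<^bsub>?A\<^esub> comb c = comb (\<lambda>\<chi>. - c \<chi>)" for c
    using a_inv_fun_ring[OF comb_PiE] comb_uminus by (simp add: a_inv_def)
  have "x \<in> range comb" if "x \<in> generate ?A ?H" for x
    using that
  proof induction
    case one
    then show ?case by (simp add: comb_zero)
  next
    case (inv h)
    then obtain c where "h = comb c" using H by blast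
    then show ?case using \<open>\<And>c. inv\<^bsub>?A\<^esub> comb c = comb (\<lambda>\<chi>. - c \<chi>)\<close> by auto
  next
    case (eng h1 h2)
    then obtain c d where "h1 = comb c" "h2 = comb d" by blast
    then show ?case by (simp add: comb_add)
  qed (rule H)
  then show "carrier (char_ring G) \<subseteq> range comb" by (auto simp: carrier_char_ring)
  have Ch: "\<chi> \<in> generate ?A ?H" if "\<chi> \<in> Ch" for \<chi>
  proof -
    have "\<chi> \<in> ?H" using Ch_irreducible[OF that] by blast
    then show ?thesis by (rule generate.incl)
  qed
  have Hc: "?H \<subseteq> carrier (fun_ring (carrier G))"
  proof
    fix h assume "h \<in> ?H"
    then obtain c where "h = comb c" using H by blast
    then show "h \<in> carrier (fun_ring (carrier G))" using comb_PiE by simp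
  qed
  define V where "V f \<longleftrightarrow> restrict f (carrier G) \<in> generate ?A ?H" for f
  have V_Ch: "V \<chi>" if "\<chi> \<in> Ch" for \<chi>
    using Ch[OF that] Ch_extensional[OF that] by (simp add: V_def extensional_restrict)
  have V_add: "V (\<lambda>g. f g + h g)" if "V f" "V h" for f h
  proof -
    have "restrict f (carrier G) \<otimes>\<^bsub>?A\<^esub> restrict h (carrier G) \<in> generate ?A ?H"
      using that unfolding V_def by (rule generate.eng)
    then show ?thesis by (simp add: V_def cong: restrict_cong)
  qed
  have V_neg: "V (\<lambda>g. - f g)" if "V f" for f
  proof -
    have "\<ominus>\<^bsub>fun_ring (carrier G)\<^esub> restrict f (carrier G) \<in> generate ?A ?H"
      using F.add.generate_m_inv_closed[OF Hc] that unfolding V_def by (simp add: a_inv_def)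
    then show ?thesis
      by (subst (asm) a_inv_fun_ring) (auto simp: V_def cong: restrict_cong)
  qed
  have V_zero: "V (\<lambda>g. 0)"
    using generate.one[of ?A ?H] by (simp add: V_def)
  have V_nat: "V (\<lambda>g. of_nat m * \<chi> g)" if "\<chi> \<in> Ch" for m \<chi>
  proof (induction m)
    case (Suc m)
    then show ?case using V_add[OF V_Ch[OF that]] by (simp add: distrib_right)
  qed (simp add: V_zero)
  have V_int: "V (\<lambda>g. of_int a * \<chi> g)" if "\<chi> \<in> Ch" for a \<chi>
  proof (cases a rule: int_cases2)
    case (nonneg m)
    then show ?thesis using V_nat[OF that, of m] by simp
  next
    case (nonpos m)
    then show ?thesis using V_neg[OF V_nat[OF that, of m]] by simp
  qed
  have "V (\<lambda>g. \<Sum>\<chi>\<in>F. of_int (c \<chi>) * \<chi> g)" if "finite F" "F \<subseteq> Ch" for F c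
    using that by (induction F) (auto intro: V_zero V_add V_int)
  then show "range comb \<subseteq> carrier (char_ring G)"
    unfolding carrier_char_ring using finite_Ch by (auto simp: comb_def V_def)
qed

lemma virtual_char_ring: "virtual f \<longleftrightarrow> restrict f (carrier G) \<in> carrier (char_ring G)"
  by (simp add: virtual_def char_ring_carrier)

lemma char_ring_virtual:
  assumes "f \<in> carrier (char_ring G)"
  shows "virtual f" "restrict f (carrier G) = f" "f \<in> carrier G \<rightarrow>\<^sub>E UNIV"
  using assms comb_PiE by (auto simp: char_ring_carrier PiE_def extensional_restrict)

lemma char_ring_undefined: "f \<in> carrier (char_ring G) \<Longrightarrow> g \<notin> carrier G \<Longrightarrow> f g = undefined"
  using char_ring_virtual(3) by (auto simp: PiE_def extensional_def)

lemma char_ring_closed: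
  assumes "f \<in> carrier (char_ring G)" "h \<in> carrier (char_ring G)"
  shows "(\<lambda>g\<in>carrier G. f g + h g) \<in> carrier (char_ring G)"
    "(\<lambda>g\<in>carrier G. f g * h g) \<in> carrier (char_ring G)"
    "(\<lambda>g\<in>carrier G. - f g) \<in> carrier (char_ring G)"
  using virtual_add[of f h] virtual_mult[of f h] virtual_of_int_mult[of f "-1"] char_ring_virtual(1) assms
  by (simp_all add: virtual_char_ring)

lemma char_ring_const: "(\<lambda>g\<in>carrier G. of_int a) \<in> carrier (char_ring G)"
  using virtual_const by (simp add: virtual_char_ring)

lemma cring_char_ring: "cring (char_ring G)"
proof (rule cringI)
  note closed = char_ring_closed char_ring_const[of 0, simplified] char_ring_const[of 1, simplified]
  have minus: "\<exists>y\<in>carrier (char_ring G). (\<lambda>g\<in>carrier G. y g + f g) = (\<lambda>g\<in>carrier G. 0)"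
    if "f \<in> carrier (char_ring G)" for f
    by (rule bexI[OF _ char_ring_closed(3)[OF that that]]) (simp cong: restrict_cong)
  show "abelian_group (char_ring G)"
    by (rule abelian_groupI)
       (use minus in \<open>auto simp: closed fun_eq_iff char_ring_undefined add_ac\<close>)
  show "comm_monoid (char_ring G)"
    by (rule comm_monoidI)
       (auto simp: closed fun_eq_iff char_ring_undefined mult_ac)
qed (auto simp: fun_eq_iff algebra_simps)

end

section \<open>Lambda and gamma operations\<close>

context dual_group begin

lemma finsum_char_ring:
  assumes "finite A" "\<And>a. a \<in> A \<Longrightarrow> f a \<in> carrier (char_ring G)"
  shows "finsum (char_ring G) f A = (\<lambda>g\<in>carrier G. \<Sum>a\<in>A. f a g)"
  using assms
proof (induction A)
  interpret R: cring "char_ring G" by (rule cring_char_ring)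
  case empty
  then show ?case by simp
next
  interpret R: cring "char_ring G" by (rule cring_char_ring)
  case (insert a A)
  then have "finsum (char_ring G) f (insert a A) = f a \<oplus>\<^bsub>char_ring G\<^esub> finsum (char_ring G) f A"
    by (intro R.finsum_insert) auto
  also have "finsum (char_ring G) f A = (\<lambda>g\<in>carrier G. \<Sum>a\<in>A. f a g)"
    by (rule insert.IH) (use insert.prems in auto)
  finally show ?case using insert.hyps by (auto simp: fun_eq_iff)
qed

lemma a_inv_char_ring:
  assumes "f \<in> carrier (char_ring G)"
  shows "\<ominus>\<^bsub>char_ring G\<^esub> f = (\<lambda>g\<in>carrier G. - f g)"
proof -
  interpret R: cring "char_ring G" by (rule cring_char_ring)
  show ?thesis by (rule R.minus_equality) (use assms in \<open>auto simp: fun_eq_iff char_ring_closed(3)\<close>)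
qed

lemma add_pow_char_ring_one: "add_pow (char_ring G) (k :: int) \<one>\<^bsub>char_ring G\<^esub> = (\<lambda>g\<in>carrier G. of_int k)"
proof -
  interpret R: cring "char_ring G" by (rule cring_char_ring)
  have nat: "add_pow (char_ring G) (m :: nat) \<one>\<^bsub>char_ring G\<^esub> = (\<lambda>g\<in>carrier G. of_nat m)" for m
  proof (induction m)
    case (Suc m)
    have "add_pow (char_ring G) (Suc m) \<one>\<^bsub>char_ring G\<^esub>
        = add_pow (char_ring G) m \<one>\<^bsub>char_ring G\<^esub> \<oplus>\<^bsub>char_ring G\<^esub> \<one>\<^bsub>char_ring G\<^esub>"
      by (rule R.add.nat_pow_Suc)
    also have "\<dots> = (\<lambda>g\<in>carrier G. of_nat (Suc m))"
      by (simp only: Suc) (auto simp: fun_eq_iff)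
    finally show ?case .
  qed (simp add: R.add.nat_pow_0)
  show ?thesis
  proof (cases "k \<ge> 0")
    case True
    have "add_pow (char_ring G) k \<one>\<^bsub>char_ring G\<^esub> = (\<lambda>g\<in>carrier G. of_nat (nat k))"
      by (simp only: add_pow_int_ge[OF True] nat)
    then show ?thesis using True by simp
  next
    case False
    have "(\<lambda>g\<in>carrier G. of_nat (nat (- k))) \<in> carrier (char_ring G)"
      using char_ring_const[of "int (nat (- k))"] by (simp only: of_int_of_nat_eq)
    then have "add_pow (char_ring G) k \<one>\<^bsub>char_ring G\<^esub>
        = (\<lambda>g\<in>carrier G. - (\<lambda>g\<in>carrier G. of_nat (nat (- k))) g)"
      using False by (simp only: add_pow_int_lt not_le nat a_inv_char_ring)
    also have "\<dots> = (\<lambda>g\<in>carrier G. of_int k)" using False by (intro restrict_ext) simp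
    finally show ?thesis .
  qed
qed

text \<open>The series lambda_t of the virtual character \<open>comb c\<close>, evaluated at
  g.\<close>

abbreviation char_series :: "(('a \<Rightarrow> complex) \<Rightarrow> int) \<Rightarrow> 'a \<Rightarrow> complex fps" where
  "char_series c g \<equiv> (\<Prod>\<chi>\<in>Ch. binomial_series (\<chi> g) (c \<chi>))"

text \<open>Binomial coefficients with integer upper entry are integers, so each factor has
  coefficients that are integral multiples of powers of a character.\<close>

lemma virtual_series:
  assumes "finite F" "F \<subseteq> Ch"
  shows "virtual (\<lambda>g. fps_nth (\<Prod>\<chi>\<in>F. binomial_series (\<chi> g) (c \<chi>)) k)"
  using assms
proof (induction F arbitrary: k)
  case empty
  show ?case using virtual_const[of 0] virtual_const[of 1] by (cases k) auto
next
  case (insert \<phi> F)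
  have "virtual (\<lambda>g. fps_nth (binomial_series (\<phi> g) (c \<phi>)) i)" for i
  proof -
    obtain z where "(of_int (c \<phi>) gchoose i :: complex) = of_int z"
      using gbinomial_of_int_Ints by (meson Ints_cases)
    then show ?thesis
      using insert.prems virtual_of_int_mult[OF virtual_power[OF virtual_Ch]]
      by (simp add: binomial_series_def)
  qed
  then have "virtual (\<lambda>g. \<Sum>i=0..k. fps_nth (binomial_series (\<phi> g) (c \<phi>)) i
      * fps_nth (\<Prod>\<chi>\<in>F. binomial_series (\<chi> g) (c \<chi>)) (k - i))"
    using insert by (intro virtual_sum virtual_mult) auto
  then show ?case using insert.hyps by (simp add: fps_mult_nth)
qed

lemma char_series_add: "char_series (\<lambda>\<chi>. c \<chi> + d \<chi>) g = char_series c g * char_series d g"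
  by (simp add: binomial_series_add prod.distrib)

text \<open>The choice of coefficients is harmless because they are unique on Ch. The outer
  restriction is there because \<open>is_lambda\<close> fixes the values outside the character
  ring.\<close>

definition lambda_char :: "nat \<Rightarrow> ('a \<Rightarrow> complex) \<Rightarrow> 'a \<Rightarrow> complex" where
  "lambda_char k = (\<lambda>x\<in>carrier (char_ring G). \<lambda>g\<in>carrier G. fps_nth (char_series (SOME c. x = comb c) g) k)"

lemma lambda_char_comb: "lambda_char k (comb c) = (\<lambda>g\<in>carrier G. fps_nth (char_series c g) k)"
proof -
  define d where "d = (SOME d. comb c = comb d)"
  have "comb c = comb d" unfolding d_def by (rule someI[of "\<lambda>d. comb c = comb d" c]) (rule refl)
  then have "char_series d g = char_series c g" for g
    by (intro prod.cong refl) (metis comb_inject)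
  moreover have "comb c \<in> carrier (char_ring G)" by (simp add: char_ring_carrier)
  ultimately show ?thesis by (simp add: lambda_char_def d_def)
qed

lemma lambda_char_closed: "lambda_char k \<in> carrier (char_ring G) \<rightarrow>\<^sub>E carrier (char_ring G)"
proof (rule PiE_I)
  fix x assume "x \<in> carrier (char_ring G)"
  then obtain c where "x = comb c" by (auto simp: char_ring_carrier)
  then show "lambda_char k x \<in> carrier (char_ring G)"
    using virtual_series[OF finite_Ch] by (simp add: lambda_char_comb virtual_char_ring)
qed (simp add: lambda_char_def)

lemma lambda_char_representation:
  "\<rho> \<in> representations G n \<Longrightarrow> lambda_char k (rep_char G \<rho>) = rep_char G (\<lambda>g. exterior_power k (\<rho> g))"
  by (erule representation_char) (simp add: lambda_char_comb)

lemma is_lambda_lambda_char: "is_lambda G lambda_char"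
  unfolding is_lambda_def
proof (intro conjI allI ballI)
  show "lambda_char k \<in> carrier (char_ring G) \<rightarrow>\<^sub>E carrier (char_ring G)" for k
    by (rule lambda_char_closed)
  show "lambda_char k (rep_char G \<rho>) = rep_char G (\<lambda>g. exterior_power k (\<rho> g))"
    if "\<rho> \<in> representations G n" for k n \<rho>
    using that by (rule lambda_char_representation)
  show "lambda_char 0 x = \<one>\<^bsub>char_ring G\<^esub>" if x: "x \<in> carrier (char_ring G)" for x
  proof -
    obtain c where c: "x = comb c" using x by (auto simp: char_ring_carrier)
    show ?thesis using prod_binomial_series_nth_1[OF finite_Ch] by (simp add: c lambda_char_comb)
  qed
  fix k x y assume xy: "x \<in> carrier (char_ring G)" "y \<in> carrier (char_ring G)"
  then obtain c d where cd: "x = comb c" "y = comb d" by (auto simp: char_ring_carrier)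
  have cl: "lambda_char i x \<in> carrier (char_ring G)" "lambda_char i y \<in> carrier (char_ring G)" for i
    using lambda_char_closed xy by auto
  have "(\<Oplus>\<^bsub>char_ring G\<^esub>i\<in>{..k}. lambda_char i x \<otimes>\<^bsub>char_ring G\<^esub> lambda_char (k - i) y)
      = (\<lambda>g\<in>carrier G. \<Sum>i\<le>k. (lambda_char i x \<otimes>\<^bsub>char_ring G\<^esub> lambda_char (k - i) y) g)"
    by (rule finsum_char_ring) (use cl char_ring_closed(2) in auto)
  also have "\<dots> = lambda_char k (x \<oplus>\<^bsub>char_ring G\<^esub> y)"
    by (auto simp: fun_eq_iff cd comb_add lambda_char_comb char_series_add fps_mult_nth atLeast0AtMost)
  finally show "lambda_char k (x \<oplus>\<^bsub>char_ring G\<^esub> y)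
    = (\<Oplus>\<^bsub>char_ring G\<^esub>i\<in>{..k}. lambda_char i x \<otimes>\<^bsub>char_ring G\<^esub> lambda_char (k - i) y)" by simp
qed

text \<open>For fixed \<open>g\<close> the series $\sum_k \lambda^k(x)(g) t^k$ turns sums into products, so it is
  determined by its values on the generators of the additive group.\<close>

lemma is_lambda_unique:
  assumes lam: "is_lambda G lam"
  shows "lam = lambda_char"
proof -
  interpret R: cring "char_ring G" by (rule cring_char_ring)
  define L where "L lam x g = Abs_fps (\<lambda>k. lam k x g)" for lam :: "nat \<Rightarrow> ('a \<Rightarrow> complex) \<Rightarrow> 'a \<Rightarrow> complex" and x g
  let ?R = "carrier (char_ring G)"
  have add: "L l (\<lambda>g\<in>carrier G. x g + y g) g = L l x g * L l y g"
    if l: "is_lambda G l" and xy: "x \<in> ?R" "y \<in> ?R" and g: "g \<in> carrier G" for l x y g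
  proof (rule fps_ext)
    fix k
    have cl: "l i x \<in> ?R" "l i y \<in> ?R" for i using l xy unfolding is_lambda_def by blast+
    have "l k (x \<oplus>\<^bsub>char_ring G\<^esub> y) = (\<Oplus>\<^bsub>char_ring G\<^esub>i\<in>{..k}. l i x \<otimes>\<^bsub>char_ring G\<^esub> l (k - i) y)"
      using l xy unfolding is_lambda_def by blast
    also have "\<dots> = (\<lambda>g\<in>carrier G. \<Sum>i\<le>k. (l i x \<otimes>\<^bsub>char_ring G\<^esub> l (k - i) y) g)"
      by (rule finsum_char_ring) (use cl char_ring_closed(2) in auto)
    finally show "fps_nth (L l (\<lambda>g\<in>carrier G. x g + y g) g) k = fps_nth (L l x g * L l y g) k"
      using g by (simp add: L_def fps_mult_nth atLeast0AtMost)
  qed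
  have const: "fps_nth (L l x g) 0 = 1" if "is_lambda G l" "x \<in> ?R" "g \<in> carrier G" for l x g
    using that unfolding is_lambda_def L_def by simp
  have zero: "L l (\<lambda>g\<in>carrier G. 0) g = 1" if l: "is_lambda G l" and g: "g \<in> carrier G" for l g
  proof -
    have z: "(\<lambda>g\<in>carrier G. 0) \<in> ?R" using char_ring_const[of 0] by simp
    \<comment> \<open>The series at 0 is idempotent and has constant term 1; power series over a
      field have no zero divisors, so it is 1.\<close>
    have "L l (\<lambda>g\<in>carrier G. 0) g = L l (\<lambda>g\<in>carrier G. 0) g * L l (\<lambda>g\<in>carrier G. 0) g"
      using add[OF l z z g] by (simp cong: restrict_cong)
    moreover have "L l (\<lambda>g\<in>carrier G. 0) g \<noteq> 0" using const[OF l z g] by force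
    ultimately show ?thesis by (metis mult_cancel_left1)
  qed
  have neg: "L l (\<lambda>g\<in>carrier G. - x g) g = inverse (L l x g)"
    if l: "is_lambda G l" and x: "x \<in> ?R" and g: "g \<in> carrier G" for l x g
  proof -
    have nx: "(\<lambda>g\<in>carrier G. - x g) \<in> ?R" by (rule char_ring_closed(3)[OF x x])
    have "L l x g * L l (\<lambda>g\<in>carrier G. - x g) g = 1"
      using add[OF l x nx g] zero[OF l g] by (simp cong: restrict_cong)
    then show ?thesis using const[OF l x g] by (intro fps_inverse_unique[symmetric]) auto
  qed
  note lam0 = is_lambda_lambda_char
  let ?A = "add_monoid (fun_ring (carrier G))"
  have gen: "L lam (rep_char G \<rho>) g = L lambda_char (rep_char G \<rho>) g"
    if "irreducible_rep G n \<rho>" for \<rho> n g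
  proof -
    have "\<rho> \<in> representations G n" using that by (simp add: irreducible_rep_def)
    then have "lam k (rep_char G \<rho>) = lambda_char k (rep_char G \<rho>)" for k
      using lam lambda_char_representation unfolding is_lambda_def by metis
    then show ?thesis by (simp add: L_def)
  qed
  have R: "h \<in> ?R" if "h \<in> generate ?A {rep_char G \<rho> | n \<rho>. irreducible_rep G n \<rho>}" for h
    using that by (simp add: carrier_char_ring)
  have all: "\<forall>g\<in>carrier G. L lam x g = L lambda_char x g"
    if "x \<in> generate ?A {rep_char G \<rho> | n \<rho>. irreducible_rep G n \<rho>}" for x
    using that
  proof induction
    case one
    have "\<one>\<^bsub>?A\<^esub> = (\<lambda>g\<in>carrier G. 0)" by simp
    then show ?case by (intro ballI) (simp only: zero[OF lam] zero[OF lam0])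
  next
    case (incl h)
    then show ?case using gen by blast
  next
    case (inv h)
    then have h: "h \<in> ?R" by (intro R generate.incl)
    have "inv\<^bsub>?A\<^esub> h = (\<lambda>g\<in>carrier G. - h g)"
      using a_inv_fun_ring[OF char_ring_virtual(3)[OF h]] by (simp add: a_inv_def)
    moreover have "L lam h g = L lambda_char h g" for g using inv gen by blast
    ultimately show ?case by (intro ballI) (simp only: neg[OF lam h] neg[OF lam0 h])
  next
    case (eng h1 h2)
    have "h1 \<otimes>\<^bsub>?A\<^esub> h2 = (\<lambda>g\<in>carrier G. h1 g + h2 g)" by simp
    moreover have "L lam (\<lambda>g\<in>carrier G. h1 g + h2 g) g = L lambda_char (\<lambda>g\<in>carrier G. h1 g + h2 g) g"
      if g: "g \<in> carrier G" for g
      using add[OF lam R[OF eng(1)] R[OF eng(2)] g] add[OF lam0 R[OF eng(1)] R[OF eng(2)] g] eng(3,4) g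
      by simp
    ultimately show ?case by (simp only:) blast
  qed
  have eq: "lam k x g = lambda_char k x g" if "x \<in> ?R" "g \<in> carrier G" for k x g
  proof -
    have "L lam x g = L lambda_char x g" using all that unfolding carrier_char_ring by blast
    then have "fps_nth (L lam x g) k = fps_nth (L lambda_char x g) k" by simp
    then show ?thesis by (simp add: L_def)
  qed
  have "lam k x = lambda_char k x" for k x
  proof (cases "x \<in> ?R")
    case True
    then have "lam k x \<in> ?R" "lambda_char k x \<in> ?R"
      using lam lam0 unfolding is_lambda_def by blast+
    then show ?thesis using eq[OF True] char_ring_undefined by (metis ext)
  next
    case False
    have "lam k \<in> extensional ?R" "lambda_char k \<in> extensional ?R"
      using lam lam0 unfolding is_lambda_def PiE_def by blast+
    then show ?thesis using False by (simp add: extensional_def)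
  qed
  then show ?thesis by blast
qed

lemma lambda_op_eq: "lambda_op G = lambda_char"
  unfolding lambda_op_def by (rule the_equality) (auto intro: is_lambda_lambda_char is_lambda_unique)

lemma aug_ideal_comb:
  assumes "x \<in> aug_ideal G"
  obtains c where "x = comb c" "(\<Sum>\<chi>\<in>Ch. c \<chi>) = 0"
proof -
  obtain c where c: "x = comb c" and "x \<one> = 0"
    using assms by (auto simp: aug_ideal_def char_degree_def char_ring_carrier)
  then have "of_int (\<Sum>\<chi>\<in>Ch. c \<chi>) = (0 :: complex)" by (simp add: comb_def Ch_one)
  then have "(\<Sum>\<chi>\<in>Ch. c \<chi>) = 0" unfolding of_int_eq_0_iff .
  with c show thesis using that by blast
qed

text \<open>Since the coefficients sum to 0, the product of all (1 + s)^(-c_chi) is 1. It may be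
  inserted into the lambda series at s = t/(1-t) and distributed over the factors, each of which
  then becomes a power of 1 + (chi - 1)t.\<close>

lemma gamma_op_comb:
  assumes "(\<Sum>\<chi>\<in>Ch. c \<chi>) = 0"
  shows "gamma_op G n (comb c) = (\<lambda>g\<in>carrier G. fps_nth (\<Prod>\<chi>\<in>Ch. binomial_series (\<chi> g - 1) (c \<chi>)) n)"
proof -
  define \<epsilon> :: "'a \<Rightarrow> complex" where "\<epsilon> = (\<lambda>g\<in>carrier G. 1)"
  have \<epsilon>: "\<epsilon> \<in> Ch" using trivial_Ch by (simp add: \<epsilon>_def)
  define d where "d \<chi> = (if \<chi> = \<epsilon> then int n - 1 else 0)" for \<chi>
  have sd: "char_series d g = binomial_series 1 (int n - 1)" if "g \<in> carrier G" for g
  proof -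
    have "char_series d g = (\<Prod>\<chi>\<in>Ch. if \<chi> = \<epsilon> then binomial_series 1 (int n - 1) else 1)"
      using that by (intro prod.cong) (auto simp: d_def \<epsilon>_def)
    then show ?thesis using \<epsilon> finite_Ch by simp
  qed
  have cd: "comb d = (\<lambda>g\<in>carrier G. of_int (int n - 1))"
  proof -
    have "(\<Sum>\<chi>\<in>Ch. of_int (d \<chi>) * \<chi> g) = (\<Sum>\<chi>\<in>Ch. if \<chi> = \<epsilon> then of_int (int n - 1) else 0)"
      if "g \<in> carrier G" for g
      using that by (intro sum.cong) (auto simp: d_def \<epsilon>_def)
    then show ?thesis unfolding comb_def using \<epsilon> finite_Ch by (intro restrict_ext) simp
  qed
  \<comment> \<open>At the identity every character is 1, so this series is (1 + t) to the power
    minus the degree. It is the trivial factor that is distributed below.\<close>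
  have one: "char_series (\<lambda>\<chi>. - c \<chi>) \<one> = 1"
  proof -
    have "(\<Prod>\<chi>\<in>F. binomial_series 1 (e \<chi>)) = binomial_series 1 (\<Sum>\<chi>\<in>F. e \<chi>)" if "finite F" for F and e :: "('a \<Rightarrow> complex) \<Rightarrow> int"
      using that by (induction F) (simp_all add: binomial_series_add)
    then have "(\<Prod>\<chi>\<in>Ch. binomial_series 1 (- c \<chi>)) = binomial_series 1 (- (\<Sum>\<chi>\<in>Ch. c \<chi>))"
      using finite_Ch by (simp add: sum_negf)
    then show ?thesis using assms by (simp add: Ch_one)
  qed
  have "gamma_op G n (comb c) = lambda_char n (\<lambda>g\<in>carrier G. comb c g + comb d g)"
    unfolding gamma_op_def lambda_op_eq add_pow_char_ring_one cd by simp
  also have "\<dots> = (\<lambda>g\<in>carrier G. fps_nth (char_series c g * char_series d g) n)"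
    by (simp add: comb_add lambda_char_comb char_series_add)
  also have "\<dots> = (\<lambda>g\<in>carrier G. fps_nth (\<Prod>\<chi>\<in>Ch. binomial_series (\<chi> g - 1) (c \<chi>)) n)"
  proof (rule restrict_ext)
    fix g assume g: "g \<in> carrier G"
    have compose_prod: "fps_compose (\<Prod>\<chi>\<in>F. f \<chi>) gamma_subst = (\<Prod>\<chi>\<in>F. fps_compose (f \<chi>) gamma_subst)"
      if "finite F" for F and f :: "('a \<Rightarrow> complex) \<Rightarrow> complex fps"
      using that by (induction F) (simp_all add: fps_compose_mult_distrib)
    have "fps_nth (char_series c g * char_series d g) n = fps_nth (fps_compose (char_series c g) gamma_subst) n"
      unfolding sd[OF g] by (rule gamma_coefficient)
    also have "fps_compose (char_series c g) gamma_subst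
        = fps_compose (char_series c g) gamma_subst * fps_compose (char_series (\<lambda>\<chi>. - c \<chi>) \<one>) gamma_subst"
      unfolding one by simp
    also have "\<dots> = (\<Prod>\<chi>\<in>Ch. fps_compose (binomial_series (\<chi> g) (c \<chi>)) gamma_subst
        * fps_compose (binomial_series 1 (- c \<chi>)) gamma_subst)"
      unfolding compose_prod[OF finite_Ch] prod.distrib[symmetric]
      by (intro prod.cong refl) (simp add: Ch_one)
    also have "\<dots> = (\<Prod>\<chi>\<in>Ch. binomial_series (\<chi> g - 1) (c \<chi>))"
      by (simp add: binomial_series_gamma)
    finally show "fps_nth (char_series c g * char_series d g) n
        = fps_nth (\<Prod>\<chi>\<in>Ch. binomial_series (\<chi> g - 1) (c \<chi>)) n" .
  qed
  finally show ?thesis .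
qed

end

section \<open>The gamma filtration of the square of a cyclic group of order 4\<close>

lemma ii_power_mod_4: "\<i> ^ (n mod 4) = \<i> ^ n"
proof -
  have "\<i> ^ 4 = 1" by (simp add: power4_eq_xxxx)
  then have "\<i> ^ (4 * (n div 4) + n mod 4) = \<i> ^ (n mod 4)"
    by (simp only: power_add power_mult power_one) simp
  then show ?thesis by simp
qed

text \<open>The discrete logarithm e with respect to a generator is additive modulo 4, and i^e
  depends only on e modulo 4.\<close>

lemma cyclic_group_4_character:
  assumes "group C" "cyclic_group C" "Coset.order C = 4"
  obtains \<zeta> :: "'a \<Rightarrow> complex" where "bij_betw \<zeta> (carrier C) {1, \<i>, - 1, - \<i>}"
    "\<And>x y. x \<in> carrier C \<Longrightarrow> y \<in> carrier C \<Longrightarrow> \<zeta> (x \<otimes>\<^bsub>C\<^esub> y) = \<zeta> x * \<zeta> y"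
proof -
  interpret group C by fact
  obtain c where c: "c \<in> carrier C" and range: "carrier C = range (\<lambda>n::int. c [^]\<^bsub>C\<^esub> n)"
    using assms(2) cyclic_group by blast
  have fin: "finite (carrier C)" using assms(3) by (metis Coset.order_def card.infinite zero_neq_numeral)
  have "generate C {c} = carrier C" unfolding generate_pow[OF c] range by auto
  then have ord: "ord c = 4"
    using generate_pow_card[OF c] assms(3) by (simp add: Coset.order_def)
  have inj: "inj_on (\<lambda>k::nat. c [^]\<^bsub>C\<^esub> k) {0..<4}"
    using ord_inj[OF c] unfolding ord by (rule inj_on_subset) auto
  have elems: "carrier C = (\<lambda>k::nat. c [^]\<^bsub>C\<^esub> k) ` {0..<4}"
  proof (rule card_subset_eq[OF fin, symmetric])
    show "(\<lambda>k::nat. c [^]\<^bsub>C\<^esub> k) ` {0..<4} \<subseteq> carrier C" using c by auto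
    show "card ((\<lambda>k::nat. c [^]\<^bsub>C\<^esub> k) ` {0..<4}) = card (carrier C)"
      using card_image[OF inj] assms(3) by (simp add: Coset.order_def)
  qed
  have bij: "bij_betw (\<lambda>k::nat. c [^]\<^bsub>C\<^esub> k) {0..<4} (carrier C)"
    using inj elems by (simp add: bij_betw_def)
  define e where "e = inv_into {0..<4} (\<lambda>k::nat. c [^]\<^bsub>C\<^esub> k)"
  have e: "e (c [^]\<^bsub>C\<^esub> k) = k" if "k < 4" for k :: nat
    unfolding e_def using that inj by (simp add: inv_into_f_f)
  have ec: "c [^]\<^bsub>C\<^esub> e x = x" "e x < 4" if "x \<in> carrier C" for x
    using that bij_betw_inv_into_right[OF bij] bij_betw_apply[OF bij_betw_inv_into[OF bij]]
    unfolding e_def by (auto dest: atLeastLessThan_iff[THEN iffD1])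
  have pow_mod: "c [^]\<^bsub>C\<^esub> (k mod 4) = c [^]\<^bsub>C\<^esub> k" for k :: nat
  proof -
    have "c [^]\<^bsub>C\<^esub> k = c [^]\<^bsub>C\<^esub> (4 * (k div 4) + k mod 4)" by simp
    also have "\<dots> = (c [^]\<^bsub>C\<^esub> (4::nat)) [^]\<^bsub>C\<^esub> (k div 4) \<otimes>\<^bsub>C\<^esub> c [^]\<^bsub>C\<^esub> (k mod 4)"
      using c by (simp only: nat_pow_mult nat_pow_pow nat_pow_closed)
    also have "c [^]\<^bsub>C\<^esub> (4::nat) = \<one>\<^bsub>C\<^esub>" using pow_ord_eq_1[OF c] by (simp add: ord)
    finally show ?thesis using c by simp
  qed
  define \<zeta> where "\<zeta> x = \<i> ^ e x" for x
  have "bij_betw (\<lambda>k. \<i> ^ k) {0..<4::nat} {1, \<i>, - 1, - \<i>}"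
  proof -
    have "{0..<4::nat} = {0, 1, 2, 3}" by auto
    then show ?thesis by (auto simp: bij_betw_def inj_on_def power3_eq_cube complex_eq_iff)
  qed
  moreover have "bij_betw e (carrier C) {0..<4}"
    unfolding e_def by (rule bij_betw_inv_into[OF bij])
  ultimately have "bij_betw ((\<lambda>k. \<i> ^ k) \<circ> e) (carrier C) {1, \<i>, - 1, - \<i>}"
    by (rule bij_betw_trans[rotated])
  then have "bij_betw \<zeta> (carrier C) {1, \<i>, - 1, - \<i>}"
    by (simp add: \<zeta>_def[abs_def] o_def)
  moreover have "\<zeta> (x \<otimes>\<^bsub>C\<^esub> y) = \<zeta> x * \<zeta> y" if "x \<in> carrier C" "y \<in> carrier C" for x y
  proof -
    have "x \<otimes>\<^bsub>C\<^esub> y = c [^]\<^bsub>C\<^esub> (e x + e y)"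
      using ec that c by (metis nat_pow_mult)
    also have "\<dots> = c [^]\<^bsub>C\<^esub> ((e x + e y) mod 4)" by (simp only: pow_mod)
    finally have "e (x \<otimes>\<^bsub>C\<^esub> y) = (e x + e y) mod 4" by (simp add: e)
    then show ?thesis by (simp add: \<zeta>_def ii_power_mod_4 power_add)
  qed
  ultimately show thesis by (rule that)
qed

locale C4_squared =
  fixes C :: "('g, 'm) monoid_scheme" and \<zeta> :: "'g \<Rightarrow> complex"
  assumes group_C: "group C"
    and bij_\<zeta>: "bij_betw \<zeta> (carrier C) {1, \<i>, - 1, - \<i>}"
    and mult_\<zeta>: "x \<in> carrier C \<Longrightarrow> y \<in> carrier C \<Longrightarrow> \<zeta> (x \<otimes>\<^bsub>C\<^esub> y) = \<zeta> x * \<zeta> y"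
begin

abbreviation "G \<equiv> C \<times>\<times> C"

definition chr :: "nat \<Rightarrow> nat \<Rightarrow> 'g \<times> 'g \<Rightarrow> complex" where
  "chr a b = (\<lambda>g\<in>carrier G. \<zeta> (fst g) ^ a * \<zeta> (snd g) ^ b)"

definition Ch :: "('g \<times> 'g \<Rightarrow> complex) set" where
  "Ch = (\<lambda>(a, b). chr a b) ` ({0..<4} \<times> {0..<4})"

section \<open>The sixteen characters and their orthogonality\<close>

lemma \<zeta>_mem: "x \<in> carrier C \<Longrightarrow> \<zeta> x \<in> {1, \<i>, - 1, - \<i>}"
  using bij_betw_apply[OF bij_\<zeta>] .

lemma \<zeta>_one: "\<zeta> \<one>\<^bsub>C\<^esub> = 1"
proof -
  interpret C: group C by (rule group_C)
  have "\<zeta> \<one>\<^bsub>C\<^esub> = \<zeta> \<one>\<^bsub>C\<^esub> * \<zeta> \<one>\<^bsub>C\<^esub>" using mult_\<zeta>[of "\<one>\<^bsub>C\<^esub>" "\<one>\<^bsub>C\<^esub>"] by simp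
  moreover have "\<zeta> \<one>\<^bsub>C\<^esub> \<noteq> 0" using \<zeta>_mem[OF C.one_closed] by auto
  ultimately show ?thesis by simp
qed

lemma \<zeta>_inv: "x \<in> carrier C \<Longrightarrow> \<zeta> (inv\<^bsub>C\<^esub> x) = inverse (\<zeta> x)"
proof -
  interpret C: group C by (rule group_C)
  assume x: "x \<in> carrier C"
  have "\<zeta> x * \<zeta> (inv\<^bsub>C\<^esub> x) = 1" using mult_\<zeta>[OF x C.inv_closed[OF x]] \<zeta>_one x by simp
  then show ?thesis using inverse_unique by metis
qed

lemma sum_\<zeta>: "(\<Sum>x\<in>carrier C. f (\<zeta> x)) = f 1 + f \<i> + f (- 1) + f (- \<i>)"
proof -
  have "(\<Sum>x\<in>carrier C. f (\<zeta> x)) = (\<Sum>z\<in>{1, \<i>, - 1, - \<i>}. f z)"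
    by (rule sum.reindex_bij_betw[OF bij_\<zeta>])
  also have "\<dots> = f 1 + f \<i> + f (- 1) + f (- \<i>)" by (simp add: complex_eq_iff add.assoc)
  finally show ?thesis .
qed

lemma finite_C: "finite (carrier C)" "card (carrier C) = 4"
proof -
  show "finite (carrier C)" using bij_betw_finite[OF bij_\<zeta>] by simp
  have "card {1, \<i>, - 1, - \<i>} = 4" by (simp add: complex_eq_iff)
  then show "card (carrier C) = 4" using bij_betw_same_card[OF bij_\<zeta>] by simp
qed

lemma \<zeta>_power4: "x \<in> carrier C \<Longrightarrow> \<zeta> x ^ 4 = 1"
  using \<zeta>_mem[of x] by (auto simp: power4_eq_xxxx)

lemma \<zeta>_power_mod4: "x \<in> carrier C \<Longrightarrow> \<zeta> x ^ (n mod 4) = \<zeta> x ^ n"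
proof -
  assume "x \<in> carrier C"
  then have "\<zeta> x ^ (4 * (n div 4) + n mod 4) = \<zeta> x ^ (n mod 4)"
    by (simp only: power_add power_mult \<zeta>_power4 power_one) simp
  then show ?thesis by simp
qed

lemma chr_apply [simp]: "x \<in> carrier C \<Longrightarrow> y \<in> carrier C \<Longrightarrow> chr a b (x, y) = \<zeta> x ^ a * \<zeta> y ^ b"
  by (simp add: chr_def)

lemma row_sum:
  assumes "a < 4" "a' < 4"
  shows "(\<Sum>x\<in>carrier C. \<zeta> x ^ a * \<zeta> (inv\<^bsub>C\<^esub> x) ^ a') = (if a = a' then 4 else 0)"
proof -
  have "(\<Sum>x\<in>carrier C. \<zeta> x ^ a * \<zeta> (inv\<^bsub>C\<^esub> x) ^ a') = (\<Sum>x\<in>carrier C. \<zeta> x ^ a * inverse (\<zeta> x) ^ a')"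
    by (intro sum.cong refl) (simp add: \<zeta>_inv)
  also have "\<dots> = 1 + \<i> ^ a * inverse \<i> ^ a' + (- 1) ^ a * inverse (- 1) ^ a' + (- \<i>) ^ a * inverse (- \<i>) ^ a'"
    using sum_\<zeta>[of "\<lambda>z. z ^ a * inverse z ^ a'"] by simp
  also have "\<dots> = (if a = a' then 4 else 0)"
  proof -
    have "a = 0 \<or> a = 1 \<or> a = 2 \<or> a = 3" "a' = 0 \<or> a' = 1 \<or> a' = 2 \<or> a' = 3" using assms by auto
    then show ?thesis by (elim disjE) (simp_all add: power3_eq_cube)
  qed
  finally show ?thesis .
qed

lemma column_sum:
  assumes "x \<in> carrier C"
  shows "(\<Sum>a\<in>{0..<4}. \<zeta> x ^ a) = (if x = \<one>\<^bsub>C\<^esub> then 4 else 0)"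
proof -
  interpret C: group C by (rule group_C)
  have "(\<Sum>a\<in>{0..<4}. \<zeta> x ^ a) = 1 + \<zeta> x + \<zeta> x ^ 2 + \<zeta> x ^ 3"
    by (simp add: eval_nat_numeral)
  moreover have "\<zeta> x = 1 \<longleftrightarrow> x = \<one>\<^bsub>C\<^esub>"
    using \<zeta>_one assms C.one_closed bij_betw_imp_inj_on[OF bij_\<zeta>] by (metis inj_onD)
  moreover have "\<i> \<noteq> 1" "- \<i> \<noteq> 1" by (simp_all add: complex_eq_iff)
  ultimately show ?thesis using \<zeta>_mem[OF assms]
    by (elim insertE emptyE) (simp_all add: power3_eq_cube)
qed

lemma row_sum_chr:
  assumes "a < 4" "b < 4" "a' < 4" "b' < 4"
  shows "(\<Sum>g\<in>carrier G. chr a b g * chr a' b' (inv\<^bsub>G\<^esub> g)) = (if a = a' \<and> b = b' then 16 else 0)"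
proof -
  interpret C: group C by (rule group_C)
  have "(\<Sum>g\<in>carrier G. chr a b g * chr a' b' (inv\<^bsub>G\<^esub> g))
      = (\<Sum>g\<in>carrier C \<times> carrier C. case g of (x, y) \<Rightarrow>
          (\<zeta> x ^ a * \<zeta> (inv\<^bsub>C\<^esub> x) ^ a') * (\<zeta> y ^ b * \<zeta> (inv\<^bsub>C\<^esub> y) ^ b'))"
    by (intro sum.cong) (auto simp: inv_DirProd[OF group_C group_C])
  also have "\<dots> = (\<Sum>x\<in>carrier C. \<zeta> x ^ a * \<zeta> (inv\<^bsub>C\<^esub> x) ^ a') * (\<Sum>y\<in>carrier C. \<zeta> y ^ b * \<zeta> (inv\<^bsub>C\<^esub> y) ^ b')"
    by (simp only: sum.cartesian_product[symmetric] sum_product)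
  finally show ?thesis using assms by (simp add: row_sum)
qed

text \<open>If two characters with different exponents were equal, the same row sum would be both 16
  and 0.\<close>

lemma chr_inject:
  assumes "chr a b = chr a' b'" "a < 4" "b < 4" "a' < 4" "b' < 4"
  shows "a = a' \<and> b = b'"
  using row_sum_chr[of a b a' b'] row_sum_chr[of a b a b] assms by (auto split: if_splits)

lemma inj_chr: "inj_on (\<lambda>(a, b). chr a b) ({0..<4} \<times> {0..<4})"
  by (rule inj_onI) (auto dest!: chr_inject)

sublocale dual_group G Ch
proof -
  interpret C: group C by (rule group_C)
  have G: "group G" by (rule DirProd_group[OF group_C group_C])
  then interpret G: group G .
  have card: "card (carrier G) = 16" by (simp add: finite_C card_cartesian_product)
  have Ch: "\<exists>a<4. \<exists>b<4. \<chi> = chr a b" if "\<chi> \<in> Ch" for \<chi> using that by (auto simp: Ch_def) blast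
  show "dual_group G Ch"
  proof (intro dual_group.intro dual_group_axioms.intro G)
    show "finite (carrier G)" by (simp add: finite_C)
    show "finite Ch" by (simp add: Ch_def)
    show "\<chi> \<in> extensional (carrier G)" if "\<chi> \<in> Ch" for \<chi>
      using Ch[OF that] by (auto simp: chr_def)
    show "\<chi> (x \<otimes>\<^bsub>G\<^esub> y) = \<chi> x * \<chi> y" if "\<chi> \<in> Ch" "x \<in> carrier G" "y \<in> carrier G" for \<chi> x y
      using Ch[OF that(1)] that(2,3) by (auto simp: mult_\<zeta> power_mult_distrib)
    show "\<chi> \<one>\<^bsub>G\<^esub> = 1" if "\<chi> \<in> Ch" for \<chi>
      using Ch[OF that] by (auto simp: \<zeta>_one)
    show "(\<lambda>g\<in>carrier G. \<chi> g * \<psi> g) \<in> Ch" if "\<chi> \<in> Ch" "\<psi> \<in> Ch" for \<chi> \<psi>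
    proof -
      from Ch[OF that(1)] Ch[OF that(2)] obtain a b a' b' where "\<chi> = chr a b" "\<psi> = chr a' b'" by blast
      then have "(\<lambda>g\<in>carrier G. \<chi> g * \<psi> g) = chr ((a + a') mod 4) ((b + b') mod 4)"
        by (auto simp: fun_eq_iff chr_def \<zeta>_power_mod4 power_add)
      then show ?thesis by (auto simp: Ch_def)
    qed
    have "(\<lambda>g\<in>carrier G. 1) = chr 0 0" by (simp add: chr_def)
    then show "(\<lambda>g\<in>carrier G. 1) \<in> Ch" by (auto simp: Ch_def)
    show "(\<Sum>g\<in>carrier G. \<chi> g * \<psi> (inv\<^bsub>G\<^esub> g)) = (if \<chi> = \<psi> then of_nat (card (carrier G)) else 0)"
      if "\<chi> \<in> Ch" "\<psi> \<in> Ch" for \<chi> \<psi>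
    proof -
      from Ch[OF that(1)] Ch[OF that(2)] obtain a b a' b'
        where ab: "\<chi> = chr a b" "\<psi> = chr a' b'" "a < 4" "b < 4" "a' < 4" "b' < 4"
        by blast
      then have "chr a b = chr a' b' \<longleftrightarrow> a = a' \<and> b = b'" using chr_inject by blast
      then show ?thesis unfolding card ab(1,2) row_sum_chr[OF ab(3-6)] by simp
    qed
    show "(\<Sum>\<chi>\<in>Ch. \<chi> g) = (if g = \<one>\<^bsub>G\<^esub> then of_nat (card (carrier G)) else 0)" if g: "g \<in> carrier G" for g
    proof -
      obtain x y where xy: "g = (x, y)" "x \<in> carrier C" "y \<in> carrier C" using g by auto
      have "(\<Sum>\<chi>\<in>Ch. \<chi> g) = (\<Sum>(a, b)\<in>{0..<4} \<times> {0..<4}. \<zeta> x ^ a * \<zeta> y ^ b)"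
        unfolding Ch_def by (subst sum.reindex[OF inj_chr]) (auto simp: xy intro!: sum.cong)
      also have "\<dots> = (\<Sum>a\<in>{0..<4}. \<zeta> x ^ a) * (\<Sum>b\<in>{0..<4}. \<zeta> y ^ b)"
        by (simp only: sum.cartesian_product[symmetric] sum_product)
      finally show ?thesis using xy unfolding card by (simp add: column_sum)
    qed
  qed
qed

text \<open>The ring homomorphism from Z[x,y] to the character ring with x to X - 1 and y to Y -
  1.\<close>

definition point_eval :: "int poly2 \<Rightarrow> 'g \<times> 'g \<Rightarrow> complex" where
  "point_eval P = (\<lambda>g\<in>carrier G. poly2_eval (\<zeta> (fst g) - 1) (\<zeta> (snd g) - 1) P)"

lemma point_eval_add: "point_eval P \<oplus>\<^bsub>char_ring G\<^esub> point_eval Q = point_eval (P + Q)"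
  by (auto simp: point_eval_def fun_eq_iff poly2_eval_simps)

lemma point_eval_mult: "point_eval P \<otimes>\<^bsub>char_ring G\<^esub> point_eval Q = point_eval (P * Q)"
  by (auto simp: point_eval_def fun_eq_iff poly2_eval_simps)

lemma point_eval_one: "\<one>\<^bsub>char_ring G\<^esub> = point_eval 1"
  by (auto simp: point_eval_def fun_eq_iff)

lemma point_eval_zero: "\<zero>\<^bsub>char_ring G\<^esub> = point_eval 0"
  by (auto simp: point_eval_def fun_eq_iff)

text \<open>As g runs over G, the pair of values of X - 1 and Y - 1 runs over the whole grid
  \<open>C4_values\<close> times \<open>C4_values\<close>. This connects characters with the
  detection results on points.\<close>

lemma point_eval_eq_iff:
  "point_eval P = point_eval Q \<longleftrightarrow>
    (\<forall>u\<in>C4_values. \<forall>v\<in>C4_values. poly2_eval u v P = poly2_eval u v Q)"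
proof -
  have img: "(\<lambda>x. \<zeta> x - 1) ` carrier C = C4_values"
  proof -
    have "(\<lambda>x. \<zeta> x - 1) ` carrier C = (\<lambda>z. z - 1) ` {1, \<i>, - 1, - \<i>}"
      unfolding bij_betw_imp_surj_on[OF bij_\<zeta>, symmetric] image_image ..
    then show ?thesis by (auto simp: C4_values_def)
  qed
  have "point_eval P = point_eval Q \<longleftrightarrow> (\<forall>x\<in>carrier C. \<forall>y\<in>carrier C.
      poly2_eval (\<zeta> x - 1) (\<zeta> y - 1) P = poly2_eval (\<zeta> x - 1) (\<zeta> y - 1) Q)"
    by (auto simp: point_eval_def fun_eq_iff restrict_def)
  then show ?thesis unfolding img[symmetric] by auto
qed

lemma virtual_point_eval: "virtual (point_eval P)"
proof -
  have one: "chr 1 0 \<in> Ch" "chr 0 1 \<in> Ch" by (force simp: Ch_def)+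
  have u: "virtual (\<lambda>g. \<zeta> (fst g) - 1)"
    by (rule virtual_cong[THEN iffD1, OF _ virtual_add[OF virtual_Ch[OF one(1)] virtual_const[of "-1"]]])
       (auto simp: chr_def)
  have v: "virtual (\<lambda>g. \<zeta> (snd g) - 1)"
    by (rule virtual_cong[THEN iffD1, OF _ virtual_add[OF virtual_Ch[OF one(2)] virtual_const[of "-1"]]])
       (auto simp: chr_def)
  have "virtual (\<lambda>g. poly2_eval (\<zeta> (fst g) - 1) (\<zeta> (snd g) - 1) P)"
    unfolding poly2_eval_def by (intro virtual_sum virtual_of_int_mult virtual_mult virtual_power u v)
  then show ?thesis by (rule virtual_cong[THEN iffD1, rotated]) (simp add: point_eval_def)
qed

lemma point_eval_closed: "point_eval P \<in> carrier (char_ring G)"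
  using virtual_point_eval[of P] by (simp add: virtual_char_ring point_eval_def)

definition chr_poly :: "nat \<Rightarrow> nat \<Rightarrow> int poly2" where
  "chr_poly a b = (1 + var_x) ^ a * (1 + var_y) ^ b"

lemma chr_point_eval: "chr a b = point_eval (chr_poly a b)"
  by (auto simp: chr_def point_eval_def chr_poly_def poly2_eval_simps fun_eq_iff)

text \<open>The polynomial (1+x)^a (1+y)^b - 1 has no constant term. In terms of the group: X - 1
  and Y - 1 generate the augmentation ideal.\<close>

lemma Ch_minus_one:
  assumes "\<chi> \<in> Ch"
  obtains Q where "Q \<in> order_ge 1" "\<And>g. g \<in> carrier G \<Longrightarrow> \<chi> g - 1 = point_eval Q g"
proof -
  obtain a b where ab: "\<chi> = chr a b" using assms by (auto simp: Ch_def)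
  have pow: "(1 + p) ^ n - 1 \<in> order_ge 1" if "p \<in> order_ge 1" for p :: "int poly2" and n
  proof (induction n)
    case (Suc n)
    have "(1 + p) ^ Suc n - 1 = (1 + p) * ((1 + p) ^ n - 1) + p" by (simp add: algebra_simps)
    then show ?case using order_ge_add[OF order_ge_mult_left[OF Suc] that] by simp
  qed simp
  have "chr_poly a b - 1 = (1 + var_x) ^ a * ((1 + var_y) ^ b - 1) + ((1 + var_x) ^ a - 1)"
    by (simp add: chr_poly_def algebra_simps)
  then have "chr_poly a b - 1 \<in> order_ge 1"
    using order_ge_add[OF order_ge_mult_left[OF pow[OF order_ge_var(2)]] pow[OF order_ge_var(1)]] by metis
  moreover have "\<chi> g - 1 = point_eval (chr_poly a b - 1) g" if "g \<in> carrier G" for g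
    using that by (simp add: ab chr_point_eval point_eval_def poly2_eval_simps)
  ultimately show thesis by (rule that)
qed

lemma char_ring_range: "carrier (char_ring G) = range point_eval"
proof
  show "range point_eval \<subseteq> carrier (char_ring G)" using point_eval_closed by blast
  have "\<exists>P. \<forall>g\<in>carrier G. (\<Sum>\<chi>\<in>F. of_int (c \<chi>) * \<chi> g) = point_eval P g" if "finite F" "F \<subseteq> Ch" for F c
    using that
  proof (induction F)
    case empty
    then show ?case by (intro exI[of _ 0]) (simp add: point_eval_def)
  next
    case (insert \<chi> F)
    then obtain P where P: "\<forall>g\<in>carrier G. (\<Sum>\<chi>\<in>F. of_int (c \<chi>) * \<chi> g) = point_eval P g" by auto
    obtain a b where "\<chi> = chr a b" using insert.prems by (auto simp: Ch_def)
    then have "\<forall>g\<in>carrier G. (\<Sum>\<chi>\<in>insert \<chi> F. of_int (c \<chi>) * \<chi> g) = point_eval (of_int (c \<chi>) * chr_poly a b + P) g"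
      using insert.hyps P by (simp add: chr_point_eval point_eval_def poly2_eval_simps)
    then show ?case by blast
  qed
  note sum_ex = this
  show "carrier (char_ring G) \<subseteq> range point_eval"
  proof
    fix x assume "x \<in> carrier (char_ring G)"
    then obtain c where x: "x = comb c" by (auto simp: char_ring_carrier)
    obtain P where "\<forall>g\<in>carrier G. (\<Sum>\<chi>\<in>Ch. of_int (c \<chi>) * \<chi> g) = point_eval P g"
      using sum_ex[OF finite_Ch] by blast
    then have "x = point_eval P" by (auto simp: x comb_def point_eval_def fun_eq_iff)
    then show "x \<in> range point_eval" by blast
  qed
qed

text \<open>The coefficient of t^i in (1 + (chi - 1)t)^c is an integer times (chi - 1)^i, so it
  comes from a polynomial of order at least i. In the Cauchy product over the characters these
  orders add up to k.\<close>

lemma gamma_op_order_ge: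
  assumes "x \<in> aug_ideal G"
  shows "gamma_op G k x \<in> point_eval ` order_ge k"
proof -
  obtain c where c: "x = comb c" "(\<Sum>\<chi>\<in>Ch. c \<chi>) = 0" using aug_ideal_comb[OF assms] .
  have "\<exists>P\<in>order_ge k. \<forall>g\<in>carrier G. fps_nth (\<Prod>\<chi>\<in>F. binomial_series (\<chi> g - 1) (c \<chi>)) k = point_eval P g"
    if "finite F" "F \<subseteq> Ch" for F k
    using that
  proof (induction F arbitrary: k)
    case empty
    show ?case
    proof (cases "k = 0")
      case True
      then show ?thesis by (intro bexI[of _ 1]) (simp_all add: point_eval_def)
    next
      case False
      then show ?thesis by (intro bexI[of _ 0]) (simp_all add: point_eval_def)
    qed
  next
    case (insert \<phi> F)
    obtain Q where Q: "Q \<in> order_ge 1" "\<And>g. g \<in> carrier G \<Longrightarrow> \<phi> g - 1 = point_eval Q g"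
      using Ch_minus_one insert.prems by blast
    have "\<forall>i. \<exists>z. (of_int (c \<phi>) gchoose i :: complex) = of_int z"
      using gbinomial_of_int_Ints by (meson Ints_cases)
    then obtain z where z: "\<And>i. (of_int (c \<phi>) gchoose i :: complex) = of_int (z i)" by metis
    have "\<exists>P. P \<in> order_ge i \<and>
        (\<forall>g\<in>carrier G. fps_nth (\<Prod>\<chi>\<in>F. binomial_series (\<chi> g - 1) (c \<chi>)) i = point_eval P g)" for i
      using insert.IH[of i] insert.prems by blast
    then have "\<exists>P. \<forall>i. P i \<in> order_ge i \<and>
        (\<forall>g\<in>carrier G. fps_nth (\<Prod>\<chi>\<in>F. binomial_series (\<chi> g - 1) (c \<chi>)) i = point_eval (P i) g)"
      by (intro choice) blast
    then obtain P where P: "\<And>i. P i \<in> order_ge i"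
      "\<And>i g. g \<in> carrier G \<Longrightarrow> fps_nth (\<Prod>\<chi>\<in>F. binomial_series (\<chi> g - 1) (c \<chi>)) i = point_eval (P i) g"
      by blast
    let ?P = "\<Sum>i=0..k. (of_int (z i) * Q ^ i) * P (k - i)"
    have "?P \<in> order_ge k"
    proof (rule order_ge_sum)
      fix i assume "i \<in> {0..k}"
      then have "(of_int (z i) * Q ^ i) * P (k - i) \<in> order_ge (i + (k - i))"
        using order_ge_power[OF Q(1), of i] by (intro order_ge_mult order_ge_mult_left P(1)) simp
      then show "(of_int (z i) * Q ^ i) * P (k - i) \<in> order_ge k" using \<open>i \<in> {0..k}\<close> by simp
    qed
    moreover have "fps_nth (\<Prod>\<chi>\<in>insert \<phi> F. binomial_series (\<chi> g - 1) (c \<chi>)) k = point_eval ?P g"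
      if g: "g \<in> carrier G" for g
    proof -
      have "fps_nth (\<Prod>\<chi>\<in>insert \<phi> F. binomial_series (\<chi> g - 1) (c \<chi>)) k
          = (\<Sum>i=0..k. fps_nth (binomial_series (\<phi> g - 1) (c \<phi>)) i
              * fps_nth (\<Prod>\<chi>\<in>F. binomial_series (\<chi> g - 1) (c \<chi>)) (k - i))"
        using insert.hyps by (simp add: fps_mult_nth)
      also have "\<dots> = (\<Sum>i=0..k. (of_int (z i) * point_eval Q g ^ i) * point_eval (P (k - i)) g)"
        by (simp only: P(2)[OF g] binomial_series_nth z Q(2)[OF g])
      also have "\<dots> = point_eval ?P g"
        using g by (simp add: point_eval_def poly2_eval_sum poly2_eval_simps)
      finally show ?thesis .
    qed
    ultimately show ?case by blast
  qed
  then obtain P where P: "P \<in> order_ge k"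
    "\<forall>g\<in>carrier G. fps_nth (\<Prod>\<chi>\<in>Ch. binomial_series (\<chi> g - 1) (c \<chi>)) k = point_eval P g"
    using finite_Ch by blast
  then have "gamma_op G k x = point_eval P"
    by (auto simp: c(1) gamma_op_comb[OF c(2)] point_eval_def fun_eq_iff)
  then show ?thesis using P(1) by blast
qed

text \<open>The first coefficient is the sum of c_chi (chi - 1), and the correction vanishes because
  the c_chi sum to 0. Hence products of n elements of the augmentation ideal lie in the n-th step of
  the filtration.\<close>

lemma gamma_op_1:
  assumes "x \<in> aug_ideal G"
  shows "gamma_op G 1 x = x"
proof -
  obtain c where c: "x = comb c" "(\<Sum>\<chi>\<in>Ch. c \<chi>) = 0" using aug_ideal_comb[OF assms] .
  have nth: "finite F \<Longrightarrow> fps_nth (\<Prod>\<chi>\<in>F. binomial_series (f \<chi>) (c \<chi>)) 0 = 1 \<and>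
    fps_nth (\<Prod>\<chi>\<in>F. binomial_series (f \<chi>) (c \<chi>)) 1 = (\<Sum>\<chi>\<in>F. of_int (c \<chi>) * f \<chi>)" for F and f
    by (induction F rule: finite_induct) (auto simp: fps_mult_nth binomial_series_def)
  have "(\<Sum>\<chi>\<in>Ch. of_int (c \<chi>) * (\<chi> g - 1)) = (\<Sum>\<chi>\<in>Ch. of_int (c \<chi>) * \<chi> g) - of_int (\<Sum>\<chi>\<in>Ch. c \<chi>)" for g
    by (simp add: right_diff_distrib sum_subtractf)
  then have "fps_nth (\<Prod>\<chi>\<in>Ch. binomial_series (\<chi> g - 1) (c \<chi>)) 1 = (\<Sum>\<chi>\<in>Ch. of_int (c \<chi>) * \<chi> g)" for g
    using nth[OF finite_Ch, of "\<lambda>\<chi>. \<chi> g - 1"] c(2) by simp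
  then show ?thesis unfolding c(1) gamma_op_comb[OF c(2)] by (simp only: comb_def)
qed

lemma finprod_point_eval:
  "(\<Otimes>\<^bsub>char_ring G\<^esub>j\<in>{..<r::nat}. point_eval (P j)) = point_eval (\<Prod>j<r. P j)"
proof (induction r)
  interpret R: cring "char_ring G" by (rule cring_char_ring)
  case 0
  then show ?case by (simp add: point_eval_one del: char_ring_simps)
next
  interpret R: cring "char_ring G" by (rule cring_char_ring)
  case (Suc r)
  have "(\<Otimes>\<^bsub>char_ring G\<^esub>j\<in>insert r {..<r}. point_eval (P j))
      = point_eval (P r) \<otimes>\<^bsub>char_ring G\<^esub> (\<Otimes>\<^bsub>char_ring G\<^esub>j\<in>{..<r}. point_eval (P j))"
    by (rule R.finprod_insert) (auto simp: point_eval_closed)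
  then show ?case unfolding Suc point_eval_mult by (simp add: lessThan_Suc mult.commute)
qed

text \<open>Generators land in the image because gamma operations raise the order and orders add
  under products. Conversely every monomial of degree at least n is a product of first gamma
  operations of X - 1 and Y - 1, and the monomials span additively.\<close>

lemma gamma_filtration_eq: "gamma_filtration G n = point_eval ` order_ge n"
proof
  interpret R: cring "char_ring G" by (rule cring_char_ring)
  let ?A = "add_monoid (char_ring G)"
  let ?S = "{(\<Otimes>\<^bsub>char_ring G\<^esub>j\<in>{..<r}. gamma_op G (i j) (x j)) | (r::nat) i x.
        (\<forall>j<r. x j \<in> aug_ideal G) \<and> (\<Sum>j<r. i j) \<ge> n}"
  have S: "h \<in> point_eval ` order_ge n" if "h \<in> ?S" for h
  proof -
    from that obtain r :: nat and i x where h: "h = (\<Otimes>\<^bsub>char_ring G\<^esub>j\<in>{..<r}. gamma_op G (i j) (x j))"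
      and x: "\<And>j. j < r \<Longrightarrow> x j \<in> aug_ideal G" and n: "(\<Sum>j<r. i j) \<ge> n"
      by auto
    have "\<forall>j. \<exists>P. j < r \<longrightarrow> P \<in> order_ge (i j) \<and> gamma_op G (i j) (x j) = point_eval P"
      using gamma_op_order_ge[OF x] by blast
    then obtain P where P: "\<And>j. j < r \<Longrightarrow> P j \<in> order_ge (i j)"
      "\<And>j. j < r \<Longrightarrow> gamma_op G (i j) (x j) = point_eval (P j)" by metis
    have "h = (\<Otimes>\<^bsub>char_ring G\<^esub>j\<in>{..<r}. point_eval (P j))"
      unfolding h by (intro R.finprod_cong') (auto simp: P point_eval_closed)
    also have "\<dots> = point_eval (\<Prod>j<r. P j)" by (rule finprod_point_eval)
    finally have "h = point_eval (\<Prod>j<r. P j)" .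
    moreover have "(\<Prod>j<s. P j) \<in> order_ge (\<Sum>j<s. i j)" if "s \<le> r" for s
      using that
    proof (induction s)
      case (Suc s)
      then show ?case using order_ge_mult[of "\<Prod>j<s. P j" "\<Sum>j<s. i j" "P s" "i s"] P(1) by simp
    qed simp
    ultimately show ?thesis using order_ge_mono[OF _ n] by blast
  qed
  have minus: "\<ominus>\<^bsub>char_ring G\<^esub> point_eval P = point_eval (- P)" for P
    unfolding a_inv_char_ring[OF point_eval_closed] by (auto simp: point_eval_def poly2_eval_simps fun_eq_iff)
  then have neg: "inv\<^bsub>?A\<^esub> point_eval P = point_eval (- P)" for P
    by (simp add: a_inv_def)
  have "h \<in> point_eval ` order_ge n" if "h \<in> generate ?A ?S" for h
    using that
  proof induction
    case one
    have "\<one>\<^bsub>?A\<^esub> = point_eval 0" by (simp add: point_eval_zero del: char_ring_simps)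
    then show ?case by (simp only:) (rule imageI, simp)
  next
    case (incl h)
    then show ?case by (rule S)
  next
    case (inv h)
    then show ?case using S[of h] neg order_ge_uminus by auto
  next
    case (eng h1 h2)
    then obtain P Q where "P \<in> order_ge n" "Q \<in> order_ge n" "h1 = point_eval P" "h2 = point_eval Q" by auto
    then have "h1 \<otimes>\<^bsub>?A\<^esub> h2 = point_eval (P + Q)" "P + Q \<in> order_ge n"
      by (simp_all add: point_eval_add order_ge_add del: char_ring_simps)
    then show ?case by blast
  qed
  then show "gamma_filtration G n \<subseteq> point_eval ` order_ge n" by (auto simp: gamma_filtration_def)
  have aug: "point_eval var_x \<in> aug_ideal G" "point_eval var_y \<in> aug_ideal G"
    by (simp_all add: aug_ideal_def char_degree_def point_eval_closed)
       (simp_all add: point_eval_def \<zeta>_one group.is_monoid[OF group_C] monoid.one_closed)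
  \<comment> \<open>The witness has a + b factors, all with gamma index 1: a copies of X - 1
    followed by b copies of Y - 1. For a = b = 0 it is the empty product.\<close>
  have mono: "point_eval (var_x ^ a * var_y ^ b) \<in> ?S" if "a + b \<ge> n" for a b
  proof -
    have "(\<Otimes>\<^bsub>char_ring G\<^esub>j\<in>{..<a+b}. gamma_op G 1 (point_eval (if j < a then var_x else var_y)))
      = (\<Otimes>\<^bsub>char_ring G\<^esub>j\<in>{..<a+b}. point_eval (if j < a then var_x else var_y))"
      by (intro R.finprod_cong') (auto simp: point_eval_closed intro!: gamma_op_1[unfolded One_nat_def] aug)
    also have "\<dots> = point_eval (\<Prod>j<a+b. if j < a then var_x else var_y)" by (rule finprod_point_eval)
    also have "(\<Prod>j<a+b. if j < a then var_x else var_y :: int poly2) = var_x ^ a * var_y ^ b"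
      by (induction b) (auto intro!: prod.cong simp: mult_ac)
    finally show ?thesis
      using that aug by (intro CollectI exI[of _ "a + b"] exI[of _ "\<lambda>_. 1"]
          exI[of _ "\<lambda>j. point_eval (if j < a then var_x else var_y)"]) auto
  qed
  have S_carrier: "?S \<subseteq> carrier (char_ring G)" 
  proof
    fix h assume "h \<in> ?S"
    from S[OF this] show "h \<in> carrier (char_ring G)" using point_eval_closed by auto
  qed
  define V where "V P \<longleftrightarrow> point_eval P \<in> generate ?A ?S" for P
  have V_add: "V (P + Q)" if "V P" "V Q" for P Q
    using generate.eng[of "point_eval P" ?A ?S "point_eval Q"] that
    by (simp add: V_def point_eval_add del: char_ring_simps)
  have V_neg: "V (- P)" if "V P" for P
    using R.add.generate_m_inv_closed[OF S_carrier that[unfolded V_def]] unfolding V_def minus .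
  have V_0: "V 0" using generate.one[of ?A ?S] by (simp add: V_def point_eval_zero del: char_ring_simps)
  have V_single: "V (Poly_Mapping.single (a, b) c)" if "a + b \<ge> n" for a b c
  proof -
    have one: "V (Poly_Mapping.single (a, b) 1)"
      using mono[OF that] unfolding V_def var_power_mult by (rule generate.incl)
    have nat: "V (Poly_Mapping.single (a, b) (int m))" for m
      by (induction m) (auto simp: V_0 single_add intro!: V_add one)
    show ?thesis
    proof (cases c rule: int_cases2)
      case (nonpos m)
      then show ?thesis using V_neg[OF nat[of m]] by (simp add: single_uminus)
    qed (use nat in simp)
  qed
  have V_sum: "V (sum f A)" if "\<And>k. k \<in> A \<Longrightarrow> V (f k)" for f :: "nat \<times> nat \<Rightarrow> int poly2" and A
    using that by (induction A rule: infinite_finite_induct) (auto intro: V_0 V_add)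
  have "V P" if P: "P \<in> order_ge n" for P
  proof -
    have "P = (\<Sum>k\<in>Poly_Mapping.keys P. Poly_Mapping.single k (Poly_Mapping.lookup P k))"
      by (rule poly_mapping_eqI) (auto simp: lookup_sum lookup_single when_def in_keys_iff)
    moreover have "V (\<Sum>k\<in>Poly_Mapping.keys P. Poly_Mapping.single k (Poly_Mapping.lookup P k))"
      using P by (intro V_sum) (auto simp: order_ge_def intro!: V_single)
    ultimately show ?thesis by metis
  qed
  then show "point_eval ` order_ge n \<subseteq> gamma_filtration G n" by (auto simp: gamma_filtration_def V_def)
qed

end

section \<open>The associated graded ring\<close>

lemma cring_class_ring: "cring (class_ring :: 'a::comm_ring_1 ring)"
proof (intro cringI abelian_groupI comm_monoidI)
  fix x :: 'a assume "x \<in> carrier class_ring"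
  show "\<exists>y\<in>carrier class_ring. y \<oplus>\<^bsub>class_ring\<^esub> x = \<zero>\<^bsub>class_ring\<^esub>"
    by (rule bexI[of _ "- x"]) auto
qed (auto simp: algebra_simps)

lemmas ring_class_ring = cring.axioms(1)[OF cring_class_ring]

lemma class_ring_idealI:
  fixes J :: "'a::comm_ring_1 set"
  assumes "0 \<in> J" "\<And>p q. p \<in> J \<Longrightarrow> q \<in> J \<Longrightarrow> p + q \<in> J" "\<And>p q. p \<in> J \<Longrightarrow> q * p \<in> J"
  shows "ideal J class_ring"
proof (rule idealI[OF ring_class_ring])
  have grp: "group (add_monoid (class_ring :: 'a ring))"
    by (rule abelian_group.a_group[OF ring.is_abelian_group[OF ring_class_ring]])
  show "subgroup J (add_monoid class_ring)"
  proof (rule group.subgroupI[OF grp])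
    fix a assume a: "a \<in> J"
    have inv: "inv\<^bsub>add_monoid class_ring\<^esub> a = - 1 * a" by (rule group.inv_equality[OF grp]) auto
    show "inv\<^bsub>add_monoid class_ring\<^esub> a \<in> J" unfolding inv by (rule assms(3)[OF a])
  qed (use assms in auto)
qed (use assms(3) in \<open>auto simp: mult.commute\<close>)

lemma ideal_genideal_class_ring: "ideal (Idl\<^bsub>class_ring\<^esub> S) (class_ring :: 'a::comm_ring_1 ring)"
  using ring.genideal_ideal[OF ring_class_ring, of S] by simp

lemma genideal_class_ring_subset: "S \<subseteq> Idl\<^bsub>class_ring\<^esub> S" for S :: "'a::comm_ring_1 set"
  using ring.genideal_self[OF ring_class_ring, of S] by simp

lemma genideal_class_ring_minimal: "ideal J class_ring \<Longrightarrow> S \<subseteq> J \<Longrightarrow> Idl\<^bsub>class_ring\<^esub> S \<subseteq> J"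
  for S :: "'a::comm_ring_1 set"
  by (rule ring.genideal_minimal[OF ring_class_ring])

text \<open>The first isomorphism theorem with homogeneous parts carried along. It serves for both
  quotients: the one of Z[x,y] and the one that defines the tensor product.\<close>

lemma quotient_graded_isomorphic:
  assumes "ring_hom_ring A B h" "h ` carrier A = carrier B" "a_kernel A B h = J"
    and "\<And>n. dA n \<subseteq> carrier A" "\<And>n. dB n = h ` dA n"
  shows "graded_isomorphic (A Quot J) (quot_part A J dA) B dB"
proof -
  interpret ring_hom_ring A B h by fact
  have iso: "(\<lambda>X. the_elem (h ` X)) \<in> ring_iso (A Quot J) B"
    using FactRing_iso_set[OF assms(2)] by (simp add: assms(3))
  have "(\<lambda>X. the_elem (h ` X)) ` quot_part A J dA n = dB n" for n
  proof -
    have "(\<lambda>X. the_elem (h ` X)) ` quot_part A J dA n = (\<lambda>a. the_elem (h ` (J +>\<^bsub>A\<^esub> a))) ` dA n"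
      by (simp add: quot_part_def image_image)
    also have "\<dots> = h ` dA n"
      using the_elem_simp assms(3,4) by (intro image_cong) auto
    finally show ?thesis by (simp add: assms(5))
  qed
  then show ?thesis using iso unfolding graded_isomorphic_def by blast
qed

lemma graded_isomorphic_sym:
  assumes "ring A" "graded_isomorphic A dA B dB" "\<And>n. dA n \<subseteq> carrier A"
  shows "graded_isomorphic B dB A dA"
proof -
  obtain h where h: "h \<in> ring_iso A B" "\<And>n. h ` dA n = dB n"
    using assms(2) unfolding graded_isomorphic_def by blast
  have "inv_into (carrier A) h \<in> ring_iso B A" by (rule ring_iso_set_sym[OF assms(1) h(1)])
  moreover have "inv_into (carrier A) h ` dB n = dA n" for n
    using h assms(3) inv_into_image_cancel[of h "carrier A" "dA n"]
    by (auto simp: ring_iso_def bij_betw_def)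
  ultimately show ?thesis unfolding graded_isomorphic_def by blast
qed

text \<open>What remains of the character ring from here on: a quotient of Z[x,y] filtered by the
  images of the powers of (x, y). Its graded ring is Z[x,y] modulo the lowest-degree forms of the
  kernel.\<close>

locale poly2_filtered_ring = cring R for R :: "('r, 'm) ring_scheme" (structure) +
  fixes \<phi> :: "int poly2 \<Rightarrow> 'r" and F :: "nat \<Rightarrow> 'r set"
  assumes \<phi>_add: "\<phi> p \<oplus> \<phi> q = \<phi> (p + q)" and \<phi>_mult: "\<phi> p \<otimes> \<phi> q = \<phi> (p * q)"
    and \<phi>_one: "\<one> = \<phi> 1" and \<phi>_zero: "\<zero> = \<phi> 0"
    and \<phi>_surj: "carrier R = range \<phi>" and F_eq: "F n = \<phi> ` order_ge n"
begin

abbreviation "gr \<equiv> assoc_graded R F"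

lemma coset_eq: "F n +> \<phi> p = {\<phi> (e + p) | e. e \<in> order_ge n}"
  by (auto simp: a_r_coset_def' F_eq \<phi>_add)

lemma \<phi>_diff: "\<phi> p = \<phi> q \<longleftrightarrow> \<phi> (p - q) = \<phi> 0"
proof
  assume "\<phi> p = \<phi> q"
  then have "\<phi> p \<oplus> \<phi> (- q) = \<phi> q \<oplus> \<phi> (- q)" by simp
  then show "\<phi> (p - q) = \<phi> 0" by (simp add: \<phi>_add)
next
  assume "\<phi> (p - q) = \<phi> 0"
  then have "\<phi> (p - q) \<oplus> \<phi> q = \<phi> 0 \<oplus> \<phi> q" by simp
  then show "\<phi> p = \<phi> q" by (simp add: \<phi>_add)
qed

lemma coset_eq_iff: "F n +> \<phi> p = F n +> \<phi> q \<longleftrightarrow> \<phi> (p - q) \<in> F n"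
proof
  assume "F n +> \<phi> p = F n +> \<phi> q"
  moreover have "\<phi> p \<in> F n +> \<phi> p" unfolding coset_eq by (auto intro!: exI[of _ 0])
  ultimately obtain e where e: "e \<in> order_ge n" "\<phi> p = \<phi> (e + q)" unfolding coset_eq by blast
  then have "\<phi> (p - (e + q)) = \<phi> 0" using \<phi>_diff by blast
  then have "\<phi> ((p - q) - e) = \<phi> 0" by (simp add: algebra_simps)
  then have "\<phi> (p - q) = \<phi> e" using \<phi>_diff by blast
  then show "\<phi> (p - q) \<in> F n" using e(1) by (simp add: F_eq)
next
  assume "\<phi> (p - q) \<in> F n"
  then obtain e where e: "e \<in> order_ge n" "\<phi> (p - q) = \<phi> e" by (auto simp: F_eq)
  have "\<phi> ((p - q) - e) = \<phi> 0" using e(2) \<phi>_diff by blast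
  then have "\<phi> ((f + p) - (f + e + q)) = \<phi> 0" "\<phi> ((f + q) - (f - e + p)) = \<phi> 0" for f
    using \<phi>_diff[of "p - q" e] \<phi>_diff[of e "p - q"] e(2) by (simp_all add: algebra_simps)
  then have *: "\<phi> (f + p) = \<phi> (f + e + q)" "\<phi> (f + q) = \<phi> (f - e + p)" for f using \<phi>_diff by blast+
  show "F n +> \<phi> p = F n +> \<phi> q"
    unfolding coset_eq using * order_ge_add[OF _ e(1)] order_ge_diff[OF _ e(1)] by blast
qed

lemma coset_cong: "p - q \<in> order_ge n \<Longrightarrow> F n +> \<phi> p = F n +> \<phi> q"
  unfolding coset_eq_iff by (simp add: F_eq)

lemma coset_zero: "F n +> \<phi> 0 = F n"
  unfolding coset_eq by (auto simp: F_eq)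

lemma coset_add: "(F n +> \<phi> p) <+> (F n +> \<phi> q) = F n +> \<phi> (p + q)"
proof -
  have "(F n +> \<phi> p) <+> (F n +> \<phi> q) = {\<phi> (e + p) \<oplus> \<phi> (e' + q) | e e'. e \<in> order_ge n \<and> e' \<in> order_ge n}"
    unfolding coset_eq set_add_defs by auto
  also have "\<dots> = {\<phi> (e + (p + q)) | e. e \<in> order_ge n}"
  proof safe
    fix e e' :: "int poly2" assume "e \<in> order_ge n" "e' \<in> order_ge n"
    then show "\<exists>f. \<phi> (e + p) \<oplus> \<phi> (e' + q) = \<phi> (f + (p + q)) \<and> f \<in> order_ge n"
      by (intro exI[of _ "e + e'"]) (simp add: \<phi>_add order_ge_add algebra_simps)
  next
    fix e :: "int poly2" assume "e \<in> order_ge n"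
    then show "\<exists>f f'. \<phi> (e + (p + q)) = \<phi> (f + p) \<oplus> \<phi> (f' + q) \<and> f \<in> order_ge n \<and> f' \<in> order_ge n"
      by (intro exI[of _ e] exI[of _ 0]) (simp add: \<phi>_add algebra_simps)
  qed
  finally show ?thesis unfolding coset_eq .
qed

text \<open>\<open>rcoset_mult\<close> is a union over all pairs of representatives. Changing the
  representatives adds terms ef, eq and pf, all of order above n, so every member of the union is
  the same coset.\<close>

lemma coset_mult:
  assumes "p \<in> order_ge i" "q \<in> order_ge j" "i + j = n"
  shows "rcoset_mult R (F (Suc n)) (F (Suc i) +> \<phi> p) (F (Suc j) +> \<phi> q) = F (Suc n) +> \<phi> (p * q)"
proof -
  have "F (Suc n) +> (a \<otimes> b) = F (Suc n) +> \<phi> (p * q)"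
    if ab: "a \<in> F (Suc i) +> \<phi> p" "b \<in> F (Suc j) +> \<phi> q" for a b
  proof -
    obtain e f where e: "e \<in> order_ge (Suc i)" "a = \<phi> (e + p)" and f: "f \<in> order_ge (Suc j)" "b = \<phi> (f + q)"
      using ab unfolding coset_eq by blast
    have "e * f \<in> order_ge (Suc n)" "e * q \<in> order_ge (Suc n)" "p * f \<in> order_ge (Suc n)"
      using order_ge_mult[OF e(1) f(1)] order_ge_mult[OF e(1) assms(2)] order_ge_mult[OF assms(1) f(1)] assms(3)
      by (auto elim: order_ge_mono)
    then have "e * f + e * q + p * f \<in> order_ge (Suc n)" by (intro order_ge_add)
    moreover have "(e + p) * (f + q) - p * q = e * f + e * q + p * f" by (simp add: algebra_simps)
    ultimately show ?thesis unfolding e(2) f(2) \<phi>_mult by (intro coset_cong) simp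
  qed
  moreover have "\<phi> p \<in> F (Suc i) +> \<phi> p" "\<phi> q \<in> F (Suc j) +> \<phi> q"
    unfolding coset_eq by (auto intro!: exI[of _ 0])
  ultimately show ?thesis unfolding rcoset_mult_def by blast
qed

lemma A_Mod_comm_monoid: "comm_monoid (R A_Mod F n)"
  and carrier_A_Mod: "carrier (R A_Mod F n) = range (\<lambda>p. F n +> \<phi> p)"
proof -
  show car: "carrier (R A_Mod F n) = range (\<lambda>p. F n +> \<phi> p)"
    by (auto simp: A_FactGroup_def' A_RCOSETS_def' \<phi>_surj)
  have one: "\<one>\<^bsub>R A_Mod F n\<^esub> = F n +> \<phi> 0" by (simp add: A_FactGroup_def' coset_zero)
  show "comm_monoid (R A_Mod F n)"
    by (rule comm_monoidI) (auto simp: car one coset_add add_ac)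
qed

lemma finprod_coset:
  "finite S \<Longrightarrow> finprod (R A_Mod F n) (\<lambda>i. F n +> \<phi> (f i)) S = F n +> \<phi> (\<Sum>i\<in>S. f i)"
proof (induction S rule: finite_induct)
  interpret M: comm_monoid "R A_Mod F n" by (rule A_Mod_comm_monoid)
  case empty
  show ?case by (simp add: coset_zero) (simp add: A_FactGroup_def')
next
  interpret M: comm_monoid "R A_Mod F n" by (rule A_Mod_comm_monoid)
  case (insert i S)
  have "finprod (R A_Mod F n) (\<lambda>i. F n +> \<phi> (f i)) (insert i S)
      = (F n +> \<phi> (f i)) \<otimes>\<^bsub>R A_Mod F n\<^esub> finprod (R A_Mod F n) (\<lambda>i. F n +> \<phi> (f i)) S"
    by (rule M.finprod_insert) (use insert in \<open>auto simp: carrier_A_Mod\<close>)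
  then show ?case using insert by (simp add: coset_add)
qed

text \<open>Every homogeneous component is kept, each in its own degree, and not only the lowest
  one; this makes the map additive and multiplicative.\<close>

definition leading :: "int poly2 \<Rightarrow> nat \<Rightarrow> 'r set" where
  "leading p = (\<lambda>n. F (Suc n) +> \<phi> (homog_part n p))"

lemma leading_mem: "leading p \<in> carrier gr"
proof -
  have "leading p n \<in> (\<lambda>a. F (Suc n) +> a) ` F n" for n
    using homogeneous_order_ge[OF homog_part_homogeneous] by (auto simp: leading_def F_eq)
  moreover have "{n. leading p n \<noteq> F (Suc n)} \<subseteq> {n. homog_part n p \<noteq> 0}"
    using coset_zero by (auto simp: leading_def)
  ultimately show ?thesis
    using finite_subset[OF _ finite_homog_part] by (simp add: assoc_graded_def)
qed

lemma leading_add: "leading p \<oplus>\<^bsub>gr\<^esub> leading q = leading (p + q)"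
  by (simp add: assoc_graded_def leading_def coset_add homog_part_add)

lemma leading_zero: "leading 0 = \<zero>\<^bsub>gr\<^esub>"
  by (simp add: assoc_graded_def leading_def coset_zero)

lemma leading_one: "leading 1 = \<one>\<^bsub>gr\<^esub>"
  by (auto simp: assoc_graded_def leading_def homog_part_1 coset_zero \<phi>_one fun_eq_iff)

lemma leading_mult: "leading p \<otimes>\<^bsub>gr\<^esub> leading q = leading (p * q)"
proof
  fix n
  interpret M: comm_monoid "R A_Mod F (Suc n)" by (rule A_Mod_comm_monoid)
  have "(leading p \<otimes>\<^bsub>gr\<^esub> leading q) n
      = finprod (R A_Mod F (Suc n)) (\<lambda>i. rcoset_mult R (F (Suc n)) (leading p i) (leading q (n - i))) {..n}"
    by (simp add: assoc_graded_def)
  also have "\<dots> = finprod (R A_Mod F (Suc n)) (\<lambda>i. F (Suc n) +> \<phi> (homog_part i p * homog_part (n - i) q)) {..n}"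
  proof (rule M.finprod_cong')
    fix i assume "i \<in> {..n}"
    then show "rcoset_mult R (F (Suc n)) (leading p i) (leading q (n - i))
        = F (Suc n) +> \<phi> (homog_part i p * homog_part (n - i) q)"
      unfolding leading_def
      by (intro coset_mult homogeneous_order_ge homog_part_homogeneous) simp
  qed (auto simp: carrier_A_Mod)
  also have "\<dots> = leading (p * q) n"
    by (simp add: finprod_coset homog_part_mult leading_def)
  finally show "(leading p \<otimes>\<^bsub>gr\<^esub> leading q) n = leading (p * q) n" .
qed

text \<open>A representative of order at least n may be replaced by its part of degree n, and
  finitely many such parts are summed. The second conclusion is what makes homogeneous elements lift
  to homogeneous polynomials.\<close>

lemma leading_surj:
  assumes u: "u \<in> carrier gr"
  obtains p where "u = leading p" "\<And>m. u m = F (Suc m) \<Longrightarrow> homog_part m p = 0"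
proof -
  have "\<forall>n. \<exists>p\<in>order_ge n. u n = F (Suc n) +> \<phi> p" using u by (force simp: assoc_graded_def F_eq)
  then obtain p where p: "\<And>n. p n \<in> order_ge n" "\<And>n. u n = F (Suc n) +> \<phi> (p n)" by metis
  define N where "N = {n. u n \<noteq> F (Suc n)}"
  have fin: "finite N" using u by (simp add: assoc_graded_def N_def)
  define q where "q = (\<Sum>n\<in>N. homog_part n (p n))"
  have sum: "homog_part m (sum f S) = (\<Sum>n\<in>S. homog_part m (f n))" for m S and f :: "nat \<Rightarrow> int poly2"
    by (induction S rule: infinite_finite_induct) (simp_all add: homog_part_add)
  have hq: "homog_part m q = (if m \<in> N then homog_part m (p m) else 0)" for m
  proof -
    have "homog_part m q = (\<Sum>n\<in>N. if n = m then homog_part m (p m) else 0)"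
      unfolding q_def sum
      by (intro sum.cong refl) (simp add: homog_part_homogeneous_eq[OF homog_part_homogeneous])
    then show ?thesis using fin by simp
  qed
  have "u m = leading q m" for m
  proof (cases "m \<in> N")
    case True
    have "u m = F (Suc m) +> \<phi> (homog_part m (p m))"
      unfolding p(2) by (rule coset_cong[OF homog_part_diff_order_ge[OF p(1)]])
    then show ?thesis using True by (simp add: leading_def hq)
  next
    case False
    then show ?thesis by (simp add: leading_def hq coset_zero) (simp add: N_def)
  qed
  then have "u = leading q" by blast
  moreover have "homog_part m q = 0" if "u m = F (Suc m)" for m using that by (simp add: hq N_def)
  ultimately show thesis by (rule that)
qed

lemma leading_image: "leading ` UNIV = carrier gr"
proof
  show "carrier gr \<subseteq> range leading"
  proof
    fix u assume "u \<in> carrier gr"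
    then obtain p where "u = leading p" using leading_surj by blast
    then show "u \<in> range leading" by blast
  qed
qed (use leading_mem in blast)

lemma leading_ring_hom: "leading \<in> Ring.ring_hom class_ring gr"
  by (rule ring_hom_memI) (auto simp: leading_mem leading_add leading_mult leading_one)

text \<open>The ring axioms are inherited from the polynomial ring through the surjection
  \<open>leading\<close>.\<close>

lemma ring_gr: "ring gr"
proof -
  have "ring (gr \<lparr> carrier := leading ` carrier class_ring, zero := leading \<zero>\<^bsub>class_ring\<^esub> \<rparr>)"
    by (rule ring.ring_hom_imp_img_ring[OF ring_class_ring leading_ring_hom])
  also have "gr \<lparr> carrier := leading ` carrier class_ring, zero := leading \<zero>\<^bsub>class_ring\<^esub> \<rparr> = gr"
    using leading_image leading_zero by simp
  finally show ?thesis .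
qed

lemma leading_ring_hom_ring: "ring_hom_ring class_ring gr leading"
  by (rule ring_hom_ringI2[OF ring_class_ring ring_gr leading_ring_hom])

lemma leading_part: "assoc_graded_part R F n = leading ` homogeneous n"
proof
  show "leading ` homogeneous n \<subseteq> assoc_graded_part R F n"
    by (auto simp: assoc_graded_part_def leading_mem)
       (auto simp: leading_def homog_part_homogeneous_eq coset_zero)
  show "assoc_graded_part R F n \<subseteq> leading ` homogeneous n"
  proof
    fix u assume u: "u \<in> assoc_graded_part R F n"
    then obtain p where p: "u = leading p" "\<And>m. u m = F (Suc m) \<Longrightarrow> homog_part m p = 0"
      using leading_surj unfolding assoc_graded_part_def by blast
    have "Poly_Mapping.lookup p k = 0" if "fst k + snd k \<noteq> n" for k
    proof -
      have "homog_part (fst k + snd k) p = 0" using p(2) u that unfolding assoc_graded_part_def by blast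
      then show ?thesis using lookup_homog_part[of "fst k + snd k" p k] by simp
    qed
    then have "p \<in> homogeneous n" by (auto simp: homogeneous_def in_keys_iff) force
    then show "u \<in> leading ` homogeneous n" using p(1) by blast
  qed
qed

lemma leading_kernel: "leading p = \<zero>\<^bsub>gr\<^esub> \<longleftrightarrow> (\<forall>n. \<phi> (homog_part n p) \<in> F (Suc n))"
proof -
  have "leading p = \<zero>\<^bsub>gr\<^esub> \<longleftrightarrow> (\<forall>n. F (Suc n) +> \<phi> (homog_part n p) = F (Suc n) +> \<phi> 0)"
    by (auto simp: leading_def coset_zero assoc_graded_def fun_eq_iff)
  then show ?thesis unfolding coset_eq_iff by simp
qed

end

text \<open>A form lies in the kernel when it agrees on the points with a polynomial of higher
  order. For the relations such polynomials are exhibited in \<open>C4_relations_leading\<close>;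
  conversely \<open>leading_form_mem_ideal\<close> applies to each homogeneous part.\<close>

lemma C4_leading_kernel:
  assumes "poly2_filtered_ring R \<phi> F"
    and \<phi>: "\<And>p q. \<phi> p = \<phi> q \<longleftrightarrow> (\<forall>u\<in>C4_values. \<forall>v\<in>C4_values. poly2_eval u v p = poly2_eval u v q)"
  shows "a_kernel class_ring (assoc_graded R F) (poly2_filtered_ring.leading R \<phi> F) = Idl\<^bsub>class_ring\<^esub> C4_relations"
proof -
  interpret poly2_filtered_ring R \<phi> F by fact
  interpret h: ring_hom_ring class_ring gr leading by (rule leading_ring_hom_ring)
  have ker: "a_kernel class_ring gr leading = {p. leading p = \<zero>\<^bsub>gr\<^esub>}"
    unfolding a_kernel_def' by auto
  show ?thesis
  proof
    show "Idl\<^bsub>class_ring\<^esub> C4_relations \<subseteq> a_kernel class_ring gr leading"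
    proof (rule genideal_class_ring_minimal[OF h.kernel_is_ideal], rule subsetI)
      fix r assume "r \<in> C4_relations"
      then obtain n P where P: "r \<in> homogeneous n" "P \<in> order_ge (Suc n)"
        "\<And>u v. u \<in> C4_values \<Longrightarrow> v \<in> C4_values \<Longrightarrow> poly2_eval u v r = poly2_eval u v P"
        using C4_relations_leading by blast
      then have "\<phi> r = \<phi> P" using \<phi> by blast
      then have "\<phi> r \<in> F (Suc n)" using P(2) by (simp add: F_eq)
      moreover have "\<phi> 0 \<in> F m" for m by (simp add: F_eq)
      ultimately show "r \<in> a_kernel class_ring gr leading"
        by (simp add: ker leading_kernel homog_part_homogeneous_eq[OF P(1)])
    qed
    show "a_kernel class_ring gr leading \<subseteq> Idl\<^bsub>class_ring\<^esub> C4_relations"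
    proof
      fix p assume "p \<in> a_kernel class_ring gr leading"
      then have p: "\<phi> (homog_part n p) \<in> F (Suc n)" for n by (simp add: ker leading_kernel)
      have mem: "homog_part n p \<in> Idl\<^bsub>class_ring\<^esub> C4_relations" for n
      proof -
        obtain P where "P \<in> order_ge (Suc n)" "\<phi> (homog_part n p) = \<phi> P" using p by (auto simp: F_eq)
        then show ?thesis
          using leading_form_mem_ideal[OF ideal_genideal_class_ring genideal_class_ring_subset
              homog_part_homogeneous] \<phi> by blast
      qed
      obtain N where "\<And>k. k \<in> Poly_Mapping.keys p \<Longrightarrow> fst k + snd k \<le> N"
        using finite_imageI[OF finite_keys, of "\<lambda>k. fst k + snd k" p] by (auto simp: finite_nat_set_iff_bounded_le)
      then have eq: "p = (\<Sum>n\<le>N. homog_part n p)" by (rule sum_homog_part)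
      show "p \<in> Idl\<^bsub>class_ring\<^esub> C4_relations"
        by (rule ssubst[OF eq]) (rule class_ring_ideal_sum[OF ideal_genideal_class_ring mem])
    qed
  qed
qed

section \<open>Reduction modulo 2\<close>

definition frag_sum :: "('k \<Rightarrow> 'b::comm_ring_1) \<Rightarrow> ('k \<Rightarrow>\<^sub>0 int) \<Rightarrow> 'b" where
  "frag_sum w c = (\<Sum>k\<in>Poly_Mapping.keys c. of_int (Poly_Mapping.lookup c k) * w k)"

lemma frag_sum_superset:
  assumes "finite K" "Poly_Mapping.keys c \<subseteq> K"
  shows "frag_sum w c = (\<Sum>k\<in>K. of_int (Poly_Mapping.lookup c k) * w k)"
  unfolding frag_sum_def by (rule sum.mono_neutral_left) (use assms in \<open>auto simp: in_keys_iff\<close>)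

lemma frag_sum_of [simp]: "frag_sum w (frag_of k) = w k"
  by (subst frag_sum_superset[of "{k}"]) (auto simp: keys_frag_of)

lemma frag_sum_0 [simp]: "frag_sum w 0 = 0"
  by (simp add: frag_sum_def)

lemma frag_sum_add: "frag_sum w (c + d) = frag_sum w c + frag_sum w d"
proof -
  let ?K = "Poly_Mapping.keys c \<union> Poly_Mapping.keys d"
  have "Poly_Mapping.keys (c + d) \<subseteq> ?K" by (rule keys_add)
  then show ?thesis
    by (simp add: frag_sum_superset[of ?K] lookup_add distrib_right sum.distrib)
qed

lemma frag_sum_diff: "frag_sum w (c - d) = frag_sum w c - frag_sum w d"
  using frag_sum_add[of w "c - d" d] by simp

section \<open>The ring of formal pairs\<close>

lemma pair_ring_simps [simp]:
  "carrier (pair_ring A B) = {c. Poly_Mapping.keys c \<subseteq> carrier A \<times> carrier B}"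
  "\<one>\<^bsub>pair_ring A B\<^esub> = frag_of (\<one>\<^bsub>A\<^esub>, \<one>\<^bsub>B\<^esub>)" "\<zero>\<^bsub>pair_ring A B\<^esub> = 0" "c \<oplus>\<^bsub>pair_ring A B\<^esub> d = c + d"
  by (auto simp: pair_ring_def)

lemma pair_mult_of [simp]:
  "frag_of (a, b) \<otimes>\<^bsub>pair_ring A B\<^esub> frag_of (a', b') = frag_of (a \<otimes>\<^bsub>A\<^esub> a', b \<otimes>\<^bsub>B\<^esub> b')"
  by (simp add: pair_ring_def)

lemma pair_mult_0 [simp]: "0 \<otimes>\<^bsub>pair_ring A B\<^esub> d = 0" "c \<otimes>\<^bsub>pair_ring A B\<^esub> 0 = 0"
  by (auto simp: pair_ring_def frag_extend_eq_0)

lemma pair_mult_diff_left: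
  "(c - c') \<otimes>\<^bsub>pair_ring A B\<^esub> d = c \<otimes>\<^bsub>pair_ring A B\<^esub> d - c' \<otimes>\<^bsub>pair_ring A B\<^esub> d"
  by (simp add: pair_ring_def frag_extend_diff)

lemma pair_mult_diff_right:
  "c \<otimes>\<^bsub>pair_ring A B\<^esub> (d - d') = c \<otimes>\<^bsub>pair_ring A B\<^esub> d - c \<otimes>\<^bsub>pair_ring A B\<^esub> d'"
proof -
  have "Poly_Mapping.keys c \<subseteq> UNIV" by simp
  then show ?thesis
  proof (induction c rule: frag_induction)
    case (one x)
    then show ?case by (cases x) (simp add: pair_ring_def frag_extend_diff)
  next
    case (diff a b)
    then show ?case by (simp add: pair_mult_diff_left)
  qed simp
qed

lemma keys_diff_subset:
  "Poly_Mapping.keys (c :: 'k \<Rightarrow>\<^sub>0 int) \<subseteq> S \<Longrightarrow> Poly_Mapping.keys d \<subseteq> S \<Longrightarrow> Poly_Mapping.keys (c - d) \<subseteq> S"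
  using keys_diff[of c d] by blast

lemma pair_mult_closed:
  assumes "ring A" "ring B" and c: "Poly_Mapping.keys c \<subseteq> carrier A \<times> carrier B"
    and d: "Poly_Mapping.keys d \<subseteq> carrier A \<times> carrier B"
  shows "Poly_Mapping.keys (c \<otimes>\<^bsub>pair_ring A B\<^esub> d) \<subseteq> carrier A \<times> carrier B"
proof -
  interpret A: ring A by fact
  interpret B: ring B by fact
  show ?thesis
    using c
  proof (induction c rule: frag_induction)
    case (one x)
    show ?case
      using d
    proof (induction d rule: frag_induction)
      case (one y)
      then show ?case using \<open>x \<in> carrier A \<times> carrier B\<close> by (cases x; cases y) (simp add: keys_frag_of)
    qed (simp_all add: pair_mult_diff_right keys_diff_subset)
  qed (simp_all add: pair_mult_diff_left keys_diff_subset)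
qed

lemma pair_ring_is_ring:
  assumes "ring A" "ring B"
  shows "ring (pair_ring A B)"
proof -
  interpret A: ring A by fact
  interpret B: ring B by fact
  let ?P = "pair_ring A B"
  let ?C = "carrier A \<times> carrier B"
  \<comment> \<open>\<open>frag_induction\<close> and the bilinearity rules speak of differences, so
    sums are turned into differences first.\<close>
  have sub_neg: "c + d = c - (0 - d)" for c d :: "'x \<Rightarrow>\<^sub>0 int" by simp
  have distl: "(c + d) \<otimes>\<^bsub>?P\<^esub> e = c \<otimes>\<^bsub>?P\<^esub> e + d \<otimes>\<^bsub>?P\<^esub> e" for c d e
    unfolding sub_neg[of c d] by (simp only: pair_mult_diff_left pair_mult_0) simp
  have distr: "e \<otimes>\<^bsub>?P\<^esub> (c + d) = e \<otimes>\<^bsub>?P\<^esub> c + e \<otimes>\<^bsub>?P\<^esub> d" for c d e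
    unfolding sub_neg[of c d] by (simp only: pair_mult_diff_right pair_mult_0) simp
  have assoc: "c \<otimes>\<^bsub>?P\<^esub> d \<otimes>\<^bsub>?P\<^esub> e = c \<otimes>\<^bsub>?P\<^esub> (d \<otimes>\<^bsub>?P\<^esub> e)"
    if "Poly_Mapping.keys c \<subseteq> ?C" "Poly_Mapping.keys d \<subseteq> ?C" "Poly_Mapping.keys e \<subseteq> ?C" for c d e
    using that(1)
  proof (induction c rule: frag_induction)
    case (one x)
    note x = one
    show ?case
      using that(2)
    proof (induction d rule: frag_induction)
      case (one y)
      note y = one
      show ?case
        using that(3)
      proof (induction e rule: frag_induction)
        case (one z)
        then show ?case using x y by (cases x; cases y; cases z) (simp add: A.m_assoc B.m_assoc)
      qed (simp_all add: pair_mult_diff_right)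
    qed (simp_all add: pair_mult_diff_left pair_mult_diff_right)
  qed (simp_all add: pair_mult_diff_left)
  have one: "\<one>\<^bsub>?P\<^esub> \<otimes>\<^bsub>?P\<^esub> c = c" "c \<otimes>\<^bsub>?P\<^esub> \<one>\<^bsub>?P\<^esub> = c" if "Poly_Mapping.keys c \<subseteq> ?C" for c
  proof -
    show "\<one>\<^bsub>?P\<^esub> \<otimes>\<^bsub>?P\<^esub> c = c"
      using that
    proof (induction c rule: frag_induction)
      case (one x)
      then show ?case by (cases x) simp
    qed (simp_all add: pair_mult_diff_right)
    show "c \<otimes>\<^bsub>?P\<^esub> \<one>\<^bsub>?P\<^esub> = c"
      using that
    proof (induction c rule: frag_induction)
      case (one x)
      then show ?case by (cases x) simp
    qed (simp_all add: pair_mult_diff_left)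
  qed
  show ?thesis
  proof (rule ringI)
    show "abelian_group ?P"
    proof (rule abelian_groupI)
      fix c d assume "c \<in> carrier ?P" "d \<in> carrier ?P"
      then show "c \<oplus>\<^bsub>?P\<^esub> d \<in> carrier ?P" using keys_add[of c d] by auto
    next
      fix c assume "c \<in> carrier ?P"
      then show "\<exists>d\<in>carrier ?P. d \<oplus>\<^bsub>?P\<^esub> c = \<zero>\<^bsub>?P\<^esub>" by (intro bexI[of _ "- c"]) auto
    qed (simp_all add: add_ac)
    show "monoid ?P"
      by (rule monoidI)
         (use pair_mult_closed[OF assms] assoc one in \<open>simp_all add: keys_frag_of\<close>)
  qed (simp_all add: distl distr)
qed

section \<open>Reduction of coefficients modulo 2\<close>

lemma bit_poly2_double: "p + p = (0 :: bit poly2)"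
proof (rule poly_mapping_eqI)
  fix k
  show "Poly_Mapping.lookup (p + p) k = Poly_Mapping.lookup 0 k"
    unfolding lookup_add by (cases "Poly_Mapping.lookup p k") simp_all
qed

definition reduce2 :: "int poly2 \<Rightarrow> bit poly2" where
  "reduce2 = poly2_eval var_x var_y"

lemma lookup_reduce2: "Poly_Mapping.lookup (reduce2 p) k = of_int (Poly_Mapping.lookup p k)"
proof (induction p rule: poly_mapping_add_induct)
  case (single l c)
  have of_int: "(of_int c :: bit poly2) = Poly_Mapping.single 0 (of_int c)" for c
    by (rule single_of_int[symmetric])
  have "reduce2 (Poly_Mapping.single l c) = Poly_Mapping.single l (of_int c)"
    unfolding reduce2_def poly2_eval_single var_power_mult of_int
    by (simp only: mult_single add_0 mult_1_right prod.collapse)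
  then show ?case by (simp add: lookup_single when_def)
qed (simp add: reduce2_def poly2_eval_add lookup_add)

lemma reduce2_surj:
  obtains p where "reduce2 p = f" "\<And>n. f \<in> homogeneous n \<Longrightarrow> p \<in> homogeneous n"
proof -
  define p :: "int poly2" where "p = (\<Sum>k\<in>Poly_Mapping.keys f. Poly_Mapping.single k 1)"
  have p: "Poly_Mapping.lookup p k = (if k \<in> Poly_Mapping.keys f then 1 else 0)" for k
    by (simp add: p_def lookup_sum lookup_single when_def)
  have "reduce2 p = f"
  proof (rule poly_mapping_eqI)
    fix k
    show "Poly_Mapping.lookup (reduce2 p) k = Poly_Mapping.lookup f k"
      by (cases "Poly_Mapping.lookup f k") (simp_all add: lookup_reduce2 p in_keys_iff)
  qed
  moreover have "p \<in> homogeneous n" if "f \<in> homogeneous n" for n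
    using that by (auto simp: homogeneous_def in_keys_iff p split: if_splits)
  ultimately show thesis by (rule that)
qed

lemma reduce2_homogeneous: "p \<in> homogeneous n \<Longrightarrow> reduce2 p \<in> homogeneous n"
  unfolding homogeneous_def by (auto simp: in_keys_iff lookup_reduce2)

lemma of_int_bit_eq_0:
  assumes "(of_int n :: bit) = 0"
  shows "even n"
proof (rule ccontr)
  assume "odd n"
  then obtain k where "n = k + k + 1" by (metis mult_2 oddE)
  then have "(of_int n :: bit) = of_int k + of_int k + 1" by (simp only: of_int_add of_int_1)
  also have "\<dots> = 1" by (cases "of_int k :: bit") simp_all
  finally show False using assms by simp
qed

text \<open>The quotient by 2 is given as a sum q + q because biadditivity relations act on
  sums.\<close>

lemma reduce2_eq_0:
  assumes "reduce2 p = 0"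
  obtains q where "p = q + q"
proof -
  have even: "even (Poly_Mapping.lookup p k)" for k
  proof -
    have "(of_int (Poly_Mapping.lookup p k) :: bit) = 0" using assms lookup_reduce2[of p k] by simp
    then show ?thesis by (rule of_int_bit_eq_0)
  qed
  define q :: "int poly2" where
    "q = (\<Sum>k\<in>Poly_Mapping.keys p. Poly_Mapping.single k (Poly_Mapping.lookup p k div 2))"
  have q: "Poly_Mapping.lookup q k = Poly_Mapping.lookup p k div 2" for k
    by (auto simp: q_def lookup_sum lookup_single when_def in_keys_iff)
  have "p = q + q"
  proof (rule poly_mapping_eqI)
    fix k
    show "Poly_Mapping.lookup p k = Poly_Mapping.lookup (q + q) k"
      using even[of k] unfolding lookup_add q by presburger
  qed
  then show thesis by (rule that)
qed

definition C4_relations2 :: "bit poly2 set" where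
  "C4_relations2 = {var_x ^ 4 * var_y ^ 2 + var_x ^ 2 * var_y ^ 4}"

lemma reduce2_relation:
  "reduce2 (var_x ^ 4 * var_y ^ 2 - var_x ^ 2 * var_y ^ 4) = var_x ^ 4 * var_y ^ 2 + var_x ^ 2 * var_y ^ 4"
proof -
  have "a - b = a + b" for a b :: "bit poly2"
  proof -
    have "a - b + (b + b) = a + b" by (simp only: add.assoc[symmetric] diff_add_cancel)
    then show ?thesis by (simp only: bit_poly2_double add_0_right)
  qed
  then show ?thesis by (simp add: reduce2_def poly2_eval_simps)
qed

lemma reduce2_ideal:
  assumes "p \<in> Idl\<^bsub>class_ring\<^esub> C4_relations"
  shows "reduce2 p \<in> Idl\<^bsub>class_ring\<^esub> C4_relations2"
proof -
  let ?J = "Idl\<^bsub>class_ring\<^esub> C4_relations2"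
  note I = class_ring_idealD[OF ideal_genideal_class_ring[of C4_relations2]]
  have "ideal {p. reduce2 p \<in> ?J} class_ring"
    by (rule class_ring_idealI) (simp_all add: reduce2_def poly2_eval_simps I)
  moreover have "C4_relations \<subseteq> {p. reduce2 p \<in> ?J}"
  proof -
    have two: "2 = (0 :: bit poly2)" using bit_poly2_double[of 1] by simp
    have "(4 :: bit poly2) = 2 + 2" by simp
    then have four: "4 = (0 :: bit poly2)" by (simp only: two add_0)
    show ?thesis
      using genideal_class_ring_subset[of C4_relations2] reduce2_relation I(1)
      by (auto simp: C4_relations_def C4_relations2_def) (simp_all add: reduce2_def poly2_eval_simps two four)
  qed
  ultimately show ?thesis using genideal_class_ring_minimal assms by blast
qed

text \<open>The ideal over F_2 is principal, generated by the reduction of the fourth integral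
  relation. Lifting the cofactor to Z[x,y] and subtracting leaves a polynomial that vanishes modulo
  2.\<close>

lemma reduce2_ideal_lift:
  assumes "reduce2 p \<in> Idl\<^bsub>class_ring\<^esub> C4_relations2"
  obtains q r where "p = (q + q) + r" "r \<in> Idl\<^bsub>class_ring\<^esub> C4_relations"
proof -
  let ?r = "var_x ^ 4 * var_y ^ 2 - var_x ^ 2 * var_y ^ 4 :: int poly2"
  have "ideal (range (\<lambda>s. s * reduce2 ?r)) class_ring"
  proof (rule class_ring_idealI)
    show "0 \<in> range (\<lambda>s. s * reduce2 ?r)" by (rule range_eqI[of _ _ 0]) simp
  next
    fix a b assume "a \<in> range (\<lambda>s. s * reduce2 ?r)" "b \<in> range (\<lambda>s. s * reduce2 ?r)"
    then obtain s t where "a = s * reduce2 ?r" "b = t * reduce2 ?r" by blast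
    then show "a + b \<in> range (\<lambda>s. s * reduce2 ?r)" by (intro range_eqI[of _ _ "s + t"]) (simp add: distrib_right)
  next
    fix a b assume "a \<in> range (\<lambda>s. s * reduce2 ?r)"
    then obtain s where "a = s * reduce2 ?r" by blast
    then show "b * a \<in> range (\<lambda>s. s * reduce2 ?r)" by (intro range_eqI[of _ _ "b * s"]) (simp add: mult.assoc)
  qed
  moreover have "C4_relations2 \<subseteq> range (\<lambda>s. s * reduce2 ?r)"
    unfolding C4_relations2_def reduce2_relation by (auto intro!: range_eqI[of _ _ 1])
  ultimately obtain s where s: "reduce2 p = s * reduce2 ?r"
    using genideal_class_ring_minimal assms by blast
  obtain s' where s': "reduce2 s' = s" using reduce2_surj by blast
  have "reduce2 (p - s' * ?r) = 0" using s s' by (simp add: reduce2_def poly2_eval_simps)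
  then obtain q where "p - s' * ?r = q + q" using reduce2_eq_0 by blast
  then have "p = (q + q) + s' * ?r" by (simp add: algebra_simps)
  moreover have "?r \<in> Idl\<^bsub>class_ring\<^esub> C4_relations"
    using genideal_class_ring_subset[of C4_relations] by (auto simp: C4_relations_def)
  ultimately show thesis
    using that class_ring_idealD(3)[OF ideal_genideal_class_ring] by blast
qed

text \<open>The map sends a formal pair (a, b) to b times the reduction of any lift of a. It kills
  the biadditivity relations. For the kernel, every element is brought to the form (h p, 1); if p
  reduces into the ideal over F_2, then p is a double plus an element of the integral ideal, and a
  double tensor 1 vanishes.\<close>

lemma tensor_bit_graded_isomorphic:
  fixes A :: "('a, 'm) ring_scheme"
  assumes h: "ring_hom_ring class_ring A h" and surj: "range h = carrier A"
    and ker: "a_kernel class_ring A h = Idl\<^bsub>class_ring\<^esub> C4_relations"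
    and dA: "\<And>n. dA n = h ` homogeneous n"
  shows "graded_isomorphic (tensor_ring A (class_ring :: bit ring)) (tensor_part A dA (class_ring :: bit ring))
    (poly2_quot C4_relations2) (poly2_quot_part C4_relations2)"
proof -
  interpret h: ring_hom_ring class_ring A h by (rule h)
  let ?B = "class_ring :: bit ring"
  let ?P = "pair_ring A ?B"
  let ?J = "Idl\<^bsub>class_ring\<^esub> C4_relations" and ?J2 = "Idl\<^bsub>class_ring\<^esub> C4_relations2"
  let ?rel = "tensor_relations A ?B"
  let ?I = "Idl\<^bsub>?P\<^esub> ?rel"
  let ?T = "poly2_quot C4_relations2"
  have ringA: "ring A" by (rule h.S.ring_axioms)
  have ringP: "ring ?P" by (rule pair_ring_is_ring[OF ringA ring_class_ring])
  note J = class_ring_idealD[OF ideal_genideal_class_ring[of C4_relations]]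
  note J2 = class_ring_idealD[OF ideal_genideal_class_ring[of C4_relations2]]
  have J2_right: "p * q \<in> ?J2" if "p \<in> ?J2" for p q using J2(3)[OF that, of q] by (simp only: mult.commute)
  interpret J2: ideal ?J2 "class_ring :: bit poly2 ring" by (rule ideal_genideal_class_ring)
  have hc: "h p \<in> carrier A" for p using surj by blast
  have h_add: "h (p + q) = h p \<oplus>\<^bsub>A\<^esub> h q" for p q using h.hom_add[of p q] by simp
  have h_mult: "h (p * q) = h p \<otimes>\<^bsub>A\<^esub> h q" for p q using h.hom_mult[of p q] by simp
  have h_one: "h 1 = \<one>\<^bsub>A\<^esub>" using h.hom_one by simp
  have h_zero: "h 0 = \<zero>\<^bsub>A\<^esub>" using h.hom_zero by simp
  have h_eq: "p - q \<in> ?J \<longleftrightarrow> h p = h q" for p q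
  proof -
    have "p - q \<in> ?J \<longleftrightarrow> h (p - q) = \<zero>\<^bsub>A\<^esub>" unfolding ker[symmetric] a_kernel_def' by simp
    moreover have "h p = h (p - q) \<oplus>\<^bsub>A\<^esub> h q" using h_add[of "p - q" q] by simp
    moreover have "h (p - q) = h p \<oplus>\<^bsub>A\<^esub> h (- q)" using h_add[of p "- q"] by simp
    moreover have "h q \<oplus>\<^bsub>A\<^esub> h (- q) = \<zero>\<^bsub>A\<^esub>" using h_add[of q "- q"] h_zero by simp
    ultimately show ?thesis using h.S.l_zero[OF hc] by metis
  qed
  \<comment> \<open>The lifts are arbitrary and neither additive nor multiplicative. Two lifts of
    one element differ by the integral ideal, so everything below holds modulo its image over
    F_2.\<close>
  define lift where "lift a = (SOME p. h p = a)" for a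
  have lift: "h (lift a) = a" if "a \<in> carrier A" for a
  proof -
    have "a \<in> range h" using that surj by simp
    then have "\<exists>p. h p = a" by blast
    then show ?thesis unfolding lift_def by (rule someI_ex)
  qed
  have red_lift: "reduce2 (lift (h p)) - reduce2 p \<in> ?J2" for p
  proof -
    have "lift (h p) - p \<in> ?J" using lift[OF hc] h_eq by blast
    from reduce2_ideal[OF this] show ?thesis by (simp add: reduce2_def poly2_eval_simps)
  qed
  define w :: "'a \<times> bit \<Rightarrow> bit poly2" where "w = (\<lambda>(a, b). Poly_Mapping.single 0 b * reduce2 (lift a))"
  have w0: "w (a, 0) = 0" and w1: "w (a, 1) = reduce2 (lift a)" for a by (simp_all add: w_def)
  have w_h: "w (h p, b) - Poly_Mapping.single 0 b * reduce2 p \<in> ?J2" for p b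
    using J2(3)[OF red_lift[of p], of "Poly_Mapping.single 0 b"] by (simp add: w_def right_diff_distrib)
  have hA: "\<exists>p. a = h p" if "a \<in> carrier A" for a using lift[OF that] by metis
  have mult: "frag_sum w (c \<otimes>\<^bsub>?P\<^esub> d) - frag_sum w c * frag_sum w d \<in> ?J2"
    if "c \<in> carrier ?P" "d \<in> carrier ?P" for c d
  proof -
    have c: "Poly_Mapping.keys c \<subseteq> carrier A \<times> carrier ?B" and d: "Poly_Mapping.keys d \<subseteq> carrier A \<times> carrier ?B"
      using that by simp_all
    show ?thesis
      using c
    proof (induction c rule: frag_induction)
      case (one x)
      note x = one
      show ?case
        using d
      proof (induction d rule: frag_induction)
        case (one y)
        obtain p b where xp: "x = (h p, b)" using x hA by (cases x) auto
        obtain q b' where yq: "y = (h q, b')" using one hA by (cases y) auto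
        have f1: "frag_sum w (frag_of x \<otimes>\<^bsub>?P\<^esub> frag_of y) - frag_sum w (frag_of x) * frag_sum w (frag_of y)
          = w (h (p * q), b * b') - w (h p, b) * w (h q, b')"
          unfolding xp yq pair_mult_of frag_sum_of h_mult by simp
        \<comment> \<open>The product error is split into three errors of the form in
          \<open>w_h\<close>, each multiplied by a polynomial.\<close>
        have f2: "w (h (p * q), b * b') - w (h p, b) * w (h q, b')
          = (w (h (p * q), b * b') - Poly_Mapping.single 0 (b * b') * reduce2 (p * q))
            - (w (h p, b) - Poly_Mapping.single 0 b * reduce2 p) * w (h q, b')
            - Poly_Mapping.single 0 b * reduce2 p * (w (h q, b') - Poly_Mapping.single 0 b' * reduce2 q)"
        proof -
          have s: "Poly_Mapping.single 0 (b * b') = (Poly_Mapping.single 0 b * Poly_Mapping.single 0 b' :: bit poly2)"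
            by (simp add: mult_single)
          have "reduce2 (p * q) = reduce2 p * reduce2 q" by (simp add: reduce2_def poly2_eval_mult)
          then show ?thesis unfolding s by (simp only: algebra_simps)
        qed
        show ?case unfolding f1 f2 by (rule J2(5)[OF J2(5)[OF w_h J2_right[OF w_h]] J2(3)[OF w_h]])
      next
        case (diff a b)
        have "frag_sum w (frag_of x \<otimes>\<^bsub>?P\<^esub> (a - b)) - frag_sum w (frag_of x) * frag_sum w (a - b)
          = (frag_sum w (frag_of x \<otimes>\<^bsub>?P\<^esub> a) - frag_sum w (frag_of x) * frag_sum w a)
            - (frag_sum w (frag_of x \<otimes>\<^bsub>?P\<^esub> b) - frag_sum w (frag_of x) * frag_sum w b)"
          by (simp only: pair_mult_diff_right frag_sum_diff right_diff_distrib) (simp only: algebra_simps)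
        then show ?case using J2(5)[OF diff] by (simp only:)
      qed (use J2(1) in simp)
    next
      case (diff a b)
      have "frag_sum w ((a - b) \<otimes>\<^bsub>?P\<^esub> d) - frag_sum w (a - b) * frag_sum w d
        = (frag_sum w (a \<otimes>\<^bsub>?P\<^esub> d) - frag_sum w a * frag_sum w d)
          - (frag_sum w (b \<otimes>\<^bsub>?P\<^esub> d) - frag_sum w b * frag_sum w d)"
        by (simp only: pair_mult_diff_left frag_sum_diff left_diff_distrib) (simp only: algebra_simps)
      then show ?case using J2(5)[OF diff] by (simp only:)
    qed (use J2(1) in simp)
  qed
  have coset: "?J2 +>\<^bsub>class_ring\<^esub> p = ?J2 +>\<^bsub>class_ring\<^esub> q \<longleftrightarrow> p - q \<in> ?J2" for p q :: "bit poly2"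
  proof -
    have set: "?J2 +>\<^bsub>class_ring\<^esub> p = {e + p | e. e \<in> ?J2}" for p by (auto simp: a_r_coset_def')
    show ?thesis
    proof
      assume "?J2 +>\<^bsub>class_ring\<^esub> p = ?J2 +>\<^bsub>class_ring\<^esub> q"
      moreover have "p \<in> ?J2 +>\<^bsub>class_ring\<^esub> p" unfolding set using J2(1) by force
      ultimately show "p - q \<in> ?J2" unfolding set by auto
    next
      assume pq: "p - q \<in> ?J2"
      have "\<exists>f. e + p = f + q \<and> f \<in> ?J2" if "e \<in> ?J2" for e
        using J2(2)[OF that pq] by (intro exI[of _ "e + (p - q)"]) simp
      moreover have "\<exists>f. e + q = f + p \<and> f \<in> ?J2" if "e \<in> ?J2" for e
        using J2(5)[OF that pq] by (intro exI[of _ "e - (p - q)"]) simp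
      ultimately show "?J2 +>\<^bsub>class_ring\<^esub> p = ?J2 +>\<^bsub>class_ring\<^esub> q" unfolding set by blast
    qed
  qed
  define \<Psi> where "\<Psi> c = ?J2 +>\<^bsub>class_ring\<^esub> frag_sum w c" for c
  have T: "carrier ?T = range (\<lambda>p. ?J2 +>\<^bsub>class_ring\<^esub> p)" "\<one>\<^bsub>?T\<^esub> = ?J2 +>\<^bsub>class_ring\<^esub> 1" "\<zero>\<^bsub>?T\<^esub> = ?J2 +>\<^bsub>class_ring\<^esub> 0"
    and T_mult: "\<And>p q. (?J2 +>\<^bsub>class_ring\<^esub> p) \<otimes>\<^bsub>?T\<^esub> (?J2 +>\<^bsub>class_ring\<^esub> q) = ?J2 +>\<^bsub>class_ring\<^esub> (p * q)"
    and T_add: "\<And>p q. (?J2 +>\<^bsub>class_ring\<^esub> p) \<oplus>\<^bsub>?T\<^esub> (?J2 +>\<^bsub>class_ring\<^esub> q) = ?J2 +>\<^bsub>class_ring\<^esub> (p + q)"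
  proof -
    show "carrier ?T = range (\<lambda>p. ?J2 +>\<^bsub>class_ring\<^esub> p)"
      by (auto simp: poly2_quot_def FactRing_def A_RCOSETS_def')
    show "\<one>\<^bsub>?T\<^esub> = ?J2 +>\<^bsub>class_ring\<^esub> 1" by (simp add: poly2_quot_def FactRing_def)
    have "?J2 +>\<^bsub>class_ring\<^esub> 0 = ?J2" by (auto simp: a_r_coset_def')
    then show "\<zero>\<^bsub>?T\<^esub> = ?J2 +>\<^bsub>class_ring\<^esub> 0" by (simp add: poly2_quot_def FactRing_def)
    show "(?J2 +>\<^bsub>class_ring\<^esub> p) \<otimes>\<^bsub>?T\<^esub> (?J2 +>\<^bsub>class_ring\<^esub> q) = ?J2 +>\<^bsub>class_ring\<^esub> (p * q)" for p q
      using J2.rcoset_mult_add[of p q] by (simp add: poly2_quot_def FactRing_def)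
    show "(?J2 +>\<^bsub>class_ring\<^esub> p) \<oplus>\<^bsub>?T\<^esub> (?J2 +>\<^bsub>class_ring\<^esub> q) = ?J2 +>\<^bsub>class_ring\<^esub> (p + q)" for p q
      using J2.a_rcos_sum[of p q] by (simp add: poly2_quot_def FactRing_def)
  qed
  have ringT: "ring ?T" unfolding poly2_quot_def by (rule J2.quotient_is_ring)
  have \<Psi>_hom: "\<Psi> \<in> Ring.ring_hom ?P ?T"
  proof (rule ring_hom_memI)
    show "\<Psi> c \<in> carrier ?T" for c by (auto simp: \<Psi>_def T)
    show "\<Psi> (c \<otimes>\<^bsub>?P\<^esub> d) = \<Psi> c \<otimes>\<^bsub>?T\<^esub> \<Psi> d" if "c \<in> carrier ?P" "d \<in> carrier ?P" for c d
      unfolding \<Psi>_def T_mult coset by (rule mult[OF that])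
    show "\<Psi> (c \<oplus>\<^bsub>?P\<^esub> d) = \<Psi> c \<oplus>\<^bsub>?T\<^esub> \<Psi> d" if "c \<in> carrier ?P" "d \<in> carrier ?P" for c d
      unfolding \<Psi>_def T_add by (simp add: frag_sum_add)
    have "w (h 1, 1) - 1 \<in> ?J2" using w_h[of 1 1] by (simp add: reduce2_def)
    then show "\<Psi> \<one>\<^bsub>?P\<^esub> = \<one>\<^bsub>?T\<^esub>" unfolding \<Psi>_def T(2) coset by (simp add: h_one)
  qed
  then have \<Psi>: "ring_hom_ring ?P ?T \<Psi>" by (rule ring_hom_ringI2[OF ringP ringT])
  interpret \<Psi>: ring_hom_ring ?P ?T \<Psi> by (rule \<Psi>)
  have kernel: "a_kernel ?P ?T \<Psi> = {c \<in> carrier ?P. frag_sum w c \<in> ?J2}"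
    unfolding a_kernel_def' \<Psi>_def T(3) coset by simp
  have add_B: "b \<oplus>\<^bsub>?B\<^esub> b' = b + b'" and mem_B: "b \<in> carrier ?B" for b b' by simp_all
  have rel_cases: "(\<exists>a a' b. r = frag_of (a \<oplus>\<^bsub>A\<^esub> a', b) - frag_of (a, b) - frag_of (a', b)
        \<and> a \<in> carrier A \<and> a' \<in> carrier A)
      \<or> (\<exists>a b b'. r = frag_of (a, b + b') - frag_of (a, b) - frag_of (a, b') \<and> a \<in> carrier A)"
    if "r \<in> ?rel" for r
    using that unfolding tensor_relations_def add_B by blast
  have rel_carrier: "?rel \<subseteq> carrier ?P"
  proof
    fix r assume "r \<in> ?rel"
    moreover have "frag_of (a, b) - frag_of (a', b') - frag_of (a'', b'') \<in> carrier ?P"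
      if "a \<in> carrier A" "a' \<in> carrier A" "a'' \<in> carrier A" for a a' a'' b b' b''
      using that by (simp add: keys_diff_subset keys_frag_of)
    ultimately show "r \<in> carrier ?P" using rel_cases[of r] h.S.a_closed by metis
  qed
  have "?I \<subseteq> a_kernel ?P ?T \<Psi>"
  proof (rule ring.genideal_minimal[OF ringP \<Psi>.kernel_is_ideal], rule subsetI)
    fix r assume r: "r \<in> ?rel"
    from rel_cases[OF r] have "frag_sum w r \<in> ?J2"
    proof (elim disjE exE conjE)
      fix a a' b
      assume r: "r = frag_of (a \<oplus>\<^bsub>A\<^esub> a', b) - frag_of (a, b) - frag_of (a', b)"
        and a: "a \<in> carrier A" "a' \<in> carrier A"
      obtain p q where pq: "a = h p" "a' = h q" using hA a by metis
      let ?s = "Poly_Mapping.single 0 b :: bit poly2"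
      have "frag_sum w r = w (h (p + q), b) - w (h p, b) - w (h q, b)"
        by (simp only: r pq frag_sum_diff frag_sum_of h_add)
      also have "\<dots> = (w (h (p + q), b) - ?s * reduce2 (p + q)) - (w (h p, b) - ?s * reduce2 p)
          - (w (h q, b) - ?s * reduce2 q)"
        by (simp add: reduce2_def poly2_eval_add algebra_simps)
      also have "\<dots> \<in> ?J2" by (intro J2(5) w_h)
      finally show ?thesis .
    next
      fix a b b'
      assume r: "r = frag_of (a, b + b') - frag_of (a, b) - frag_of (a, b')"
      have "w (a, b + b') = w (a, b) + w (a, b')"
        by (simp only: w_def prod.case single_add distrib_right)
      then have "frag_sum w r = 0" by (simp only: r frag_sum_diff frag_sum_of) simp
      then show ?thesis using J2(1) by simp
    qed
    then show "r \<in> a_kernel ?P ?T \<Psi>" using r rel_carrier kernel by blast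
  qed
  moreover have "a_kernel ?P ?T \<Psi> \<subseteq> ?I"
  proof
    interpret I: ideal ?I ?P by (rule ring.genideal_ideal[OF ringP rel_carrier])
    have relI: "?rel \<subseteq> ?I" by (rule ring.genideal_self[OF ringP rel_carrier])
    have I_0: "0 \<in> ?I" using additive_subgroup.zero_closed[OF I.is_additive_subgroup] by simp
    have I_add: "c + d \<in> ?I" if "c \<in> ?I" "d \<in> ?I" for c d
      using additive_subgroup.a_closed[OF I.is_additive_subgroup that] by simp
    have I_carrier: "c \<in> carrier ?P" if "c \<in> ?I" for c by (rule I.Icarr[OF that])
    have I_neg: "- c \<in> ?I" if "c \<in> ?I" for c
    proof -
      have "\<ominus>\<^bsub>?P\<^esub> c = - c"
        using I_carrier[OF that] by (intro abelian_group.minus_equality[OF ring.is_abelian_group[OF ringP]]) auto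
      then show ?thesis using additive_subgroup.a_inv_closed[OF I.is_additive_subgroup that] by simp
    qed
    have I_diff: "c - d \<in> ?I" if "c \<in> ?I" "d \<in> ?I" for c d
      using I_add[OF that(1) I_neg[OF that(2)]] by simp
    have rel1: "frag_of (a \<oplus>\<^bsub>A\<^esub> a', b) - frag_of (a, b) - frag_of (a', b) \<in> ?I"
      if "a \<in> carrier A" "a' \<in> carrier A" for a a' b
      by (rule subsetD[OF relI]) (unfold tensor_relations_def, use that mem_B in blast)
    have rel2: "frag_of (a, b + b') - frag_of (a, b) - frag_of (a, b') \<in> ?I"
      if "a \<in> carrier A" for a and b b' :: bit
    proof (rule subsetD[OF relI])
      have "frag_of (a, b \<oplus>\<^bsub>?B\<^esub> b') - frag_of (a, b) - frag_of (a, b') \<in> ?rel"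
        unfolding tensor_relations_def using that mem_B by blast
      then show "frag_of (a, b + b') - frag_of (a, b) - frag_of (a, b') \<in> ?rel" by (simp only: add_B)
    qed
    \<comment> \<open>The relation for 0 + 0 = 0 in the second slot is the negative of this
      generator; likewise for the first slot below.\<close>
    have zero_right: "frag_of (a, 0) \<in> ?I" if "a \<in> carrier A" for a
      using I_neg[OF rel2[OF that, of 0 0]] by simp
    have zero_left: "frag_of (h 0, b) \<in> ?I" for b
      using I_neg[OF rel1[OF hc hc, of 0 0 b, folded h_add]] by simp
    \<comment> \<open>Modulo the relations, (q + q) tensor 1 is twice q tensor 1, hence q tensor (1
      + 1) = q tensor 0.\<close>
    have double: "frag_of (h (q + q), 1) \<in> ?I" for q
    proof -
      have "frag_of (h (q + q), 1) - frag_of (h q, 1) - frag_of (h q, 1) \<in> ?I"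
        using rel1[OF hc hc, of q q 1] by (simp only: h_add)
      moreover have "frag_of (h q, 0) - frag_of (h q, 1) - frag_of (h q, 1) \<in> ?I"
        using rel2[OF hc, of q 1 1] by simp
      ultimately have "(frag_of (h (q + q), 1) - frag_of (h q, 1) - frag_of (h q, 1))
          - (frag_of (h q, 0) - frag_of (h q, 1) - frag_of (h q, 1)) + frag_of (h q, 0) \<in> ?I"
        using I_add[OF I_diff zero_right[OF hc]] by blast
      then show ?thesis by simp
    qed
    \<comment> \<open>The second entry is 0 or 1; a pair with second entry 0 is congruent to (h 0,
      1), as both lie in the ideal.\<close>
    have normal: "\<exists>p. c - frag_of (h p, 1) \<in> ?I" if "c \<in> carrier ?P" for c
    proof -
      have "Poly_Mapping.keys c \<subseteq> carrier A \<times> carrier ?B" using that by simp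
      then show ?thesis
      proof (induction c rule: frag_induction)
        case zero
        show ?case using I_neg[OF zero_left[of 1]] by (intro exI[of _ 0]) (simp only: diff_0)
      next
        case (one x)
        then obtain p b where x: "x = (h p, b)" using hA by (cases x) auto
        consider "b = 0" | "b = 1" by (cases b) auto
        then show ?case
        proof cases
          case 1
          show ?thesis
            using I_diff[OF zero_right[OF hc, of p] zero_left[of 1]] unfolding x 1 by blast
        next
          case 2
          show ?thesis using I_0 unfolding x 2 by (intro exI[of _ p]) (simp only: diff_self)
        qed
      next
        case (diff c d)
        then obtain p q where pq: "c - frag_of (h p, 1) \<in> ?I" "d - frag_of (h q, 1) \<in> ?I" by blast
        have "h (p - q) \<oplus>\<^bsub>A\<^esub> h q = h p" using h_add[of "p - q" q] by simp
        then have "frag_of (h p, 1) - frag_of (h (p - q), 1) - frag_of (h q, 1) \<in> ?I"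
          using rel1[OF hc hc, of "p - q" q 1] by (simp only:)
        from I_add[OF I_diff[OF pq] this]
        have "(c - frag_of (h p, 1)) - (d - frag_of (h q, 1))
            + (frag_of (h p, 1) - frag_of (h (p - q), 1) - frag_of (h q, 1)) \<in> ?I" .
        also have "(c - frag_of (h p, 1)) - (d - frag_of (h q, 1))
            + (frag_of (h p, 1) - frag_of (h (p - q), 1) - frag_of (h q, 1)) = c - d - frag_of (h (p - q), 1)"
          by simp
        finally show ?case by blast
      qed
    qed
    fix c assume "c \<in> a_kernel ?P ?T \<Psi>"
    then have c: "c \<in> carrier ?P" "frag_sum w c \<in> ?J2" unfolding kernel by blast+
    \<comment> \<open>Passing to the normal form changes \<open>frag_sum w c\<close> only within the
      ideal over F_2, so the assumption on c becomes one on the reduction of p.\<close>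
    obtain p where p: "c - frag_of (h p, 1) \<in> ?I" using normal[OF c(1)] by blast
    then have "c - frag_of (h p, 1) \<in> a_kernel ?P ?T \<Psi>" using \<open>?I \<subseteq> a_kernel ?P ?T \<Psi>\<close> by blast
    then have "frag_sum w c - w (h p, 1) \<in> ?J2" unfolding kernel by (simp add: frag_sum_diff)
    moreover have "w (h p, 1) - reduce2 p \<in> ?J2" using w_h[of p 1] by simp
    ultimately have "frag_sum w c - (frag_sum w c - w (h p, 1)) - (w (h p, 1) - reduce2 p) \<in> ?J2"
      using c(2) J2(5) by blast
    then have "reduce2 p \<in> ?J2" by simp
    then obtain q r where qr: "p = (q + q) + r" "r \<in> ?J" by (rule reduce2_ideal_lift)
    then have "h p = h (q + q)" using h_eq[of p "q + q"] by simp
    then have "frag_of (h p, 1) \<in> ?I" using double[of q] by simp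
    from I_add[OF p this] show "c \<in> ?I" by simp
  qed
  ultimately have ker_eq: "a_kernel ?P ?T \<Psi> = ?I" by blast
  have w_lift: "\<Psi> (frag_of (h p, 1)) = ?J2 +>\<^bsub>class_ring\<^esub> reduce2 p" for p
    unfolding \<Psi>_def coset using w_h[of p 1] by simp
  have frag_carrier: "frag_of (h p, 1) \<in> carrier ?P" for p by (simp add: keys_frag_of hc)
  have surj\<Psi>: "\<Psi> ` carrier ?P = carrier ?T"
  proof
    show "carrier ?T \<subseteq> \<Psi> ` carrier ?P"
    proof
      fix X assume "X \<in> carrier ?T"
      then obtain f where "X = ?J2 +>\<^bsub>class_ring\<^esub> f" using T(1) by blast
      moreover obtain p where "reduce2 p = f" using reduce2_surj by blast
      ultimately have "X = \<Psi> (frag_of (h p, 1))" by (simp add: w_lift)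
      then show "X \<in> \<Psi> ` carrier ?P" using frag_carrier by blast
    qed
  qed (use \<Psi>.hom_closed in blast)
  have hom_sub: "carrier (free_Abelian_group (dA n \<times> carrier ?B)) \<subseteq> carrier ?P" for n
  proof
    fix c assume "c \<in> carrier (free_Abelian_group (dA n \<times> carrier ?B))"
    then have "Poly_Mapping.keys c \<subseteq> dA n \<times> carrier ?B" by simp
    also have "dA n \<times> carrier ?B \<subseteq> carrier A \<times> carrier ?B" using hc unfolding dA by blast
    finally show "c \<in> carrier ?P" by simp
  qed
  have part: "poly2_quot_part C4_relations2 n = \<Psi> ` carrier (free_Abelian_group (dA n \<times> carrier ?B))" for n
  proof
    show "poly2_quot_part C4_relations2 n \<subseteq> \<Psi> ` carrier (free_Abelian_group (dA n \<times> carrier ?B))"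
    proof
      fix X assume "X \<in> poly2_quot_part C4_relations2 n"
      then obtain f where f: "f \<in> homogeneous n" "X = ?J2 +>\<^bsub>class_ring\<^esub> f"
        by (auto simp: poly2_quot_part_def quot_part_def)
      obtain p where p: "reduce2 p = f" "\<And>n. f \<in> homogeneous n \<Longrightarrow> p \<in> homogeneous n"
        using reduce2_surj[of f] by blast
      have "X = \<Psi> (frag_of (h p, 1))" using p(1) f(2) by (simp add: w_lift)
      moreover have "frag_of (h p, 1) \<in> carrier (free_Abelian_group (dA n \<times> carrier ?B))"
        using p(2)[OF f(1)] by (simp add: dA)
      ultimately show "X \<in> \<Psi> ` carrier (free_Abelian_group (dA n \<times> carrier ?B))" by blast
    qed
    show "\<Psi> ` carrier (free_Abelian_group (dA n \<times> carrier ?B)) \<subseteq> poly2_quot_part C4_relations2 n"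
    proof (rule image_subsetI)
      fix c assume "c \<in> carrier (free_Abelian_group (dA n \<times> carrier ?B))"
      then have "Poly_Mapping.keys c \<subseteq> dA n \<times> carrier ?B" by simp
      \<comment> \<open>Since lifts are arbitrary, \<open>frag_sum w c\<close> itself need not be
        homogeneous; a homogeneous representative of its class is built along with c.\<close>
      then have "\<exists>f\<in>homogeneous n. frag_sum w c - f \<in> ?J2"
      proof (induction c rule: frag_induction)
        case zero
        then show ?case using J2(1) by (intro bexI[of _ 0]) (auto simp: homogeneous_def)
      next
        case (one x)
        then obtain p b where x: "x = (h p, b)" "p \<in> homogeneous n" by (auto simp: dA)
        have "Poly_Mapping.single 0 b * reduce2 p \<in> homogeneous n"
          using reduce2_homogeneous[OF x(2)] by (cases b) (simp_all add: homogeneous_def)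
        then show ?case using w_h[of p b] x(1) by auto
      next
        case (diff a b)
        then obtain f g where "f \<in> homogeneous n" "g \<in> homogeneous n"
          "frag_sum w a - f \<in> ?J2" "frag_sum w b - g \<in> ?J2" by blast
        then show ?case using J2(5)[of "frag_sum w a - f" "frag_sum w b - g"]
          by (intro bexI[of _ "f - g"] homogeneous_diff) (simp_all add: frag_sum_diff algebra_simps)
      qed
      then obtain f where "f \<in> homogeneous n" "\<Psi> c = ?J2 +>\<^bsub>class_ring\<^esub> f"
        unfolding \<Psi>_def coset by blast
      then show "\<Psi> c \<in> poly2_quot_part C4_relations2 n"
        by (auto simp: poly2_quot_part_def quot_part_def)
    qed
  qed
  show ?thesis
    unfolding tensor_ring_def tensor_part_def
    by (rule quotient_graded_isomorphic[OF \<Psi> surj\<Psi> ker_eq hom_sub part])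
qed

context C4_squared begin

lemma poly2_filtered_char_ring:
  "poly2_filtered_ring (char_ring G) point_eval (gamma_filtration G)"
proof (intro poly2_filtered_ring.intro poly2_filtered_ring_axioms.intro cring_char_ring)
  show "gamma_filtration G n = point_eval ` order_ge n" for n by (rule gamma_filtration_eq)
qed (rule point_eval_add point_eval_mult point_eval_one point_eval_zero char_ring_range)+

end

theorem theorem1p3:
  fixes C4 :: "('g, 'm) monoid_scheme"
  assumes "group C4" and "cyclic_group C4" and "Coset.order C4 = 4"
  shows
    "(let R = graded_char_ring (C4 \<times>\<times> C4);
          dR = graded_char_part (C4 \<times>\<times> C4);
          x = (var_x :: int poly2); y = (var_y :: int poly2);
          S = {4 * x, 4 * y, 2 * x^2 * y + 2 * x * y^2, x^4 * y^2 - x^2 * y^4}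
      in graded_isomorphic R dR (poly2_quot S) (poly2_quot_part S)) \<and>
     (let R = graded_char_ring (C4 \<times>\<times> C4);
          dR = graded_char_part (C4 \<times>\<times> C4);
          F2 = (class_ring :: bit ring);
          x = (var_x :: bit poly2); y = (var_y :: bit poly2);
          S = {x^4 * y^2 + x^2 * y^4}
      in graded_isomorphic (tensor_ring R F2) (tensor_part R dR F2)
           (poly2_quot S) (poly2_quot_part S))"
proof -
  obtain \<zeta> :: "'g \<Rightarrow> complex" where "bij_betw \<zeta> (carrier C4) {1, \<i>, - 1, - \<i>}"
    "\<And>x y. x \<in> carrier C4 \<Longrightarrow> y \<in> carrier C4 \<Longrightarrow> \<zeta> (x \<otimes>\<^bsub>C4\<^esub> y) = \<zeta> x * \<zeta> y"
    using cyclic_group_4_character[OF assms] by blast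
  then interpret C4: C4_squared C4 \<zeta>
    by (intro C4_squared.intro assms(1)) auto
  let ?G = "C4 \<times>\<times> C4"
  let ?R = "graded_char_ring ?G" and ?dR = "graded_char_part ?G"
  interpret P: poly2_filtered_ring "char_ring ?G" C4.point_eval "gamma_filtration ?G"
    by (rule C4.poly2_filtered_char_ring)
  have h: "ring_hom_ring class_ring ?R P.leading"
    unfolding graded_char_ring_def by (rule P.leading_ring_hom_ring)
  have surj: "range P.leading = carrier ?R"
    unfolding graded_char_ring_def by (rule P.leading_image)
  have ker: "a_kernel class_ring ?R P.leading = Idl\<^bsub>class_ring\<^esub> C4_relations"
    unfolding graded_char_ring_def
    by (rule C4_leading_kernel[OF C4.poly2_filtered_char_ring C4.point_eval_eq_iff])
  have part: "?dR n = P.leading ` homogeneous n" for n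
    unfolding graded_char_part_def by (rule P.leading_part)
  \<comment> \<open>The induced isomorphism starts at the quotient of Z[x,y]; the statement asks for
    the opposite direction, so it is inverted afterwards.\<close>
  have "graded_isomorphic (poly2_quot C4_relations) (poly2_quot_part C4_relations) ?R ?dR"
    unfolding poly2_quot_def poly2_quot_part_def
    by (rule quotient_graded_isomorphic[OF h _ ker _ part]) (use surj in auto)
  then have "graded_isomorphic ?R ?dR (poly2_quot C4_relations) (poly2_quot_part C4_relations)"
  proof (rule graded_isomorphic_sym[rotated])
    show "ring (poly2_quot C4_relations)"
      unfolding poly2_quot_def by (rule ideal.quotient_is_ring[OF ideal_genideal_class_ring])
    show "poly2_quot_part C4_relations n \<subseteq> carrier (poly2_quot C4_relations)" for n
      by (auto simp: poly2_quot_part_def quot_part_def poly2_quot_def FactRing_def A_RCOSETS_def')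
  qed
  moreover have "graded_isomorphic (tensor_ring ?R class_ring) (tensor_part ?R ?dR (class_ring :: bit ring))
      (poly2_quot C4_relations2) (poly2_quot_part C4_relations2)"
    by (rule tensor_bit_graded_isomorphic[OF h surj ker part])
  ultimately show ?thesis by (simp only: Let_def C4_relations_def C4_relations2_def)
qed

end
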